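(* Let $(\mathrm{CoFib}, \mathrm{Fib}, \mathrm{Weq})$ be a model structure on a weakly idempotent complete additive category $\mathcal A$. Then the homotopy category $\mathrm{Ho}(\mathcal A)$ is equivalent, as an additive category, to the additive quotient $(\mathcal C\cap \mathcal F)/(\mathcal C\cap \mathcal F\cap \mathcal W)$, where $\mathcal C$, $\mathcal F$, $\mathcal W$ are respectively the class of cofibrant objects, the class of fibrant objects, and the class of trivial objects (classes of objects being regarded as full subcategories of $\mathcal A$).
   Context: An additive category is weakly idempotent complete if every splitting monomorphism (morphism with a left inverse) has a cokernel, or equivalently every splitting epimorphism (morphism with a right inverse) has a kernel. For morphisms $f:A\to B$, $g:C\to D$ write $f\,\square\, g$ if for all $u:A\to C$, $v:B\to D$ with $gu=vf$ there is $h:B\to C$ with $hf=u$ and $gh=v$. A morphism $g:A'\to B'$ is a retract of $f:A\to B$ if there are $\varphi_1:A'\to A$, $\psi_1:A\to A'$, $\varphi_2:B'\to B$, $\psi_2:B\to B'$ with $f\varphi_1=\varphi_2 g$, $g\psi_1=\psi_2 f$, $\psi_1\varphi_1=\mathrm{Id}_{A'}$, $\psi_2\varphi_2=\mathrm{Id}_{B'}$. A model structure on a category $\mathcal M$ (no existence of limits or colimits is required) is a triple $(\mathrm{CoFib},\mathrm{Fib},\mathrm{Weq})$ of classes of morphisms (cofibrations, fibrations, weak equivalences) such that: (two out of three) for composable $f,g$, if two of $f,g,gf$ are in $\mathrm{Weq}$, so is the third; (retract) each of the three classes is closed under retracts; (lifting) if $f\in\mathrm{CoFib}$, $g\in\mathrm{Fib}$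 and either $f\in\mathrm{Weq}$ or $g\in\mathrm{Weq}$, then $f\,\square\, g$; (factorization) every morphism $f$ admits factorizations $f=pi$ and $f=qj$ with $i\in\mathrm{CoFib}\cap\mathrm{Weq}$, $p\in\mathrm{Fib}$, $j\in\mathrm{CoFib}$, $q\in\mathrm{Fib}\cap\mathrm{Weq}$. An object $X$ is cofibrant if $0\to X$ is in $\mathrm{CoFib}$; fibrant if $X\to 0$ is in $\mathrm{Fib}$; trivial if $0\to X$ is in $\mathrm{Weq}$ (equivalently $X\to 0$ is in $\mathrm{Weq}$). The homotopy category $\mathrm{Ho}(\mathcal A)$ is the localization category $\mathcal A[\mathrm{Weq}^{-1}]$; for $\mathcal A$ additive it is additive and the localization functor is additive. For an additive category $\mathcal B$ and a full additive subcategory $\mathcal U$ (a full subcategory closed under finite coproducts), $\mathcal B/\mathcal U$ has the same objects as $\mathcal B$, and $\mathrm{Hom}_{\mathcal B/\mathcal U}(X,Y)$ is $\mathrm{Hom}_{\mathcal B}(X,Y)$ modulo the subgroup of morphisms factoring through an object of $\mathcal U$. *)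

theory Defs
  imports "HOL-Algebra.Group"
begin

section \<open>Categories\<close>

record ('o, 'a) cat =
  Obj :: "'o set"
  Arr :: "'a set"
  Dom :: "'a \<Rightarrow> 'o"
  Cod :: "'a \<Rightarrow> 'o"
  Ide :: "'o \<Rightarrow> 'a"
  Comp :: "'a \<Rightarrow> 'a \<Rightarrow> 'a" (infixl \<open>\<cdot>\<index>\<close> 70)

definition Hom :: "('o, 'a, 'z) cat_scheme \<Rightarrow> 'o \<Rightarrow> 'o \<Rightarrow> 'a set" where
  "Hom C X Y = {f \<in> Arr C. Dom C f = X \<and> Cod C f = Y}"

definition is_category :: "('o, 'a, 'z) cat_scheme \<Rightarrow> bool" where
  "is_category C \<longleftrightarrow>
     (\<forall>f\<in>Arr C. Dom C f \<in> Obj C \<and> Cod C f \<in> Obj C) \<and>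
     (\<forall>X\<in>Obj C. Ide C X \<in> Hom C X X) \<and>
     (\<forall>f\<in>Arr C. \<forall>g\<in>Arr C. Cod C f = Dom C g \<longrightarrow> g \<cdot>\<^bsub>C\<^esub> f \<in> Hom C (Dom C f) (Cod C g)) \<and>
     (\<forall>f\<in>Arr C. f \<cdot>\<^bsub>C\<^esub> Ide C (Dom C f) = f \<and> Ide C (Cod C f) \<cdot>\<^bsub>C\<^esub> f = f) \<and>
     (\<forall>f\<in>Arr C. \<forall>g\<in>Arr C. \<forall>h\<in>Arr C. Cod C f = Dom C g \<and> Cod C g = Dom C h \<longrightarrow>
        (h \<cdot>\<^bsub>C\<^esub> g) \<cdot>\<^bsub>C\<^esub> f = h \<cdot>\<^bsub>C\<^esub> (g \<cdot>\<^bsub>C\<^esub> f))"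

definition is_iso :: "('o, 'a, 'z) cat_scheme \<Rightarrow> 'a \<Rightarrow> bool" where
  "is_iso C f \<longleftrightarrow> f \<in> Arr C \<and>
     (\<exists>g\<in>Hom C (Cod C f) (Dom C f).
        g \<cdot>\<^bsub>C\<^esub> f = Ide C (Dom C f) \<and> f \<cdot>\<^bsub>C\<^esub> g = Ide C (Cod C f))"

definition full_subcat :: "('o, 'a, 'z) cat_scheme \<Rightarrow> 'o set \<Rightarrow> ('o, 'a, 'z) cat_scheme" where
  "full_subcat C S =
     C\<lparr>Obj := Obj C \<inter> S, Arr := {f \<in> Arr C. Dom C f \<in> S \<and> Cod C f \<in> S}\<rparr>"

record ('o, 'a, 'p, 'b) cat_functor =
  FObj :: "'o \<Rightarrow> 'p"
  FArr :: "'a \<Rightarrow> 'b"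

definition is_functor ::
  "('o, 'a, 'z) cat_scheme \<Rightarrow> ('p, 'b, 'y) cat_scheme \<Rightarrow> ('o, 'a, 'p, 'b) cat_functor \<Rightarrow> bool"
where
  "is_functor C D F \<longleftrightarrow>
     (\<forall>X\<in>Obj C. FObj F X \<in> Obj D) \<and>
     (\<forall>f\<in>Arr C. FArr F f \<in> Hom D (FObj F (Dom C f)) (FObj F (Cod C f))) \<and>
     (\<forall>X\<in>Obj C. FArr F (Ide C X) = Ide D (FObj F X)) \<and>
     (\<forall>f\<in>Arr C. \<forall>g\<in>Arr C. Cod C f = Dom C g \<longrightarrow>
        FArr F (g \<cdot>\<^bsub>C\<^esub> f) = FArr F g \<cdot>\<^bsub>D\<^esub> FArr F f)"

definition id_functor :: "('o, 'a, 'o, 'a) cat_functor" where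
  "id_functor = \<lparr>FObj = (\<lambda>X. X), FArr = (\<lambda>f. f)\<rparr>"

definition comp_functor ::
  "('p, 'b, 'q, 'c) cat_functor \<Rightarrow> ('o, 'a, 'p, 'b) cat_functor \<Rightarrow> ('o, 'a, 'q, 'c) cat_functor"
where
  "comp_functor G F = \<lparr>FObj = FObj G \<circ> FObj F, FArr = FArr G \<circ> FArr F\<rparr>"

definition naturally_isomorphic ::
  "('o, 'a, 'z) cat_scheme \<Rightarrow> ('p, 'b, 'y) cat_scheme \<Rightarrow>
   ('o, 'a, 'p, 'b) cat_functor \<Rightarrow> ('o, 'a, 'p, 'b) cat_functor \<Rightarrow> bool"
where
  "naturally_isomorphic C D F G \<longleftrightarrow>
     (\<exists>\<eta>. (\<forall>X\<in>Obj C. \<eta> X \<in> Hom D (FObj F X) (FObj G X) \<and> is_iso D (\<eta> X)) \<and>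
          (\<forall>f\<in>Arr C. \<eta> (Cod C f) \<cdot>\<^bsub>D\<^esub> FArr F f = FArr G f \<cdot>\<^bsub>D\<^esub> \<eta> (Dom C f)))"


section \<open>Additive categories\<close>

record ('o, 'a) add_cat = "('o, 'a) cat" +
  Add :: "'a \<Rightarrow> 'a \<Rightarrow> 'a" (infixl \<open>\<oplus>\<index>\<close> 65)
  Zero :: "'o \<Rightarrow> 'o \<Rightarrow> 'a"

definition hom_group :: "('o, 'a, 'z) add_cat_scheme \<Rightarrow> 'o \<Rightarrow> 'o \<Rightarrow> 'a monoid" where
  "hom_group C X Y = \<lparr>carrier = Hom C X Y, mult = Add C, one = Zero C X Y\<rparr>"

definition preadditive_category :: "('o, 'a, 'z) add_cat_scheme \<Rightarrow> bool" where
  "preadditive_category C \<longleftrightarrow> is_category C \<and>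
     (\<forall>X\<in>Obj C. \<forall>Y\<in>Obj C. comm_group (hom_group C X Y)) \<and>
     (\<forall>X\<in>Obj C. \<forall>Y\<in>Obj C. \<forall>Z\<in>Obj C.
        (\<forall>f\<in>Hom C X Y. \<forall>g\<in>Hom C Y Z. \<forall>g'\<in>Hom C Y Z.
           (g \<oplus>\<^bsub>C\<^esub> g') \<cdot>\<^bsub>C\<^esub> f = (g \<cdot>\<^bsub>C\<^esub> f) \<oplus>\<^bsub>C\<^esub> (g' \<cdot>\<^bsub>C\<^esub> f)) \<and>
        (\<forall>f\<in>Hom C X Y. \<forall>f'\<in>Hom C X Y. \<forall>g\<in>Hom C Y Z.
           g \<cdot>\<^bsub>C\<^esub> (f \<oplus>\<^bsub>C\<^esub> f') = (g \<cdot>\<^bsub>C\<^esub> f) \<oplus>\<^bsub>C\<^esub> (g \<cdot>\<^bsub>C\<^esub> f')))"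

definition zero_object :: "('o, 'a, 'z) cat_scheme \<Rightarrow> 'o \<Rightarrow> bool" where
  "zero_object C Z \<longleftrightarrow> Z \<in> Obj C \<and>
     (\<forall>X\<in>Obj C. (\<exists>!f. f \<in> Hom C Z X) \<and> (\<exists>!f. f \<in> Hom C X Z))"

definition biproduct ::
  "('o, 'a, 'z) add_cat_scheme \<Rightarrow> 'o \<Rightarrow> 'o \<Rightarrow> 'o \<Rightarrow> 'a \<Rightarrow> 'a \<Rightarrow> 'a \<Rightarrow> 'a \<Rightarrow> bool"
where
  "biproduct C X Y P i j p q \<longleftrightarrow>
     X \<in> Obj C \<and> Y \<in> Obj C \<and> P \<in> Obj C \<and>
     i \<in> Hom C X P \<and> j \<in> Hom C Y P \<and> p \<in> Hom C P X \<and> q \<in> Hom C P Y \<and>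
     p \<cdot>\<^bsub>C\<^esub> i = Ide C X \<and> q \<cdot>\<^bsub>C\<^esub> j = Ide C Y \<and>
     q \<cdot>\<^bsub>C\<^esub> i = Zero C X Y \<and> p \<cdot>\<^bsub>C\<^esub> j = Zero C Y X \<and>
     (i \<cdot>\<^bsub>C\<^esub> p) \<oplus>\<^bsub>C\<^esub> (j \<cdot>\<^bsub>C\<^esub> q) = Ide C P"

definition additive_category :: "('o, 'a, 'z) add_cat_scheme \<Rightarrow> bool" where
  "additive_category C \<longleftrightarrow> preadditive_category C \<and>
     (\<exists>Z. zero_object C Z) \<and>
     (\<forall>X\<in>Obj C. \<forall>Y\<in>Obj C. \<exists>P i j p q. biproduct C X Y P i j p q)"

definition additive_functor ::
  "('o, 'a, 'z) add_cat_scheme \<Rightarrow> ('p, 'b, 'y) add_cat_scheme \<Rightarrow>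
   ('o, 'a, 'p, 'b) cat_functor \<Rightarrow> bool"
where
  "additive_functor C D F \<longleftrightarrow> is_functor C D F \<and>
     (\<forall>X\<in>Obj C. \<forall>Y\<in>Obj C. \<forall>f\<in>Hom C X Y. \<forall>g\<in>Hom C X Y.
        FArr F (f \<oplus>\<^bsub>C\<^esub> g) = FArr F f \<oplus>\<^bsub>D\<^esub> FArr F g)"

definition additively_equivalent ::
  "('o, 'a, 'z) add_cat_scheme \<Rightarrow> ('p, 'b, 'y) add_cat_scheme \<Rightarrow> bool"
where
  "additively_equivalent C D \<longleftrightarrow> additive_category C \<and> additive_category D \<and>
     (\<exists>F G. additive_functor C D F \<and> additive_functor D C G \<and>
        naturally_isomorphic C C (comp_functor G F) id_functor \<and>
        naturally_isomorphic D D (comp_functor F G) id_functor)"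

definition split_mono :: "('o, 'a, 'z) cat_scheme \<Rightarrow> 'a \<Rightarrow> bool" where
  "split_mono C f \<longleftrightarrow> f \<in> Arr C \<and>
     (\<exists>r\<in>Hom C (Cod C f) (Dom C f). r \<cdot>\<^bsub>C\<^esub> f = Ide C (Dom C f))"

definition cokernel :: "('o, 'a, 'z) add_cat_scheme \<Rightarrow> 'a \<Rightarrow> 'a \<Rightarrow> bool" where
  "cokernel C f c \<longleftrightarrow> c \<in> Arr C \<and> Dom C c = Cod C f \<and>
     c \<cdot>\<^bsub>C\<^esub> f = Zero C (Dom C f) (Cod C c) \<and>
     (\<forall>t\<in>Arr C. Dom C t = Cod C f \<and> t \<cdot>\<^bsub>C\<^esub> f = Zero C (Dom C f) (Cod C t) \<longrightarrow>
        (\<exists>!u. u \<in> Hom C (Cod C c) (Cod C t) \<and> u \<cdot>\<^bsub>C\<^esub> c = t))"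

definition weakly_idempotent_complete :: "('o, 'a, 'z) add_cat_scheme \<Rightarrow> bool" where
  "weakly_idempotent_complete C \<longleftrightarrow> (\<forall>f. split_mono C f \<longrightarrow> (\<exists>c. cokernel C f c))"

text \<open>
  In an additive category the coproducts of two objects are exactly the biproducts, and the
  empty coproducts are exactly the zero objects.  As a coproduct is only determined up to
  isomorphism, closure is required for all of them.
\<close>

definition full_additive_subcategory :: "('o, 'a, 'z) add_cat_scheme \<Rightarrow> 'o set \<Rightarrow> bool" where
  "full_additive_subcategory C U \<longleftrightarrow> U \<subseteq> Obj C \<and>
     (\<forall>Z. zero_object C Z \<longrightarrow> Z \<in> U) \<and>
     (\<forall>X\<in>U. \<forall>Y\<in>U. \<forall>P i j p q. biproduct C X Y P i j p q \<longrightarrow> P \<in> U)"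


section \<open>Quotients of categories\<close>

text \<open>
  Here \<open>R\<close> is meant to be a congruence: an equivalence relation on the arrows that only relates
  parallel arrows and is compatible with composition.  Arrows of the quotient are equivalence
  classes; the choice of representatives is then immaterial.
\<close>

definition quotient_cat ::
  "('o, 'a, 'z) cat_scheme \<Rightarrow> ('a \<times> 'a) set \<Rightarrow> ('o, 'a set) cat"
where
  "quotient_cat C R =
     \<lparr>Obj = Obj C,
      Arr = Arr C // R,
      Dom = (\<lambda>c. Dom C (SOME f. f \<in> c)),
      Cod = (\<lambda>c. Cod C (SOME f. f \<in> c)),
      Ide = (\<lambda>X. R `` {Ide C X}),
      Comp = (\<lambda>d c. R `` {(SOME g. g \<in> d) \<cdot>\<^bsub>C\<^esub> (SOME f. f \<in> c)})\<rparr>"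

definition factors_through :: "('o, 'a, 'z) cat_scheme \<Rightarrow> 'o set \<Rightarrow> 'a \<Rightarrow> bool" where
  "factors_through C U h \<longleftrightarrow> h \<in> Arr C \<and>
     (\<exists>Z\<in>U. \<exists>a\<in>Hom C (Dom C h) Z. \<exists>b\<in>Hom C Z (Cod C h). h = b \<cdot>\<^bsub>C\<^esub> a)"

definition ideal_rel :: "('o, 'a, 'z) add_cat_scheme \<Rightarrow> 'o set \<Rightarrow> ('a \<times> 'a) set" where
  "ideal_rel C U = {(f, g). \<exists>X\<in>Obj C. \<exists>Y\<in>Obj C. f \<in> Hom C X Y \<and> g \<in> Hom C X Y \<and>
     (\<exists>h\<in>Hom C X Y. factors_through C U h \<and> f = g \<oplus>\<^bsub>C\<^esub> h)}"

text \<open>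
  The two arguments of \<open>add_cat.fields\<close> are the addition and the zero morphisms of the quotient.
\<close>

definition additive_quotient ::
  "('o, 'a, 'z) add_cat_scheme \<Rightarrow> 'o set \<Rightarrow> ('o, 'a set) add_cat"
where
  "additive_quotient C U =
     cat.extend (quotient_cat C (ideal_rel C U))
       (add_cat.fields
          (\<lambda>c d. ideal_rel C U `` {(SOME f. f \<in> c) \<oplus>\<^bsub>C\<^esub> (SOME g. g \<in> d)})
          (\<lambda>X Y. ideal_rel C U `` {Zero C X Y}))"


section \<open>Localization\<close>

text \<open>
  The Gabriel--Zisman construction of \<open>C[W\<inverse>]\<close>: paths of arrows of \<open>C\<close> and formal inverses of
  arrows in \<open>W\<close>, listed in the order in which they are traversed, modulo the congruence
  generated by the evident relations.
\<close>

datatype 'a step = Fwd 'a | Bwd 'a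

fun is_path ::
  "('o, 'a, 'z) cat_scheme \<Rightarrow> 'a set \<Rightarrow> 'o \<Rightarrow> 'a step list \<Rightarrow> 'o \<Rightarrow> bool"
where
  "is_path C W X [] Y \<longleftrightarrow> X \<in> Obj C \<and> X = Y"
| "is_path C W X (Fwd f # ss) Y \<longleftrightarrow> f \<in> Arr C \<and> Dom C f = X \<and> is_path C W (Cod C f) ss Y"
| "is_path C W X (Bwd w # ss) Y \<longleftrightarrow>
     w \<in> Arr C \<inter> W \<and> Cod C w = X \<and> is_path C W (Dom C w) ss Y"

type_synonym ('o, 'a) path = "'o \<times> 'a step list \<times> 'o"

definition path_cat ::
  "('o, 'a, 'z) cat_scheme \<Rightarrow> 'a set \<Rightarrow> ('o, ('o, 'a) path) cat"
where
  "path_cat C W =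
     \<lparr>Obj = Obj C,
      Arr = {(X, ss, Y). is_path C W X ss Y},
      Dom = (\<lambda>(X, ss, Y). X),
      Cod = (\<lambda>(X, ss, Y). Y),
      Ide = (\<lambda>X. (X, [], X)),
      Comp = (\<lambda>(Y', tt, Z) (X, ss, Y). (X, ss @ tt, Z))\<rparr>"

inductive_set generated_congruence ::
  "('o, 'a, 'z) cat_scheme \<Rightarrow> ('a \<times> 'a) set \<Rightarrow> ('a \<times> 'a) set"
  for C :: "('o, 'a, 'z) cat_scheme" and R :: "('a \<times> 'a) set"
where
  base: "(f, g) \<in> R \<Longrightarrow> f \<in> Hom C X Y \<Longrightarrow> g \<in> Hom C X Y \<Longrightarrow> (f, g) \<in> generated_congruence C R"
| refl: "f \<in> Arr C \<Longrightarrow> (f, f) \<in> generated_congruence C R"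
| sym: "(f, g) \<in> generated_congruence C R \<Longrightarrow> (g, f) \<in> generated_congruence C R"
| trans: "(f, g) \<in> generated_congruence C R \<Longrightarrow> (g, h) \<in> generated_congruence C R \<Longrightarrow>
    (f, h) \<in> generated_congruence C R"
| comp: "(f, f') \<in> generated_congruence C R \<Longrightarrow> (g, g') \<in> generated_congruence C R \<Longrightarrow>
    Cod C f = Dom C g \<Longrightarrow> (g \<cdot>\<^bsub>C\<^esub> f, g' \<cdot>\<^bsub>C\<^esub> f') \<in> generated_congruence C R"

definition localization_rel ::
  "('o, 'a, 'z) cat_scheme \<Rightarrow> 'a set \<Rightarrow> (('o, 'a) path \<times> ('o, 'a) path) set"
where
  "localization_rel C W = generated_congruence (path_cat C W)
     ({((X, [Fwd (Ide C X)], X), (X, [], X)) | X. X \<in> Obj C} \<union>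
      {((Dom C f, [Fwd f, Fwd g], Cod C g), (Dom C f, [Fwd (g \<cdot>\<^bsub>C\<^esub> f)], Cod C g)) | f g.
         f \<in> Arr C \<and> g \<in> Arr C \<and> Cod C f = Dom C g} \<union>
      {((Dom C w, [Fwd w, Bwd w], Dom C w), (Dom C w, [], Dom C w)) | w. w \<in> Arr C \<inter> W} \<union>
      {((Cod C w, [Bwd w, Fwd w], Cod C w), (Cod C w, [], Cod C w)) | w. w \<in> Arr C \<inter> W})"

definition localization ::
  "('o, 'a, 'z) cat_scheme \<Rightarrow> 'a set \<Rightarrow> ('o, ('o, 'a) path set) cat"
where
  "localization C W = quotient_cat (path_cat C W) (localization_rel C W)"

definition localization_functor ::
  "('o, 'a, 'z) cat_scheme \<Rightarrow> 'a set \<Rightarrow> ('o, 'a, 'o, ('o, 'a) path set) cat_functor"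
where
  "localization_functor C W =
     \<lparr>FObj = (\<lambda>X. X), FArr = (\<lambda>f. localization_rel C W `` {(Dom C f, [Fwd f], Cod C f)})\<rparr>"

text \<open>
  \<open>H\<close> is the category \<open>C[W\<inverse>]\<close> together with an addition on its Hom-sets making it an additive
  category and the localization functor additive.  For a general \<open>W\<close> no such addition need exist.
\<close>

definition additive_localization ::
  "('o, 'a, 'z) add_cat_scheme \<Rightarrow> 'a set \<Rightarrow> ('o, ('o, 'a) path set) add_cat \<Rightarrow> bool"
where
  "additive_localization C W H \<longleftrightarrow> cat.truncate H = localization C W \<and>
     additive_category H \<and> additive_functor C H (localization_functor C W)"


section \<open>Model structures\<close>

definition lifts :: "('o, 'a, 'z) cat_scheme \<Rightarrow> 'a \<Rightarrow> 'a \<Rightarrow> bool" where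
  "lifts C f g \<longleftrightarrow>
     (\<forall>u\<in>Hom C (Dom C f) (Dom C g). \<forall>v\<in>Hom C (Cod C f) (Cod C g).
        g \<cdot>\<^bsub>C\<^esub> u = v \<cdot>\<^bsub>C\<^esub> f \<longrightarrow>
        (\<exists>h\<in>Hom C (Cod C f) (Dom C g). h \<cdot>\<^bsub>C\<^esub> f = u \<and> g \<cdot>\<^bsub>C\<^esub> h = v))"

definition retract_of :: "('o, 'a, 'z) cat_scheme \<Rightarrow> 'a \<Rightarrow> 'a \<Rightarrow> bool" where
  "retract_of C g f \<longleftrightarrow> g \<in> Arr C \<and> f \<in> Arr C \<and>
     (\<exists>\<phi>1\<in>Hom C (Dom C g) (Dom C f). \<exists>\<psi>1\<in>Hom C (Dom C f) (Dom C g).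
      \<exists>\<phi>2\<in>Hom C (Cod C g) (Cod C f). \<exists>\<psi>2\<in>Hom C (Cod C f) (Cod C g).
        f \<cdot>\<^bsub>C\<^esub> \<phi>1 = \<phi>2 \<cdot>\<^bsub>C\<^esub> g \<and> g \<cdot>\<^bsub>C\<^esub> \<psi>1 = \<psi>2 \<cdot>\<^bsub>C\<^esub> f \<and>
        \<psi>1 \<cdot>\<^bsub>C\<^esub> \<phi>1 = Ide C (Dom C g) \<and> \<psi>2 \<cdot>\<^bsub>C\<^esub> \<phi>2 = Ide C (Cod C g))"

definition two_out_of_three :: "('o, 'a, 'z) cat_scheme \<Rightarrow> 'a set \<Rightarrow> bool" where
  "two_out_of_three C W \<longleftrightarrow>
     (\<forall>f\<in>Arr C. \<forall>g\<in>Arr C. Cod C f = Dom C g \<longrightarrow>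
        (f \<in> W \<and> g \<in> W \<longrightarrow> g \<cdot>\<^bsub>C\<^esub> f \<in> W) \<and>
        (f \<in> W \<and> g \<cdot>\<^bsub>C\<^esub> f \<in> W \<longrightarrow> g \<in> W) \<and>
        (g \<in> W \<and> g \<cdot>\<^bsub>C\<^esub> f \<in> W \<longrightarrow> f \<in> W))"

definition retract_closed :: "('o, 'a, 'z) cat_scheme \<Rightarrow> 'a set \<Rightarrow> bool" where
  "retract_closed C M \<longleftrightarrow> (\<forall>f g. f \<in> M \<and> retract_of C g f \<longrightarrow> g \<in> M)"

definition factorizations :: "('o, 'a, 'z) cat_scheme \<Rightarrow> 'a set \<Rightarrow> 'a set \<Rightarrow> bool" where
  "factorizations C L R \<longleftrightarrow>
     (\<forall>f\<in>Arr C. \<exists>i\<in>L. \<exists>p\<in>R. Dom C i = Dom C f \<and> Cod C i = Dom C p \<and> Cod C p = Cod C f \<and>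
        f = p \<cdot>\<^bsub>C\<^esub> i)"

definition model_structure ::
  "('o, 'a, 'z) cat_scheme \<Rightarrow> 'a set \<Rightarrow> 'a set \<Rightarrow> 'a set \<Rightarrow> bool"
where
  "model_structure C CoFib Fib Weq \<longleftrightarrow>
     CoFib \<subseteq> Arr C \<and> Fib \<subseteq> Arr C \<and> Weq \<subseteq> Arr C \<and>
     two_out_of_three C Weq \<and>
     retract_closed C CoFib \<and> retract_closed C Fib \<and> retract_closed C Weq \<and>
     (\<forall>f\<in>CoFib. \<forall>g\<in>Fib. f \<in> Weq \<or> g \<in> Weq \<longrightarrow> lifts C f g) \<and>
     factorizations C (CoFib \<inter> Weq) Fib \<and>
     factorizations C CoFib (Fib \<inter> Weq)"

text \<open>
  All zero objects are isomorphic and the three classes are closed under retracts, so it does not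
  matter which zero object is used.
\<close>

definition cofibrant_objects :: "('o, 'a, 'z) cat_scheme \<Rightarrow> 'a set \<Rightarrow> 'o set" where
  "cofibrant_objects C CoFib =
     {X \<in> Obj C. \<exists>Z f. zero_object C Z \<and> f \<in> Hom C Z X \<and> f \<in> CoFib}"

definition fibrant_objects :: "('o, 'a, 'z) cat_scheme \<Rightarrow> 'a set \<Rightarrow> 'o set" where
  "fibrant_objects C Fib =
     {X \<in> Obj C. \<exists>Z f. zero_object C Z \<and> f \<in> Hom C X Z \<and> f \<in> Fib}"

definition trivial_objects :: "('o, 'a, 'z) cat_scheme \<Rightarrow> 'a set \<Rightarrow> 'o set" where
  "trivial_objects C Weq =
     {X \<in> Obj C. \<exists>Z f. zero_object C Z \<and> f \<in> Hom C Z X \<and> f \<in> Weq}"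

end

theory Submission
  imports Defs
begin

text \<open>
  In an additive category \<open>f\<close> and \<open>g\<close> are compared through \<open>f - g\<close>, so no cylinder or path objects
  are needed: a map out of a cofibrant object that is killed by a trivial fibration extends over a
  cone \<open>X \<rightarrow> K\<close>, a cofibration with \<open>K \<rightarrow> 0\<close> a trivial fibration, and such a \<open>K\<close> lies in
  \<open>\<C> \<inter> \<F> \<inter> \<W>\<close>; dually for maps killed by a trivial cofibration.
  Hence weak equivalences between objects of \<open>\<C> \<inter> \<F>\<close> become invertible in the quotient \<open>B\<close>, and
  the cofibrant-fibrant replacement \<open>X \<leftarrow> Q X \<rightarrow> R X\<close> is an additive functor \<open>\<A> \<rightarrow> B\<close> inverting
  weak equivalences, which extends to \<open>Ho(\<A>) \<rightarrow> B\<close>.  Conversely a map through an object \<open>K\<close> of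
  \<open>\<C> \<inter> \<F> \<inter> \<W>\<close> vanishes in \<open>Ho(\<A>)\<close> because \<open>X \<oplus> K \<rightarrow> X\<close> is a weak equivalence, which gives
  \<open>B \<rightarrow> Ho(\<A>)\<close>.  The zigzags \<open>X \<leftarrow> Q X \<rightarrow> R X\<close> make the two functors inverse to each other.
\<close>

section \<open>Categories and functors\<close>

text \<open>Lifts are not unique and factorizations need not be functorial, so replacing arrows
  gives a relation on \<open>A\<close>, not a functor. That relation is linear: sums of lifts are
  lifts of sums. Independence of the chosen lift therefore reduces to replacements of the zero map,
  which are handled by one cone followed by one cocone. The second obstacle is the addition on the
  localization, since classes of paths carry no visible one. The equivalence of plain categories
  comes first; being fully faithful, it transports the addition of the quotient back, so an additive
  localization exists. The theorem also speaks of every other addition \<open>H\<close> making the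
  localization functor additive. There the functor from the quotient is additive because the
  localization functor is, and its quasi-inverse inherits additivity, so two additions are never
  compared. Functors out of the localization are defined on paths; natural transformations between
  them are checked on arrows of \<open>A\<close> only.\<close>

locale category =
  fixes C :: "('o, 'a, 'z) cat_scheme" (structure)
  assumes is_category: "is_category C"
begin

lemma Dom_Obj [simp]: "f \<in> Arr C \<Longrightarrow> Dom C f \<in> Obj C"
  and Cod_Obj [simp]: "f \<in> Arr C \<Longrightarrow> Cod C f \<in> Obj C"
  and Ide_Arr [simp]: "X \<in> Obj C \<Longrightarrow> Ide C X \<in> Arr C"
  and Dom_Ide [simp]: "X \<in> Obj C \<Longrightarrow> Dom C (Ide C X) = X"
  and Cod_Ide [simp]: "X \<in> Obj C \<Longrightarrow> Cod C (Ide C X) = X"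
  using is_category by (auto simp: is_category_def Hom_def)

lemma Comp_Arr [simp]: "f \<in> Arr C \<Longrightarrow> g \<in> Arr C \<Longrightarrow> Cod C f = Dom C g \<Longrightarrow> g \<cdot> f \<in> Arr C"
  and Dom_Comp [simp]: "f \<in> Arr C \<Longrightarrow> g \<in> Arr C \<Longrightarrow> Cod C f = Dom C g \<Longrightarrow> Dom C (g \<cdot> f) = Dom C f"
  and Cod_Comp [simp]: "f \<in> Arr C \<Longrightarrow> g \<in> Arr C \<Longrightarrow> Cod C f = Dom C g \<Longrightarrow> Cod C (g \<cdot> f) = Cod C g"
  using is_category by (auto simp: is_category_def Hom_def)

lemma Comp_Ide [simp]: "f \<in> Arr C \<Longrightarrow> Dom C f = X \<Longrightarrow> f \<cdot> Ide C X = f"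
  and Ide_Comp [simp]: "f \<in> Arr C \<Longrightarrow> Cod C f = X \<Longrightarrow> Ide C X \<cdot> f = f"
  using is_category by (auto simp: is_category_def)

lemma Comp_assoc [simp]:
  "f \<in> Arr C \<Longrightarrow> g \<in> Arr C \<Longrightarrow> h \<in> Arr C \<Longrightarrow> Cod C f = Dom C g \<Longrightarrow> Cod C g = Dom C h \<Longrightarrow>
    (h \<cdot> g) \<cdot> f = h \<cdot> (g \<cdot> f)"
  using is_category unfolding is_category_def by blast

text \<open>The simplifier nests composites to the right, which hides a known composite
  \<open>g \<cdot> f\<close> inside \<open>g \<cdot> (f \<cdot> x)\<close>. This form lets an
  equation act there.\<close>

lemma Comp_reassoc:
  "g \<cdot> f = k \<Longrightarrow> f \<in> Arr C \<Longrightarrow> g \<in> Arr C \<Longrightarrow> Cod C f = Dom C g \<Longrightarrow>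
    x \<in> Arr C \<Longrightarrow> Cod C x = Dom C f \<Longrightarrow> g \<cdot> (f \<cdot> x) = k \<cdot> x"
  by (metis Comp_assoc)

lemma Hom_Obj: "f \<in> Hom C X Y \<Longrightarrow> X \<in> Obj C \<and> Y \<in> Obj C"
  by (auto simp: Hom_def)

lemma Comp_Hom: "f \<in> Hom C X Y \<Longrightarrow> g \<in> Hom C Y Z \<Longrightarrow> g \<cdot> f \<in> Hom C X Z"
  by (auto simp: Hom_def)

lemma Ide_Hom: "X \<in> Obj C \<Longrightarrow> Ide C X \<in> Hom C X X"
  by (auto simp: Hom_def)

lemma is_isoI:
  assumes "f \<in> Hom C X Y" "g \<in> Hom C Y X" "g \<cdot> f = Ide C X" "f \<cdot> g = Ide C Y"
  shows "is_iso C f"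
  using assms unfolding is_iso_def Hom_def by auto

lemma is_isoE:
  assumes "is_iso C f" "f \<in> Hom C X Y"
  obtains g where "g \<in> Hom C Y X" "g \<cdot> f = Ide C X" "f \<cdot> g = Ide C Y"
  using assms unfolding is_iso_def Hom_def by auto

lemma is_iso_Comp:
  assumes "is_iso C f" "is_iso C g" "f \<in> Hom C X Y" "g \<in> Hom C Y Z"
  shows "is_iso C (g \<cdot> f)"
proof -
  obtain f' where f': "f' \<in> Hom C Y X" "f' \<cdot> f = Ide C X" "f \<cdot> f' = Ide C Y"
    using assms by (blast elim: is_isoE)
  obtain g' where g': "g' \<in> Hom C Z Y" "g' \<cdot> g = Ide C Y" "g \<cdot> g' = Ide C Z"
    using assms by (blast elim: is_isoE)
  show ?thesis
    by (rule is_isoI[of _ X Z "f' \<cdot> g'"])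
      (use assms(3,4) f' g' in \<open>simp_all add: Hom_def Comp_reassoc[OF f'(2)] Comp_reassoc[OF g'(2)]
         Comp_reassoc[OF f'(3)] Comp_reassoc[OF g'(3)]\<close>)
qed

text \<open>The inverse is made a function of the arrow because evaluating a path must name one for
  each backward step.\<close>

definition inverse_arr :: "'a \<Rightarrow> 'a" where
  "inverse_arr f = (SOME g. g \<in> Hom C (Cod C f) (Dom C f) \<and>
     g \<cdot> f = Ide C (Dom C f) \<and> f \<cdot> g = Ide C (Cod C f))"

lemma inverse_arr:
  assumes "is_iso C f" "f \<in> Hom C X Y"
  shows "inverse_arr f \<in> Hom C Y X" "inverse_arr f \<cdot> f = Ide C X" "f \<cdot> inverse_arr f = Ide C Y"
    "is_iso C (inverse_arr f)"
proof -
  have "inverse_arr f \<in> Hom C (Cod C f) (Dom C f) \<and>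
     inverse_arr f \<cdot> f = Ide C (Dom C f) \<and> f \<cdot> inverse_arr f = Ide C (Cod C f)"
    unfolding inverse_arr_def by (rule someI_ex) (use assms in \<open>auto simp: is_iso_def\<close>)
  then show *: "inverse_arr f \<in> Hom C Y X" "inverse_arr f \<cdot> f = Ide C X" "f \<cdot> inverse_arr f = Ide C Y"
    using assms by (auto simp: Hom_def)
  then show "is_iso C (inverse_arr f)" using assms(2) by (blast intro: is_isoI)
qed

text \<open>Reversal of two opposite invertible sides of a commutative square. It gives naturality
  of inverse transformations, of formal inverses in the localization, and of zigzags with a backward
  leg.\<close>

lemma inverse_square:
  assumes "f \<in> Hom C X Y" "f' \<in> Hom C Y X" "f \<cdot> f' = Ide C Y" "f' \<cdot> f = Ide C X"
    and "g \<in> Hom C X' Y'" "g' \<in> Hom C Y' X'" "g' \<cdot> g = Ide C X'"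
    and "u \<in> Hom C X X'" "v \<in> Hom C Y Y'" "v \<cdot> f = g \<cdot> u"
  shows "u \<cdot> f' = g' \<cdot> v"
proof -
  have "g' \<cdot> v = g' \<cdot> (v \<cdot> (f \<cdot> f'))" using assms by (simp add: Hom_def)
  also have "\<dots> = g' \<cdot> (g \<cdot> (u \<cdot> f'))"
    using assms(1,2,5,6,8,9) Comp_reassoc[OF assms(10)] by (simp add: Hom_def)
  also have "\<dots> = u \<cdot> f'"
    using assms(1,2,5,6,8,9) Comp_reassoc[OF assms(7)] by (simp add: Hom_def)
  finally show ?thesis by simp
qed

end

text \<open>An additive localization \<open>H\<close> is tied to the localization only through
  \<open>cat.truncate H\<close>. These rules carry category, functor and isomorphism facts across
  that equation.\<close>

lemma is_category_truncate [simp]: "is_category (cat.truncate H) = is_category H"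
  by (simp add: is_category_def Hom_def cat.truncate_def)

lemma Hom_truncate [simp]: "Hom (cat.truncate H) X Y = Hom H X Y"
  by (simp add: Hom_def cat.truncate_def)

lemma is_iso_truncate [simp]: "is_iso (cat.truncate H) f = is_iso H f"
  by (simp add: is_iso_def Hom_def cat.truncate_def)

lemma truncate_simps [simp]:
  "Obj (cat.truncate H) = Obj H" "Arr (cat.truncate H) = Arr H"
  "Dom (cat.truncate H) = Dom H" "Cod (cat.truncate H) = Cod H"
  "Ide (cat.truncate H) = Ide H" "Comp (cat.truncate H) = Comp H"
  by (simp_all add: cat.truncate_def)

lemma is_functor_truncate [simp]:
  "is_functor (cat.truncate C) D F = is_functor C D F"
  "is_functor C (cat.truncate D) F = is_functor C D F"
  by (simp_all add: is_functor_def)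

lemma naturally_isomorphic_truncate [simp]:
  "naturally_isomorphic (cat.truncate C) D F G = naturally_isomorphic C D F G"
  "naturally_isomorphic C (cat.truncate D) F G = naturally_isomorphic C D F G"
  by (simp_all add: naturally_isomorphic_def)

section \<open>Functors, natural isomorphisms and equivalences\<close>

lemma functor_Hom: "is_functor C D F \<Longrightarrow> f \<in> Hom C X Y \<Longrightarrow> FArr F f \<in> Hom D (FObj F X) (FObj F Y)"
  by (auto simp: is_functor_def Hom_def)

lemma functor_Obj: "is_functor C D F \<Longrightarrow> X \<in> Obj C \<Longrightarrow> FObj F X \<in> Obj D"
  by (auto simp: is_functor_def)

lemma functor_Ide: "is_functor C D F \<Longrightarrow> X \<in> Obj C \<Longrightarrow> FArr F (Ide C X) = Ide D (FObj F X)"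
  by (auto simp: is_functor_def)

lemma functor_Comp:
  "is_functor C D F \<Longrightarrow> f \<in> Hom C X Y \<Longrightarrow> g \<in> Hom C Y Z \<Longrightarrow>
    FArr F (g \<cdot>\<^bsub>C\<^esub> f) = FArr F g \<cdot>\<^bsub>D\<^esub> FArr F f"
  by (auto simp: is_functor_def Hom_def)

lemma comp_functor_simps [simp]:
  "FObj (comp_functor G F) X = FObj G (FObj F X)" "FArr (comp_functor G F) f = FArr G (FArr F f)"
  by (simp_all add: comp_functor_def)

lemma id_functor_simps [simp]: "FObj id_functor X = X" "FArr id_functor f = f"
  by (simp_all add: id_functor_def)

lemma is_functor_comp:
  assumes "is_functor C D F" "is_functor D E G"
  shows "is_functor C E (comp_functor G F)"
  using assms by (auto simp: is_functor_def Hom_def)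

lemma is_functor_id: "is_category C \<Longrightarrow> is_functor C C id_functor"
  by (auto simp: is_functor_def is_category_def Hom_def)

text \<open>An endofunctor isomorphic to the identity acts by conjugation. The formula in both
  directions yields faithfulness, fullness and the transfer of additivity.\<close>

lemma naturally_isomorphic_idE:
  assumes "is_category C" "is_functor C C F" "naturally_isomorphic C C F id_functor"
  obtains \<eta> \<eta>' where
    "\<And>X. X \<in> Obj C \<Longrightarrow> \<eta> X \<in> Hom C (FObj F X) X"
    "\<And>X. X \<in> Obj C \<Longrightarrow> \<eta>' X \<in> Hom C X (FObj F X)"
    "\<And>f X Y. f \<in> Hom C X Y \<Longrightarrow> FArr F f = \<eta>' Y \<cdot>\<^bsub>C\<^esub> (f \<cdot>\<^bsub>C\<^esub> \<eta> X)"
    "\<And>f X Y. f \<in> Hom C X Y \<Longrightarrow> f = \<eta> Y \<cdot>\<^bsub>C\<^esub> (FArr F f \<cdot>\<^bsub>C\<^esub> \<eta>' X)"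
proof -
  interpret category C by unfold_locales (rule assms)
  obtain \<eta> where \<eta>: "\<And>X. X \<in> Obj C \<Longrightarrow> \<eta> X \<in> Hom C (FObj F X) X"
    "\<And>X. X \<in> Obj C \<Longrightarrow> is_iso C (\<eta> X)"
    and nat: "\<And>f. f \<in> Arr C \<Longrightarrow> \<eta> (Cod C f) \<cdot>\<^bsub>C\<^esub> FArr F f = f \<cdot>\<^bsub>C\<^esub> \<eta> (Dom C f)"
    using assms(3) unfolding naturally_isomorphic_def by auto
  define \<eta>' where "\<eta>' X = inverse_arr (\<eta> X)" for X
  have \<eta>': "\<eta>' X \<in> Hom C X (FObj F X)" "\<eta>' X \<cdot>\<^bsub>C\<^esub> \<eta> X = Ide C (FObj F X)"
    "\<eta> X \<cdot>\<^bsub>C\<^esub> \<eta>' X = Ide C X" if "X \<in> Obj C" for X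
    using inverse_arr[OF \<eta>(2)[OF that] \<eta>(1)[OF that]] by (auto simp: \<eta>'_def)
  have H: "FArr F f = \<eta>' Y \<cdot>\<^bsub>C\<^esub> (f \<cdot>\<^bsub>C\<^esub> \<eta> X)" "f = \<eta> Y \<cdot>\<^bsub>C\<^esub> (FArr F f \<cdot>\<^bsub>C\<^esub> \<eta>' X)"
    if f: "f \<in> Hom C X Y" for f X Y
  proof -
    have X: "X \<in> Obj C" and Y: "Y \<in> Obj C" using Hom_Obj[OF f] by auto
    note facts = f \<eta>(1)[OF X] \<eta>(1)[OF Y] \<eta>'(1)[OF X] \<eta>'(1)[OF Y] functor_Hom[OF assms(2) f]
    have n: "\<eta> Y \<cdot>\<^bsub>C\<^esub> FArr F f = f \<cdot>\<^bsub>C\<^esub> \<eta> X" using nat[of f] f by (simp add: Hom_def)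
    have "\<eta>' Y \<cdot>\<^bsub>C\<^esub> (\<eta> Y \<cdot>\<^bsub>C\<^esub> FArr F f) = FArr F f"
      using facts Comp_reassoc[OF \<eta>'(2)[OF Y]] by (simp add: Hom_def)
    then show "FArr F f = \<eta>' Y \<cdot>\<^bsub>C\<^esub> (f \<cdot>\<^bsub>C\<^esub> \<eta> X)" using n by simp
    show "f = \<eta> Y \<cdot>\<^bsub>C\<^esub> (FArr F f \<cdot>\<^bsub>C\<^esub> \<eta>' X)"
      using facts Comp_reassoc[OF n] \<eta>'(3)[OF X] by (simp add: Hom_def)
  qed
  show thesis using \<eta>(1) \<eta>'(1) H by (rule that)
qed

lemma naturally_isomorphic_sym:
  assumes "is_category D" "is_functor C D F" "is_functor C D G" "is_category C" "naturally_isomorphic C D F G"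
  shows "naturally_isomorphic C D G F"
proof -
  interpret C: category C by unfold_locales fact
  interpret D: category D by unfold_locales fact
  obtain \<eta> where \<eta>: "\<And>X. X \<in> Obj C \<Longrightarrow> \<eta> X \<in> Hom D (FObj F X) (FObj G X)"
    "\<And>X. X \<in> Obj C \<Longrightarrow> is_iso D (\<eta> X)"
    and nat: "\<And>f. f \<in> Arr C \<Longrightarrow> \<eta> (Cod C f) \<cdot>\<^bsub>D\<^esub> FArr F f = FArr G f \<cdot>\<^bsub>D\<^esub> \<eta> (Dom C f)"
    using assms(5) unfolding naturally_isomorphic_def by auto
  note inv = D.inverse_arr[OF \<eta>(2) \<eta>(1)]
  have "D.inverse_arr (\<eta> (Cod C f)) \<cdot>\<^bsub>D\<^esub> FArr G f = FArr F f \<cdot>\<^bsub>D\<^esub> D.inverse_arr (\<eta> (Dom C f))"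
    if f: "f \<in> Arr C" for f
  proof -
    have XY: "Dom C f \<in> Obj C" "Cod C f \<in> Obj C" "f \<in> Hom C (Dom C f) (Cod C f)"
      using f by (simp_all add: Hom_def)
    show ?thesis
      by (rule D.inverse_square[symmetric, OF \<eta>(1)[OF XY(1)] inv(1)[OF XY(1,1)] inv(3)[OF XY(1,1)]
            inv(2)[OF XY(1,1)] \<eta>(1)[OF XY(2)] inv(1)[OF XY(2,2)] inv(2)[OF XY(2,2)]
            functor_Hom[OF assms(2) XY(3)] functor_Hom[OF assms(3) XY(3)] nat[OF f, symmetric]])
  qed
  then show ?thesis
    unfolding naturally_isomorphic_def using inv(1,4)
    by (intro exI[of _ "\<lambda>X. D.inverse_arr (\<eta> X)"]) blast
qed

lemma equivalence_faithful:
  assumes "is_category C" "is_functor C D F" "is_functor D C G"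
    and "naturally_isomorphic C C (comp_functor G F) id_functor"
    and "f \<in> Hom C X Y" "g \<in> Hom C X Y" "FArr F f = FArr F g"
  shows "f = g"
proof -
  obtain \<eta> \<eta>' where "\<And>f X Y. f \<in> Hom C X Y \<Longrightarrow> f = \<eta> Y \<cdot>\<^bsub>C\<^esub> (FArr (comp_functor G F) f \<cdot>\<^bsub>C\<^esub> \<eta>' X)"
    using naturally_isomorphic_idE[OF assms(1) is_functor_comp[OF assms(2,3)] assms(4)] by metis
  from this[OF assms(5)] this[OF assms(6)] show ?thesis using assms(7) by simp
qed

text \<open>Conjugating \<open>G d\<close> back gives an \<open>f\<close> with the same image under
  \<open>G \<circ> F\<close> as \<open>d\<close> has under \<open>G\<close>; faithfulness of
  \<open>G\<close> then cancels \<open>G\<close>.\<close>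

lemma equivalence_full:
  assumes C: "is_category C" and D: "is_category D" and F: "is_functor C D F" and G: "is_functor D C G"
    and GF: "naturally_isomorphic C C (comp_functor G F) id_functor"
    and FG: "naturally_isomorphic D D (comp_functor F G) id_functor"
    and XY: "X \<in> Obj C" "Y \<in> Obj C" and d: "d \<in> Hom D (FObj F X) (FObj F Y)"
  shows "\<exists>f\<in>Hom C X Y. FArr F f = d"
proof -
  interpret category C by unfold_locales (rule C)
  note comp = is_functor_comp[OF F G]
  obtain \<eta> \<eta>' where \<eta>: "\<And>X. X \<in> Obj C \<Longrightarrow> \<eta> X \<in> Hom C (FObj (comp_functor G F) X) X"
    and \<eta>': "\<And>X. X \<in> Obj C \<Longrightarrow> \<eta>' X \<in> Hom C X (FObj (comp_functor G F) X)"
    and conj: "\<And>f X Y. f \<in> Hom C X Y \<Longrightarrow>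
      FArr (comp_functor G F) f = \<eta>' Y \<cdot>\<^bsub>C\<^esub> (f \<cdot>\<^bsub>C\<^esub> \<eta> X)"
    using C comp GF by (rule naturally_isomorphic_idE) blast
  \<comment> \<open>The conjugation formula at an identity arrow says that \<open>\<eta>'\<close> is
    a left inverse of \<open>\<eta>\<close>.\<close>
  have inv: "\<eta>' X \<cdot>\<^bsub>C\<^esub> \<eta> X = Ide C (FObj G (FObj F X))" if X: "X \<in> Obj C" for X
    using conj[OF Ide_Hom[OF X]] functor_Ide[OF comp X] \<eta>[OF X] by (simp add: Hom_def)
  define f where "f = \<eta> Y \<cdot>\<^bsub>C\<^esub> (FArr G d \<cdot>\<^bsub>C\<^esub> \<eta>' X)"
  note H = \<eta>[OF XY(1), simplified] \<eta>[OF XY(2), simplified] \<eta>'[OF XY(1), simplified]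
    \<eta>'[OF XY(2), simplified] functor_Hom[OF G d]
  have f: "f \<in> Hom C X Y" unfolding f_def by (rule Comp_Hom[OF Comp_Hom[OF H(3,5)] H(2)])
  have "FArr G (FArr F f) = \<eta>' Y \<cdot>\<^bsub>C\<^esub> (\<eta> Y \<cdot>\<^bsub>C\<^esub> (FArr G d \<cdot>\<^bsub>C\<^esub> (\<eta>' X \<cdot>\<^bsub>C\<^esub> \<eta> X)))"
    using conj[OF f] H by (simp add: f_def Hom_def)
  also have "\<dots> = FArr G d"
    using H Comp_reassoc[OF inv[OF XY(2)]] inv[OF XY(1)] by (simp add: Hom_def)
  finally have "FArr F f = d"
    by (rule equivalence_faithful[OF D G F FG functor_Hom[OF F f] d])
  with f show ?thesis by blast
qed

section \<open>Quotients by a congruence\<close>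

locale congruence = category C for C :: "('o, 'b, 'z) cat_scheme" (structure) +
  fixes R :: "('b \<times> 'b) set"
  assumes equiv: "equiv (Arr C) R"
    and parallel: "(f, g) \<in> R \<Longrightarrow> Dom C f = Dom C g \<and> Cod C f = Cod C g"
    and compatible: "(f, f') \<in> R \<Longrightarrow> (g, g') \<in> R \<Longrightarrow> Cod C f = Dom C g \<Longrightarrow> (g \<cdot> f, g' \<cdot> f') \<in> R"
begin

abbreviation cls :: "'b \<Rightarrow> 'b set" where "cls f \<equiv> R `` {f}"

abbreviation Quo where "Quo \<equiv> quotient_cat C R"

lemma cls_eqI: "(f, g) \<in> R \<Longrightarrow> cls f = cls g"
  using equiv by (rule equiv_class_eq)

text \<open>The operations of \<open>quotient_cat\<close> act on members picked by
  \<open>SOME\<close>. That the pick is related to \<open>f\<close> is what makes them computable on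
  any representative.\<close>

lemma some_cls: "f \<in> Arr C \<Longrightarrow> (f, SOME g. g \<in> cls f) \<in> R"
  using someI_ex[of "\<lambda>g. g \<in> cls f"] equiv_class_self[OF equiv] by blast

lemma Obj_Quo [simp]: "Obj Quo = Obj C"
  by (simp add: quotient_cat_def)

lemma Arr_Quo: "c \<in> Arr Quo \<longleftrightarrow> (\<exists>f\<in>Arr C. c = cls f)"
  by (auto simp: quotient_cat_def quotient_def)

lemma cls_Arr [simp]: "f \<in> Arr C \<Longrightarrow> cls f \<in> Arr Quo"
  by (auto simp: Arr_Quo)

lemma Dom_cls [simp]: "f \<in> Arr C \<Longrightarrow> Dom Quo (cls f) = Dom C f"
  and Cod_cls [simp]: "f \<in> Arr C \<Longrightarrow> Cod Quo (cls f) = Cod C f"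
  using parallel[OF some_cls] by (auto simp: quotient_cat_def)

lemma Ide_Quo: "Ide Quo X = cls (Ide C X)"
  by (simp add: quotient_cat_def)

lemma Comp_cls:
  assumes "f \<in> Arr C" "g \<in> Arr C" "Cod C f = Dom C g"
  shows "cls g \<cdot>\<^bsub>Quo\<^esub> cls f = cls (g \<cdot> f)"
  using cls_eqI[OF compatible[OF some_cls some_cls]] assms by (simp add: quotient_cat_def)

lemma cls_Hom: "f \<in> Hom C X Y \<Longrightarrow> cls f \<in> Hom Quo X Y"
  by (auto simp: Hom_def)

lemma Hom_QuoE:
  assumes "c \<in> Hom Quo X Y"
  obtains f where "f \<in> Hom C X Y" "c = cls f"
proof -
  obtain f where f: "f \<in> Arr C" "c = cls f"
    using assms by (auto simp: Hom_def Arr_Quo)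
  then have "f \<in> Hom C X Y" using assms by (simp add: Hom_def)
  then show thesis using f(2) by (rule that)
qed

lemma Comp_cls_Hom:
  "f \<in> Hom C X Y \<Longrightarrow> g \<in> Hom C Y Z \<Longrightarrow> cls g \<cdot>\<^bsub>Quo\<^esub> cls f = cls (g \<cdot> f)"
  by (auto simp: Hom_def Comp_cls)

lemma is_category_Quo: "is_category Quo"
proof -
  have "Dom Quo c \<in> Obj C \<and> Cod Quo c \<in> Obj C" if "c \<in> Arr Quo" for c
    using that by (auto simp: Arr_Quo)
  moreover have "(k \<cdot>\<^bsub>Quo\<^esub> d) \<cdot>\<^bsub>Quo\<^esub> c = k \<cdot>\<^bsub>Quo\<^esub> (d \<cdot>\<^bsub>Quo\<^esub> c)"
    if "c \<in> Arr Quo" "d \<in> Arr Quo" "k \<in> Arr Quo" "Cod Quo c = Dom Quo d" "Cod Quo d = Dom Quo k" for c d k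
    using that by (auto simp: Arr_Quo Comp_cls)
  moreover have "d \<cdot>\<^bsub>Quo\<^esub> c \<in> Hom Quo (Dom Quo c) (Cod Quo d)"
    if "c \<in> Arr Quo" "d \<in> Arr Quo" "Cod Quo c = Dom Quo d" for c d
    using that by (auto simp: Arr_Quo Comp_cls Hom_def)
  moreover have "c \<cdot>\<^bsub>Quo\<^esub> Ide Quo (Dom Quo c) = c \<and> Ide Quo (Cod Quo c) \<cdot>\<^bsub>Quo\<^esub> c = c"
    if "c \<in> Arr Quo" for c
    using that by (auto simp: Arr_Quo Comp_cls Ide_Quo)
  moreover have "Ide Quo X \<in> Hom Quo X X" if "X \<in> Obj C" for X
    using that cls_Hom[OF Ide_Hom[OF that]] by (simp add: Ide_Quo)
  ultimately show ?thesis by (simp add: is_category_def)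
qed

text \<open>Total in \<open>F\<close>: the value on a class is read off a picked member, which is
  meaningful once \<open>F\<close> is constant on classes.\<close>

definition descend :: "('o, 'b, 'p, 'c) cat_functor \<Rightarrow> ('o, 'b set, 'p, 'c) cat_functor" where
  "descend F = \<lparr>FObj = FObj F, FArr = (\<lambda>c. FArr F (SOME f. f \<in> c))\<rparr>"

lemma FObj_descend [simp]: "FObj (descend F) X = FObj F X"
  by (simp add: descend_def)

lemma FArr_descend:
  assumes "\<And>f g. (f, g) \<in> R \<Longrightarrow> FArr F f = FArr F g" and "f \<in> Arr C"
  shows "FArr (descend F) (cls f) = FArr F f"
  using assms(1)[OF some_cls[OF assms(2)]] by (simp add: descend_def)

lemma is_functor_descend:
  assumes F: "is_functor C D F" and R: "\<And>f g. (f, g) \<in> R \<Longrightarrow> FArr F f = FArr F g"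
  shows "is_functor Quo D (descend F)"
  using F by (auto simp: is_functor_def Arr_Quo FArr_descend[OF R] Comp_cls Ide_Quo)

end


section \<open>Localization\<close>

lemma is_path_append:
  "is_path C W X ss Y \<Longrightarrow> is_path C W Y tt Z \<Longrightarrow> is_path C W X (ss @ tt) Z"
  by (induction C W X ss Y rule: is_path.induct) auto

context category
begin

lemma is_path_Obj: "is_path C W X ss Y \<Longrightarrow> X \<in> Obj C \<and> Y \<in> Obj C"
proof (induction ss arbitrary: X)
  case (Cons s ss)
  then show ?case by (cases s) auto
qed auto

lemma is_category_path_cat: "is_category (path_cat C W)"
  by (auto simp: is_category_def path_cat_def Hom_def is_path_append dest: is_path_Obj)

text \<open>The rules for symmetry, transitivity and composition do not mention membership in the
  arrows; induction shows that they never leave pairs of parallel arrows.\<close>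

lemma localization_rel_parallel:
  assumes "(p, q) \<in> localization_rel C W"
  shows "p \<in> Arr (path_cat C W) \<and> q \<in> Arr (path_cat C W) \<and>
    Dom (path_cat C W) p = Dom (path_cat C W) q \<and> Cod (path_cat C W) p = Cod (path_cat C W) q"
proof -
  interpret P: category "path_cat C W" by unfold_locales (rule is_category_path_cat)
  show ?thesis
    using assms unfolding localization_rel_def
    by (induction rule: generated_congruence.induct) (auto simp: Hom_def)
qed

lemma congruence_localization_rel: "congruence (path_cat C W) (localization_rel C W)"
proof
  show "is_category (path_cat C W)" by (rule is_category_path_cat)
  show "equiv (Arr (path_cat C W)) (localization_rel C W)"
    by (auto simp: equiv_def refl_on_def sym_def trans_def dest: localization_rel_parallel)
      (auto simp: localization_rel_def intro: generated_congruence.intros)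
  show "(g \<cdot>\<^bsub>path_cat C W\<^esub> f, g' \<cdot>\<^bsub>path_cat C W\<^esub> f') \<in> localization_rel C W"
    if "(f, f') \<in> localization_rel C W" "(g, g') \<in> localization_rel C W"
      "Cod (path_cat C W) f = Dom (path_cat C W) g" for f f' g g'
    using that unfolding localization_rel_def by (rule generated_congruence.comp)
qed (use localization_rel_parallel in blast)

end

section \<open>Arrows of the localization: generators and formal inverses\<close>

locale localizing = category C for C :: "('o, 'a, 'z) cat_scheme" (structure) +
  fixes W :: "'a set"
begin

sublocale Path: congruence "path_cat C W" "localization_rel C W"
  by (rule congruence_localization_rel)

abbreviation Loc where "Loc \<equiv> localization C W"

lemma Loc_eq: "Loc = Path.Quo"
  by (simp add: localization_def)

sublocale Loc: category Loc
  by unfold_locales (simp add: Loc_eq Path.is_category_Quo)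

lemma Obj_Loc [simp]: "Obj Loc = Obj C"
  by (simp add: Loc_eq) (simp add: path_cat_def)

lemma Path_Hom: "(X, ss, Y) \<in> Hom (path_cat C W) X' Y' \<longleftrightarrow> X = X' \<and> Y = Y' \<and> is_path C W X ss Y"
  by (auto simp: Hom_def path_cat_def)

abbreviation \<gamma> :: "'a \<Rightarrow> ('o, 'a) path set" where
  "\<gamma> f \<equiv> Path.cls (Dom C f, [Fwd f], Cod C f)"

abbreviation \<gamma>_inv :: "'a \<Rightarrow> ('o, 'a) path set" where
  "\<gamma>_inv w \<equiv> Path.cls (Cod C w, [Bwd w], Dom C w)"

lemma Path_Arr:
    "p \<in> Arr (path_cat C W) \<longleftrightarrow> (\<exists>X ss Y. p = (X, ss, Y) \<and> is_path C W X ss Y)"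
  and Dom_path [simp]: "Dom (path_cat C W) (X, ss, Y) = X"
  and Cod_path [simp]: "Cod (path_cat C W) (X, ss, Y) = Y"
  by (auto simp: path_cat_def)

lemma \<gamma>_Hom: "f \<in> Hom C X Y \<Longrightarrow> \<gamma> f \<in> Hom Loc X Y"
  using Path.cls_Hom[of "(X, [Fwd f], Y)" X Y] by (auto simp: Loc_eq Path_Hom Hom_def[of C])

lemma \<gamma>_inv_Hom: "w \<in> Hom C X Y \<Longrightarrow> w \<in> W \<Longrightarrow> \<gamma>_inv w \<in> Hom Loc Y X"
  using Path.cls_Hom[of "(Y, [Bwd w], X)" Y X] by (auto simp: Loc_eq Path_Hom Hom_def[of C])

lemma path_Comp [simp]: "(Y', tt, Z) \<cdot>\<^bsub>path_cat C W\<^esub> (X, ss, Y) = (X, ss @ tt, Z)"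
  by (simp add: path_cat_def)

lemma cls_append:
  assumes "is_path C W X ss Y" "is_path C W Y tt Z"
  shows "Path.cls (X, ss @ tt, Z) = Path.cls (Y, tt, Z) \<cdot>\<^bsub>Loc\<^esub> Path.cls (X, ss, Y)"
  using Path.Comp_cls_Hom[of "(X, ss, Y)" X Y "(Y, tt, Z)" Z] assms by (simp add: Loc_eq Path_Hom)

lemma Ide_Loc: "Ide Loc X = Path.cls (X, [], X)"
  by (simp add: Loc_eq Path.Ide_Quo) (simp add: path_cat_def)

lemma \<gamma>_Ide: "X \<in> Obj C \<Longrightarrow> \<gamma> (Ide C X) = Ide Loc X"
  unfolding Ide_Loc
  by (rule Path.cls_eqI)
    (auto simp: localization_rel_def Path_Hom intro!: generated_congruence.base)

lemma \<gamma>_Comp: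
  assumes "f \<in> Hom C X Y" "g \<in> Hom C Y Z"
  shows "\<gamma> (g \<cdot> f) = \<gamma> g \<cdot>\<^bsub>Loc\<^esub> \<gamma> f"
proof -
  have "((X, [Fwd f, Fwd g], Z), (X, [Fwd (g \<cdot> f)], Z)) \<in> localization_rel C W"
    unfolding localization_rel_def
    by (rule generated_congruence.base[where X = X and Y = Z])
      (use assms in \<open>force simp: Hom_def path_cat_def\<close>)+
  note 1 = Path.cls_eqI[OF this]
  have "Path.cls (X, [Fwd f, Fwd g], Z) = Path.cls (Y, [Fwd g], Z) \<cdot>\<^bsub>Loc\<^esub> Path.cls (X, [Fwd f], Y)"
    using cls_append[of X "[Fwd f]" Y "[Fwd g]" Z] assms Hom_Obj[OF assms(2)]
    by (simp add: Hom_def)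
  moreover have "Dom C (g \<cdot> f) = X" "Cod C (g \<cdot> f) = Z" "Dom C f = X" "Cod C f = Y"
    "Dom C g = Y" "Cod C g = Z" using assms by (simp_all add: Hom_def)
  ultimately show ?thesis using 1 by simp
qed

lemma \<gamma>_inv:
  assumes "w \<in> Hom C X Y" "w \<in> W"
  shows "\<gamma>_inv w \<cdot>\<^bsub>Loc\<^esub> \<gamma> w = Ide Loc X" "\<gamma> w \<cdot>\<^bsub>Loc\<^esub> \<gamma>_inv w = Ide Loc Y"
proof -
  have XY: "Dom C w = X" "Cod C w = Y" "w \<in> Arr C" using assms by (simp_all add: Hom_def)
  have "((X, [Fwd w, Bwd w], X), (X, [], X)) \<in> localization_rel C W"
    unfolding localization_rel_def
    by (rule generated_congruence.base[where X = X and Y = X])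
      (use assms in \<open>force simp: Hom_def path_cat_def\<close>)+
  note Path.cls_eqI[OF this]
  moreover have "Path.cls (X, [Fwd w, Bwd w], X) = Path.cls (Y, [Bwd w], X) \<cdot>\<^bsub>Loc\<^esub> Path.cls (X, [Fwd w], Y)"
    using cls_append[of X "[Fwd w]" Y "[Bwd w]" X] assms XY Hom_Obj[OF assms(1)] by simp
  ultimately show "\<gamma>_inv w \<cdot>\<^bsub>Loc\<^esub> \<gamma> w = Ide Loc X" using XY by (simp add: Ide_Loc)
  have "((Y, [Bwd w, Fwd w], Y), (Y, [], Y)) \<in> localization_rel C W"
    unfolding localization_rel_def
    by (rule generated_congruence.base[where X = Y and Y = Y])
      (use assms in \<open>force simp: Hom_def path_cat_def\<close>)+
  note Path.cls_eqI[OF this]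
  moreover have "Path.cls (Y, [Bwd w, Fwd w], Y) = Path.cls (X, [Fwd w], Y) \<cdot>\<^bsub>Loc\<^esub> Path.cls (Y, [Bwd w], X)"
    using cls_append[of Y "[Bwd w]" X "[Fwd w]" Y] assms XY Hom_Obj[OF assms(1)] by simp
  ultimately show "\<gamma> w \<cdot>\<^bsub>Loc\<^esub> \<gamma>_inv w = Ide Loc Y" using XY by (simp add: Ide_Loc)
qed

lemma \<gamma>_iso: "w \<in> Arr C \<Longrightarrow> w \<in> W \<Longrightarrow> is_iso Loc (\<gamma> w)"
  by (rule Loc.is_isoI[OF \<gamma>_Hom \<gamma>_inv_Hom]) (auto simp: \<gamma>_inv Hom_def)

lemma localization_functor_simps [simp]:
  "FObj (localization_functor C W) X = X" "FArr (localization_functor C W) f = \<gamma> f"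
  by (simp_all add: localization_functor_def)

lemma is_functor_localization: "is_functor C Loc (localization_functor C W)"
  using \<gamma>_Hom \<gamma>_Ide \<gamma>_Comp by (auto simp: is_functor_def Hom_def[of C])

text \<open>Induction on a representing path by the step traversed first, which is the innermost
  factor of the composite. Later arguments about \<open>Loc\<close> can then avoid paths.\<close>

lemma Loc_induct [consumes 1, case_names Ide Fwd Bwd]:
  assumes "c \<in> Hom Loc X Y"
    and "\<And>X. X \<in> Obj C \<Longrightarrow> P X X (Ide Loc X)"
    and "\<And>f X Y Z c. f \<in> Hom C X Y \<Longrightarrow> c \<in> Hom Loc Y Z \<Longrightarrow> P Y Z c \<Longrightarrow> P X Z (c \<cdot>\<^bsub>Loc\<^esub> \<gamma> f)"
    and "\<And>w X Y Z c. w \<in> Hom C Y X \<Longrightarrow> w \<in> W \<Longrightarrow> c \<in> Hom Loc Y Z \<Longrightarrow> P Y Z c \<Longrightarrow>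
      P X Z (c \<cdot>\<^bsub>Loc\<^esub> \<gamma>_inv w)"
  shows "P X Y c"
proof -
  have "P X Y (Path.cls (X, ss, Y))" if "is_path C W X ss Y" for ss
    using that
  proof (induction ss arbitrary: X)
    case Nil
    then show ?case using assms(2) by (auto simp: Ide_Loc)
  next
    case (Cons s ss)
    have H: "is_path C W X' ss Y \<Longrightarrow> Path.cls (X', ss, Y) \<in> Hom Loc X' Y" for X'
      using Path.cls_Hom[of "(X', ss, Y)" X' Y] by (simp add: Loc_eq Path_Hom)
    show ?case
    proof (cases s)
      case (Fwd f)
      then show ?thesis
        using Cons cls_append[of X "[Fwd f]" "Cod C f" ss Y] assms(3)[OF _ H Cons.IH]
        by (auto simp: Hom_def[of C])
    next
      case (Bwd w)
      then show ?thesis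
        using Cons cls_append[of X "[Bwd w]" "Dom C w" ss Y] assms(4)[OF _ _ H Cons.IH]
        by (auto simp: Hom_def[of C])
    qed
  qed
  moreover obtain p where "p \<in> Hom (path_cat C W) X Y" "c = Path.cls p"
    using assms(1) by (auto simp: Loc_eq elim: Path.Hom_QuoE)
  ultimately show ?thesis by (cases p) (auto simp: Path_Hom)
qed

text \<open>Naturality squares paste along composites, so generators suffice. The hypothesis covers
  the arrows \<open>\<gamma> f\<close>, and formal inverses follow from it.\<close>

lemma Loc_natural:
  assumes D: "is_category D" and F: "is_functor Loc D F" and G: "is_functor Loc D G"
    and \<eta>: "\<And>X. X \<in> Obj C \<Longrightarrow> \<eta> X \<in> Hom D (FObj F X) (FObj G X)"
    and nat: "\<And>f X Y. f \<in> Hom C X Y \<Longrightarrow> \<eta> Y \<cdot>\<^bsub>D\<^esub> FArr F (\<gamma> f) = FArr G (\<gamma> f) \<cdot>\<^bsub>D\<^esub> \<eta> X"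
    and c: "c \<in> Hom Loc X Y"
  shows "\<eta> Y \<cdot>\<^bsub>D\<^esub> FArr F c = FArr G c \<cdot>\<^bsub>D\<^esub> \<eta> X"
proof -
  interpret D: category D by unfold_locales (rule D)
  have step: "\<eta> Z \<cdot>\<^bsub>D\<^esub> FArr F (c \<cdot>\<^bsub>Loc\<^esub> d) = FArr G (c \<cdot>\<^bsub>Loc\<^esub> d) \<cdot>\<^bsub>D\<^esub> \<eta> X"
    if d: "d \<in> Hom Loc X Y" "c \<in> Hom Loc Y Z"
      and dn: "\<eta> Y \<cdot>\<^bsub>D\<^esub> FArr F d = FArr G d \<cdot>\<^bsub>D\<^esub> \<eta> X"
      and cn: "\<eta> Z \<cdot>\<^bsub>D\<^esub> FArr F c = FArr G c \<cdot>\<^bsub>D\<^esub> \<eta> Y" for c d X Y Z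
  proof -
    have "X \<in> Obj C" "Y \<in> Obj C" "Z \<in> Obj C" using Loc.Hom_Obj d by auto
    note facts = functor_Hom[OF F d(1)] functor_Hom[OF F d(2)] functor_Hom[OF G d(1)]
      functor_Hom[OF G d(2)] this[THEN \<eta>]
    have "\<eta> Z \<cdot>\<^bsub>D\<^esub> (FArr F c \<cdot>\<^bsub>D\<^esub> FArr F d) = FArr G c \<cdot>\<^bsub>D\<^esub> (\<eta> Y \<cdot>\<^bsub>D\<^esub> FArr F d)"
      using facts D.Comp_reassoc[OF cn] by (simp add: Hom_def)
    then show ?thesis using facts dn by (simp add: functor_Comp[OF F d] functor_Comp[OF G d] Hom_def)
  qed
  show ?thesis using c
  proof (induction rule: Loc_induct)
    case (Ide X)
    then show ?case using \<eta>[of X] by (simp add: functor_Ide[OF F] functor_Ide[OF G] Hom_def)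
  next
    case (Fwd f X Y Z c)
    then show ?case using step \<gamma>_Hom nat by blast
  next
    case (Bwd w X Y Z c)
    have "Y \<in> Obj C" "X \<in> Obj C" using Hom_Obj Bwd(1) by auto
    note \<eta>s = this[THEN \<eta>]
    note wH = \<gamma>_Hom[OF Bwd(1)] \<gamma>_inv_Hom[OF Bwd(1,2)]
    have inv: "FArr K (\<gamma>_inv w) \<cdot>\<^bsub>D\<^esub> FArr K (\<gamma> w) = Ide D (FObj K X)"
      "FArr K (\<gamma> w) \<cdot>\<^bsub>D\<^esub> FArr K (\<gamma>_inv w) = Ide D (FObj K Y)"
      if K: "is_functor Loc D K" and w: "w \<in> Hom C X Y" "w \<in> W" for K w X Y
    proof -
      have "X \<in> Obj C" "Y \<in> Obj C" using Hom_Obj w by auto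
      then show "FArr K (\<gamma>_inv w) \<cdot>\<^bsub>D\<^esub> FArr K (\<gamma> w) = Ide D (FObj K X)"
        "FArr K (\<gamma> w) \<cdot>\<^bsub>D\<^esub> FArr K (\<gamma>_inv w) = Ide D (FObj K Y)"
        using \<gamma>_inv[OF w] functor_Ide[OF K, of X] functor_Ide[OF K, of Y]
          functor_Comp[OF K \<gamma>_Hom[OF w(1)] \<gamma>_inv_Hom[OF w]]
          functor_Comp[OF K \<gamma>_inv_Hom[OF w] \<gamma>_Hom[OF w(1)]] by simp_all
    qed
    \<comment> \<open>This is the square of \<open>\<gamma> w\<close> read backwards: both functors
      send \<open>\<gamma> w\<close> to an invertible arrow.\<close>
    have "\<eta> Y \<cdot>\<^bsub>D\<^esub> FArr F (\<gamma>_inv w) = FArr G (\<gamma>_inv w) \<cdot>\<^bsub>D\<^esub> \<eta> X"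
      by (rule D.inverse_square[of "FArr F (\<gamma> w)" "FObj F Y" "FObj F X" _ "FArr G (\<gamma> w)"])
        (use wH \<eta>s nat[OF Bwd(1)] in \<open>auto simp: functor_Hom[OF F] functor_Hom[OF G]
           inv[OF F Bwd(1,2)] inv[OF G Bwd(1,2)]\<close>)
    then show ?case using step wH Bwd by blast
  qed
qed

end

section \<open>Extension of functors that invert \<open>W\<close> to the localization\<close>

locale inverting = localizing C W + D: category D
  for C :: "('o, 'a, 'z) cat_scheme" (structure) and W :: "'a set"
    and D :: "('p, 'b, 'y) cat_scheme" +
  fixes F :: "('o, 'a, 'p, 'b) cat_functor"
  assumes F: "is_functor C D F"
    and inverts: "w \<in> Arr C \<Longrightarrow> w \<in> W \<Longrightarrow> is_iso D (FArr F w)"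
begin

text \<open>The head of the list is traversed first, so it becomes the rightmost factor. For a valid
  path every backward step lies in \<open>W\<close>, where the chosen inverse is a genuine
  one.\<close>

fun eval_path :: "'o \<Rightarrow> 'a step list \<Rightarrow> 'b" where
  "eval_path X [] = Ide D (FObj F X)"
| "eval_path X (Fwd f # ss) = eval_path (Cod C f) ss \<cdot>\<^bsub>D\<^esub> FArr F f"
| "eval_path X (Bwd w # ss) = eval_path (Dom C w) ss \<cdot>\<^bsub>D\<^esub> D.inverse_arr (FArr F w)"

lemma F_Hom: "f \<in> Arr C \<Longrightarrow> FArr F f \<in> Hom D (FObj F (Dom C f)) (FObj F (Cod C f))"
  using functor_Hom[OF F] by (auto simp: Hom_def[of C])

lemmas inv_F = D.inverse_arr[OF inverts F_Hom]

lemma eval_path_Hom: "is_path C W X ss Y \<Longrightarrow> eval_path X ss \<in> Hom D (FObj F X) (FObj F Y)"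
proof (induction ss arbitrary: X)
  case Nil
  then show ?case by (auto simp: functor_Obj[OF F] D.Ide_Hom)
next
  case (Cons s ss)
  then show ?case by (cases s) (auto intro!: D.Comp_Hom simp: F_Hom inv_F)
qed

lemma eval_path_append:
  "is_path C W X ss Y \<Longrightarrow> is_path C W Y tt Z \<Longrightarrow>
    eval_path X (ss @ tt) = eval_path Y tt \<cdot>\<^bsub>D\<^esub> eval_path X ss"
proof (induction ss arbitrary: X)
  case Nil
  then show ?case using eval_path_Hom[OF Nil(2)] by (auto simp: Hom_def)
next
  case (Cons s ss)
  show ?case
  proof (cases s)
    case (Fwd f)
    then have "f \<in> Arr C" "is_path C W (Cod C f) ss Y" using Cons.prems by auto
    then show ?thesis
      using Fwd Cons eval_path_Hom F_Hom[of f] by (fastforce simp: Hom_def)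
  next
    case (Bwd w)
    then have "w \<in> Arr C" "w \<in> W" "is_path C W (Dom C w) ss Y" using Cons.prems by auto
    then show ?thesis
      using Bwd Cons eval_path_Hom inv_F(1)[of w] by (fastforce simp: Hom_def)
  qed
qed

text \<open>The four families of generating relations evaluate to the identity law, the composition
  law and the two inverse laws of \<open>F\<close>; closure under composition is
  \<open>eval_path_append\<close>.\<close>

lemma eval_path_rel:
  assumes "(p, q) \<in> localization_rel C W"
  shows "eval_path (fst p) (fst (snd p)) = eval_path (fst q) (fst (snd q))"
  using assms unfolding localization_rel_def
proof (induction rule: generated_congruence.induct)
  case (base p q X Y)
  have 1: "FArr F (Ide C X) = Ide D (FObj F X)" if "X \<in> Obj C" for X
    by (rule functor_Ide[OF F that])
  have 2: "FArr F (g \<cdot> f) = FArr F g \<cdot>\<^bsub>D\<^esub> FArr F f"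
    if "f \<in> Arr C" "g \<in> Arr C" "Cod C f = Dom C g" for f g
    using F that by (auto simp: is_functor_def)
  have 3: "FArr F f \<in> Arr D" "Dom D (FArr F f) = FObj F (Dom C f)" "Cod D (FArr F f) = FObj F (Cod C f)"
    if "f \<in> Arr C" for f using F_Hom[OF that] by (auto simp: Hom_def)
  have 4: "D.inverse_arr (FArr F f) \<in> Arr D" "Dom D (D.inverse_arr (FArr F f)) = FObj F (Cod C f)"
    "Cod D (D.inverse_arr (FArr F f)) = FObj F (Dom C f)"
    if "f \<in> Arr C" "f \<in> W" for f using inv_F(1)[OF that that(1)] by (auto simp: Hom_def)
  from base(1) show ?case
    by (auto simp: 1 2 3 4 inv_F(2,3) functor_Obj[OF F])
next
  case (comp p p' q q')
  have 1: "(p, p') \<in> localization_rel C W" "(q, q') \<in> localization_rel C W"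
    using comp by (auto simp: localization_rel_def)
  note 2 = this[THEN localization_rel_parallel]
  \<comment> \<open>Related paths are parallel, so the four paths share their end points and both
    concatenations can be evaluated piecewise.\<close>
  obtain X ss Y where p: "p = (X, ss, Y)" "is_path C W X ss Y"
    using 2 by (auto simp: Path_Arr)
  obtain tt Z where q: "q = (Y, tt, Z)" "is_path C W Y tt Z"
    using 2 comp(3) p by (auto simp: Path_Arr)
  obtain ss' where p': "p' = (X, ss', Y)" "is_path C W X ss' Y"
    using 2 p by (auto simp: Path_Arr)
  obtain tt' where q': "q' = (Y, tt', Z)" "is_path C W Y tt' Z"
    using 2 q by (auto simp: Path_Arr)
  show ?case using comp.IH by (simp add: p q p' q' eval_path_append[OF p(2) q(2)] eval_path_append[OF p'(2) q'(2)])
qed auto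

definition path_functor where
  "path_functor = \<lparr>FObj = FObj F, FArr = (\<lambda>p. eval_path (fst p) (fst (snd p)))\<rparr>"

definition extension where
  "extension = Path.descend path_functor"

lemma is_functor_path: "is_functor (path_cat C W) D path_functor"
  using eval_path_Hom
  by (auto simp: is_functor_def path_functor_def path_cat_def functor_Obj[OF F] eval_path_append)

lemma extension_functor: "is_functor Loc D extension"
  unfolding extension_def Loc_eq
  by (rule Path.is_functor_descend[OF is_functor_path])
    (simp add: path_functor_def eval_path_rel)

lemma FObj_extension [simp]: "FObj extension X = FObj F X"
  by (simp add: extension_def path_functor_def)

lemma FArr_extension [simp]:
  assumes "f \<in> Arr C"
  shows "FArr extension (\<gamma> f) = FArr F f"
proof -
  have "FArr extension (\<gamma> f) = FArr path_functor (Dom C f, [Fwd f], Cod C f)"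
    unfolding extension_def
    by (rule Path.FArr_descend)
      (use assms in \<open>auto simp: path_functor_def eval_path_rel path_cat_def\<close>)
  then show ?thesis using assms F_Hom[OF assms] by (simp add: path_functor_def Hom_def)
qed

end

section \<open>Preadditive and additive categories\<close>

text \<open>The group axioms unpacked Hom-set by Hom-set, the form in which full subcategories,
  quotients and the pulled back addition are checked.\<close>

lemma preadditive_categoryI:
  assumes "is_category C"
    and add: "\<And>X Y f g. f \<in> Hom C X Y \<Longrightarrow> g \<in> Hom C X Y \<Longrightarrow> f \<oplus>\<^bsub>C\<^esub> g \<in> Hom C X Y"
    and assoc: "\<And>X Y f g h. f \<in> Hom C X Y \<Longrightarrow> g \<in> Hom C X Y \<Longrightarrow> h \<in> Hom C X Y \<Longrightarrow>
      (f \<oplus>\<^bsub>C\<^esub> g) \<oplus>\<^bsub>C\<^esub> h = f \<oplus>\<^bsub>C\<^esub> (g \<oplus>\<^bsub>C\<^esub> h)"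
    and comm: "\<And>X Y f g. f \<in> Hom C X Y \<Longrightarrow> g \<in> Hom C X Y \<Longrightarrow> f \<oplus>\<^bsub>C\<^esub> g = g \<oplus>\<^bsub>C\<^esub> f"
    and zero: "\<And>X Y. X \<in> Obj C \<Longrightarrow> Y \<in> Obj C \<Longrightarrow> Zero C X Y \<in> Hom C X Y"
    and zero_add: "\<And>X Y f. f \<in> Hom C X Y \<Longrightarrow> Zero C X Y \<oplus>\<^bsub>C\<^esub> f = f"
    and neg: "\<And>X Y f. f \<in> Hom C X Y \<Longrightarrow> \<exists>g\<in>Hom C X Y. g \<oplus>\<^bsub>C\<^esub> f = Zero C X Y"
    and distr: "\<And>X Y Z f g g'. f \<in> Hom C X Y \<Longrightarrow> g \<in> Hom C Y Z \<Longrightarrow> g' \<in> Hom C Y Z \<Longrightarrow>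
      (g \<oplus>\<^bsub>C\<^esub> g') \<cdot>\<^bsub>C\<^esub> f = (g \<cdot>\<^bsub>C\<^esub> f) \<oplus>\<^bsub>C\<^esub> (g' \<cdot>\<^bsub>C\<^esub> f)"
    and distl: "\<And>X Y Z f f' g. f \<in> Hom C X Y \<Longrightarrow> f' \<in> Hom C X Y \<Longrightarrow> g \<in> Hom C Y Z \<Longrightarrow>
      g \<cdot>\<^bsub>C\<^esub> (f \<oplus>\<^bsub>C\<^esub> f') = (g \<cdot>\<^bsub>C\<^esub> f) \<oplus>\<^bsub>C\<^esub> (g \<cdot>\<^bsub>C\<^esub> f')"
  shows "preadditive_category C"
proof -
  have "comm_group (hom_group C X Y)" if "X \<in> Obj C" "Y \<in> Obj C" for X Y
    by (rule comm_groupI) (use that in \<open>auto simp: hom_group_def add assoc zero zero_add neg intro: comm\<close>)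
  then show ?thesis
    unfolding preadditive_category_def using assms(1) distr distl by blast
qed

locale preadditive =
  fixes C :: "('o, 'a, 'z) add_cat_scheme" (structure)
  assumes preadditive: "preadditive_category C"

sublocale preadditive \<subseteq> category C
  by unfold_locales (use preadditive in \<open>simp add: preadditive_category_def\<close>)

context preadditive
begin

lemma hom_group: "X \<in> Obj C \<Longrightarrow> Y \<in> Obj C \<Longrightarrow> comm_group (hom_group C X Y)"
  using preadditive by (simp add: preadditive_category_def)

lemma hom_group_simps:
  "carrier (hom_group C X Y) = Hom C X Y" "f \<otimes>\<^bsub>hom_group C X Y\<^esub> g = f \<oplus> g"
  "\<one>\<^bsub>hom_group C X Y\<^esub> = Zero C X Y"
  by (simp_all add: hom_group_def)

lemma Add_Hom: "f \<in> Hom C X Y \<Longrightarrow> g \<in> Hom C X Y \<Longrightarrow> f \<oplus> g \<in> Hom C X Y"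
  using monoid.m_closed[OF comm_group.axioms(2)[THEN group.is_monoid], OF hom_group, of X Y f g] Hom_Obj
  by (auto simp: hom_group_simps)

lemma Zero_Hom: "X \<in> Obj C \<Longrightarrow> Y \<in> Obj C \<Longrightarrow> Zero C X Y \<in> Hom C X Y"
  using monoid.one_closed[OF comm_group.axioms(2)[THEN group.is_monoid], OF hom_group, of X Y]
  by (auto simp: hom_group_simps)

lemma Add_Arr [simp]:
    "f \<in> Arr C \<Longrightarrow> g \<in> Arr C \<Longrightarrow> Dom C f = Dom C g \<Longrightarrow> Cod C f = Cod C g \<Longrightarrow> f \<oplus> g \<in> Arr C"
  and Dom_Add [simp]: "f \<in> Arr C \<Longrightarrow> g \<in> Arr C \<Longrightarrow> Dom C f = Dom C g \<Longrightarrow> Cod C f = Cod C g \<Longrightarrow>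
    Dom C (f \<oplus> g) = Dom C g"
  and Cod_Add [simp]: "f \<in> Arr C \<Longrightarrow> g \<in> Arr C \<Longrightarrow> Dom C f = Dom C g \<Longrightarrow> Cod C f = Cod C g \<Longrightarrow>
    Cod C (f \<oplus> g) = Cod C g"
  using Add_Hom[of f "Dom C g" "Cod C g" g] by (auto simp: Hom_def)

lemma Zero_Arr [simp]: "X \<in> Obj C \<Longrightarrow> Y \<in> Obj C \<Longrightarrow> Zero C X Y \<in> Arr C"
  and Dom_Zero [simp]: "X \<in> Obj C \<Longrightarrow> Y \<in> Obj C \<Longrightarrow> Dom C (Zero C X Y) = X"
  and Cod_Zero [simp]: "X \<in> Obj C \<Longrightarrow> Y \<in> Obj C \<Longrightarrow> Cod C (Zero C X Y) = Y"
  using Zero_Hom by (auto simp: Hom_def)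

lemma Add_assoc:
  assumes "f \<in> Hom C X Y" "g \<in> Hom C X Y" "h \<in> Hom C X Y"
  shows "(f \<oplus> g) \<oplus> h = f \<oplus> (g \<oplus> h)"
  using monoid.m_assoc[OF comm_group.axioms(2)[THEN group.is_monoid], OF hom_group, of X Y f g h]
    assms Hom_Obj[OF assms(1)] by (simp add: hom_group_simps)

lemma Add_commute:
  assumes "f \<in> Hom C X Y" "g \<in> Hom C X Y"
  shows "f \<oplus> g = g \<oplus> f"
  using comm_monoid.m_comm[OF comm_group.axioms(1), OF hom_group, of X Y f g]
    assms Hom_Obj[OF assms(1)] by (simp add: hom_group_simps)

lemma Zero_Add [simp]:
    "f \<in> Arr C \<Longrightarrow> X = Dom C f \<Longrightarrow> Y = Cod C f \<Longrightarrow> Zero C X Y \<oplus> f = f"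
  and Add_Zero [simp]: "f \<in> Arr C \<Longrightarrow> X = Dom C f \<Longrightarrow> Y = Cod C f \<Longrightarrow> f \<oplus> Zero C X Y = f"
  using monoid.l_one[OF comm_group.axioms(2)[THEN group.is_monoid], OF hom_group, of X Y f]
    monoid.r_one[OF comm_group.axioms(2)[THEN group.is_monoid], OF hom_group, of X Y f]
  by (auto simp: hom_group_simps Hom_def)

lemma Comp_distrib_right:
    "f \<in> Hom C X Y \<Longrightarrow> g \<in> Hom C Y Z \<Longrightarrow> g' \<in> Hom C Y Z \<Longrightarrow> (g \<oplus> g') \<cdot> f = g \<cdot> f \<oplus> g' \<cdot> f"
  and Comp_distrib_left:
    "f \<in> Hom C X Y \<Longrightarrow> f' \<in> Hom C X Y \<Longrightarrow> g \<in> Hom C Y Z \<Longrightarrow> g \<cdot> (f \<oplus> f') = g \<cdot> f \<oplus> g \<cdot> f'"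
  using preadditive Hom_Obj unfolding preadditive_category_def by blast+

lemma Comp_Add_right [simp]:
  "f \<in> Arr C \<Longrightarrow> g \<in> Arr C \<Longrightarrow> g' \<in> Arr C \<Longrightarrow> Cod C f = Dom C g \<Longrightarrow> Dom C g = Dom C g' \<Longrightarrow>
    Cod C g = Cod C g' \<Longrightarrow> (g \<oplus> g') \<cdot> f = g \<cdot> f \<oplus> g' \<cdot> f"
  by (rule Comp_distrib_right) (auto simp: Hom_def)

lemma Comp_Add_left [simp]:
  "f \<in> Arr C \<Longrightarrow> f' \<in> Arr C \<Longrightarrow> g \<in> Arr C \<Longrightarrow> Cod C f = Dom C g \<Longrightarrow> Dom C f = Dom C f' \<Longrightarrow>
    Cod C f = Cod C f' \<Longrightarrow> g \<cdot> (f \<oplus> f') = g \<cdot> f \<oplus> g \<cdot> f'"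
  by (rule Comp_distrib_left) (auto simp: Hom_def)

text \<open>In a group only the neutral element equals its own double. Hence whatever preserves
  sums, a composition or an additive functor, preserves zero.\<close>

lemma Add_idem:
  assumes "f \<in> Hom C X Y" "f \<oplus> f = f"
  shows "f = Zero C X Y"
  using group.l_cancel_one'[OF comm_group.axioms(2), OF hom_group, of X Y f f]
    assms Hom_Obj[OF assms(1)] by (simp add: hom_group_simps)

lemma Zero_Comp [simp]:
  assumes "f \<in> Arr C" "Y = Cod C f" "Z \<in> Obj C"
  shows "Zero C Y Z \<cdot> f = Zero C (Dom C f) Z"
proof (rule Add_idem)
  have "Zero C Y Z \<cdot> f \<oplus> Zero C Y Z \<cdot> f = (Zero C Y Z \<oplus> Zero C Y Z) \<cdot> f"
    by (rule Comp_distrib_right[symmetric]) (use assms in \<open>auto simp: Hom_def\<close>)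
  also have "Zero C Y Z \<oplus> Zero C Y Z = Zero C Y Z" using assms by auto
  finally show "Zero C Y Z \<cdot> f \<oplus> Zero C Y Z \<cdot> f = Zero C Y Z \<cdot> f" .
qed (use assms in \<open>auto simp: Hom_def\<close>)

lemma Comp_Zero [simp]:
  assumes "f \<in> Arr C" "Y = Dom C f" "X \<in> Obj C"
  shows "f \<cdot> Zero C X Y = Zero C X (Cod C f)"
proof (rule Add_idem)
  have "f \<cdot> Zero C X Y \<oplus> f \<cdot> Zero C X Y = f \<cdot> (Zero C X Y \<oplus> Zero C X Y)"
    by (rule Comp_distrib_left[symmetric]) (use assms in \<open>auto simp: Hom_def\<close>)
  also have "Zero C X Y \<oplus> Zero C X Y = Zero C X Y" using assms by auto
  finally show "f \<cdot> Zero C X Y \<oplus> f \<cdot> Zero C X Y = f \<cdot> Zero C X Y" .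
qed (use assms in \<open>auto simp: Hom_def\<close>)

definition neg :: "'a \<Rightarrow> 'a" where
  "neg f = inv\<^bsub>hom_group C (Dom C f) (Cod C f)\<^esub> f"

lemma neg_Hom: "f \<in> Hom C X Y \<Longrightarrow> neg f \<in> Hom C X Y"
  and Add_neg: "f \<in> Hom C X Y \<Longrightarrow> f \<oplus> neg f = Zero C X Y"
  and neg_Add: "f \<in> Hom C X Y \<Longrightarrow> neg f \<oplus> f = Zero C X Y"
  using group.inv_closed[OF comm_group.axioms(2), OF hom_group, of X Y f]
    group.r_inv[OF comm_group.axioms(2), OF hom_group, of X Y f]
    group.l_inv[OF comm_group.axioms(2), OF hom_group, of X Y f]
  by (auto simp: hom_group_simps neg_def Hom_def)

lemma neg_Arr [simp]: "f \<in> Arr C \<Longrightarrow> neg f \<in> Arr C"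
  and Dom_neg [simp]: "f \<in> Arr C \<Longrightarrow> Dom C (neg f) = Dom C f"
  and Cod_neg [simp]: "f \<in> Arr C \<Longrightarrow> Cod C (neg f) = Cod C f"
  using neg_Hom by (auto simp: Hom_def)

lemma neg_unique:
  assumes "f \<in> Hom C X Y" "g \<in> Hom C X Y" "f \<oplus> g = Zero C X Y"
  shows "g = neg f"
proof -
  have "neg f \<oplus> (f \<oplus> g) = g"
    using Add_assoc[OF neg_Hom[OF assms(1)] assms(1,2)] assms
    by (simp add: neg_Add[OF assms(1)] Hom_def)
  then show ?thesis using assms neg_Hom[OF assms(1)] by (simp add: Hom_def)
qed

lemma Comp_neg:
  assumes "f \<in> Hom C X Y" "g \<in> Hom C Y Z"
  shows "g \<cdot> neg f = neg (g \<cdot> f)"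
proof (rule neg_unique)
  show "g \<cdot> f \<oplus> g \<cdot> neg f = Zero C X Z"
    unfolding Comp_distrib_left[OF assms(1) neg_Hom[OF assms(1)] assms(2), symmetric] Add_neg[OF assms(1)]
    using assms Hom_Obj[OF assms(1)] by (auto simp: Hom_def)
qed (use assms in \<open>auto simp: Hom_def\<close>)

lemma neg_Comp:
  assumes "f \<in> Hom C X Y" "g \<in> Hom C Y Z"
  shows "neg g \<cdot> f = neg (g \<cdot> f)"
proof (rule neg_unique)
  show "g \<cdot> f \<oplus> neg g \<cdot> f = Zero C X Z"
    unfolding Comp_distrib_right[OF assms(1,2) neg_Hom[OF assms(2)], symmetric] Add_neg[OF assms(2)]
    using assms Hom_Obj[OF assms(2)] by (auto simp: Hom_def)
qed (use assms in \<open>auto simp: Hom_def\<close>)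

lemma Add_neg_cancel:
  assumes "f \<in> Hom C X Y" "g \<in> Hom C X Y"
  shows "g \<oplus> (f \<oplus> neg g) = f"
proof -
  have "g \<oplus> (f \<oplus> neg g) = g \<oplus> (neg g \<oplus> f)"
    using Add_commute[OF assms(1) neg_Hom[OF assms(2)]] by simp
  also have "\<dots> = Zero C X Y \<oplus> f"
    using Add_assoc[OF assms(2) neg_Hom[OF assms(2)] assms(1)] Add_neg[OF assms(2)] by simp
  finally show ?thesis using assms by (simp add: Hom_def)
qed

lemma Add_add_swap:
  assumes "f \<in> Hom C X Y" "g \<in> Hom C X Y" "h \<in> Hom C X Y" "k \<in> Hom C X Y"
  shows "(f \<oplus> g) \<oplus> (h \<oplus> k) = (f \<oplus> h) \<oplus> (g \<oplus> k)"
proof -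
  have "(f \<oplus> g) \<oplus> (h \<oplus> k) = f \<oplus> ((g \<oplus> h) \<oplus> k)" using assms by (simp add: Add_assoc Add_Hom)
  also have "\<dots> = f \<oplus> ((h \<oplus> g) \<oplus> k)" using assms by (simp add: Add_commute[of g])
  also have "\<dots> = (f \<oplus> h) \<oplus> (g \<oplus> k)" using assms by (simp add: Add_assoc Add_Hom)
  finally show ?thesis .
qed

text \<open>If the identity of \<open>Z\<close> is zero, then every arrow into or out of
  \<open>Z\<close> is a composite with a zero arrow. Unlike the universal property, the equation
  does not quantify over objects, so it passes to full subcategories and through additive
  functors.\<close>

lemma zero_object_iff: "zero_object C Z \<longleftrightarrow> Z \<in> Obj C \<and> Ide C Z = Zero C Z Z"
proof
  assume "zero_object C Z"
  then show "Z \<in> Obj C \<and> Ide C Z = Zero C Z Z"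
    unfolding zero_object_def using Ide_Hom Zero_Hom by blast
next
  assume Z: "Z \<in> Obj C \<and> Ide C Z = Zero C Z Z"
  have "f = Zero C Z X" if "f \<in> Hom C Z X" for f X
    using that Z Comp_Ide[of f Z] Comp_Zero[of f Z Z] by (auto simp: Hom_def)
  moreover have "f = Zero C X Z" if "f \<in> Hom C X Z" for f X
    using that Z Ide_Comp[of f Z] Zero_Comp[of f Z Z] by (auto simp: Hom_def)
  ultimately show "zero_object C Z" unfolding zero_object_def using Z Zero_Hom by metis
qed

lemma zero_object_Zero:
  assumes "zero_object C Z"
  shows "f \<in> Hom C Z X \<Longrightarrow> f = Zero C Z X" "f \<in> Hom C X Z \<Longrightarrow> f = Zero C X Z"
proof -
  have Z: "Z \<in> Obj C" using assms by (simp add: zero_object_def)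
  show "f \<in> Hom C Z X \<Longrightarrow> f = Zero C Z X" "f \<in> Hom C X Z \<Longrightarrow> f = Zero C X Z"
    using assms Zero_Hom[OF Z] Zero_Hom[OF _ Z] Hom_Obj[of f Z X] Hom_Obj[of f X Z]
    unfolding zero_object_def by blast+
qed

end

section \<open>Additive categories and the transport of addition along functors\<close>

lemma additive_categoryE:
  assumes "additive_category C"
  obtains Z where "zero_object C Z"
  using assms unfolding additive_category_def by blast

lemma additive_category_biproductE:
  assumes "additive_category C" "X \<in> Obj C" "Y \<in> Obj C"
  obtains P i j p q where "biproduct C X Y P i j p q"
  using assms unfolding additive_category_def by blast

lemma full_additive_zero: "full_additive_subcategory C S \<Longrightarrow> zero_object C Z \<Longrightarrow> Z \<in> S"
  by (simp add: full_additive_subcategory_def)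

lemma full_additive_biproduct:
  "full_additive_subcategory C S \<Longrightarrow> biproduct C X Y P i j p q \<Longrightarrow> X \<in> S \<Longrightarrow> Y \<in> S \<Longrightarrow> P \<in> S"
  unfolding full_additive_subcategory_def by blast

lemma additive_category_preadditive: "additive_category C \<Longrightarrow> preadditive C"
  by unfold_locales (simp add: additive_category_def)

lemma additive_functor_Add:
  assumes "is_category C" "additive_functor C D F" "f \<in> Hom C X Y" "g \<in> Hom C X Y"
  shows "FArr F (f \<oplus>\<^bsub>C\<^esub> g) = FArr F f \<oplus>\<^bsub>D\<^esub> FArr F g"
proof -
  interpret category C by unfold_locales (rule assms)
  have "X \<in> Obj C" "Y \<in> Obj C" using Hom_Obj[OF assms(3)] by simp_all
  then show ?thesis using assms(2-4) by (simp add: additive_functor_def)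
qed

lemma additive_functor_Zero:
  assumes "preadditive C" "preadditive D" "additive_functor C D F" "X \<in> Obj C" "Y \<in> Obj C"
  shows "FArr F (Zero C X Y) = Zero D (FObj F X) (FObj F Y)"
proof -
  interpret C: preadditive C by fact
  interpret D: preadditive D by fact
  have "is_functor C D F" using assms(3) by (simp add: additive_functor_def)
  then show ?thesis
    using additive_functor_Add[OF C.is_category assms(3) C.Zero_Hom C.Zero_Hom] assms(4,5)
    by (intro D.Add_idem functor_Hom) (auto simp: C.Zero_Hom)
qed

text \<open>Zero objects and biproducts are defined by equations, hence transported by additive functors.\<close>

lemma additive_category_image:
  assumes C: "additive_category C" and D: "preadditive_category D"
    and F: "additive_functor C D F" and surj: "FObj F ` Obj C = Obj D"
  shows "additive_category D"
proof -
  interpret C: preadditive C using C by (rule additive_category_preadditive)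
  interpret D: preadditive D by unfold_locales (rule D)
  have fun_F: "is_functor C D F" using F by (simp add: additive_functor_def)
  note zero = additive_functor_Zero[OF C.preadditive_axioms D.preadditive_axioms F]
  obtain Z where "zero_object C Z" using C by (rule additive_categoryE)
  then have "zero_object D (FObj F Z)"
    using zero[of Z Z] functor_Ide[OF fun_F, of Z] functor_Obj[OF fun_F]
    by (auto simp: C.zero_object_iff D.zero_object_iff)
  moreover have "\<exists>P i j p q. biproduct D X' Y' P i j p q" if XY: "X' \<in> Obj D" "Y' \<in> Obj D" for X' Y'
  proof -
    have "X' \<in> FObj F ` Obj C" "Y' \<in> FObj F ` Obj C" using surj XY by simp_all
    then obtain X Y where X: "X \<in> Obj C" "FObj F X = X'" and Y: "Y \<in> Obj C" "FObj F Y = Y'"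
      by blast
    obtain P i j p q where b: "biproduct C X Y P i j p q"
      using C X(1) Y(1) by (rule additive_category_biproductE)
    then have H: "i \<in> Hom C X P" "j \<in> Hom C Y P" "p \<in> Hom C P X" "q \<in> Hom C P Y" "P \<in> Obj C"
      by (auto simp: biproduct_def)
    have "biproduct D X' Y' (FObj F P) (FArr F i) (FArr F j) (FArr F p) (FArr F q)"
      using b X Y H functor_Hom[OF fun_F]
        additive_functor_Add[OF C.is_category F C.Comp_Hom[OF H(3,1)] C.Comp_Hom[OF H(4,2)]]
      by (auto simp: biproduct_def functor_Obj[OF fun_F] zero functor_Ide[OF fun_F]
          functor_Comp[OF fun_F, symmetric])
    then show ?thesis by blast
  qed
  ultimately show ?thesis using D unfolding additive_category_def by blast
qed

text \<open>The equational axioms relate parallel arrows and may be checked after applying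
  \<open>F\<close>, which is injective on Hom-sets. Surjectivity on Hom-sets supplies the
  negatives.\<close>

lemma preadditive_category_pullback:
  assumes H: "is_category H" and D: "preadditive_category D" and F: "is_functor H D F"
    and bij: "\<And>X Y. X \<in> Obj H \<Longrightarrow> Y \<in> Obj H \<Longrightarrow>
      bij_betw (FArr F) (Hom H X Y) (Hom D (FObj F X) (FObj F Y))"
    and Add: "\<And>f g X Y. f \<in> Hom H X Y \<Longrightarrow> g \<in> Hom H X Y \<Longrightarrow>
      f \<oplus>\<^bsub>H\<^esub> g \<in> Hom H X Y \<and> FArr F (f \<oplus>\<^bsub>H\<^esub> g) = FArr F f \<oplus>\<^bsub>D\<^esub> FArr F g"
    and Zero: "\<And>X Y. X \<in> Obj H \<Longrightarrow> Y \<in> Obj H \<Longrightarrow>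
      Zero H X Y \<in> Hom H X Y \<and> FArr F (Zero H X Y) = Zero D (FObj F X) (FObj F Y)"
  shows "preadditive_category H"
proof -
  interpret H: category H by unfold_locales (rule H)
  interpret D: preadditive D by unfold_locales (rule D)
  have inj: "f = g" if "f \<in> Hom H X Y" "g \<in> Hom H X Y" "FArr F f = FArr F g" for f g X Y
    using bij_betw_imp_inj_on[OF bij] H.Hom_Obj[OF that(1)] that by (auto dest: inj_onD)
  note FH = functor_Hom[OF F]
  have A: "f \<oplus>\<^bsub>H\<^esub> g \<in> Hom H X Y" and FA: "FArr F (f \<oplus>\<^bsub>H\<^esub> g) = FArr F f \<oplus>\<^bsub>D\<^esub> FArr F g"
    if "f \<in> Hom H X Y" "g \<in> Hom H X Y" for f g X Y using Add[OF that] by auto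
  note Z = Zero[THEN conjunct1] and FZ = Zero[THEN conjunct2]
  show ?thesis
  proof (rule preadditive_categoryI)
    fix X Y f g h
    assume f: "f \<in> Hom H X Y" and g: "g \<in> Hom H X Y" and h: "h \<in> Hom H X Y"
    show "f \<oplus>\<^bsub>H\<^esub> g \<oplus>\<^bsub>H\<^esub> h = f \<oplus>\<^bsub>H\<^esub> (g \<oplus>\<^bsub>H\<^esub> h)"
      by (rule inj[where X = X and Y = Y])
        (simp_all add: f g h A FA[where X = X and Y = Y] D.Add_assoc[OF FH[OF f] FH[OF g] FH[OF h]])
  next
    fix X Y f g
    assume f: "f \<in> Hom H X Y" and g: "g \<in> Hom H X Y"
    show "f \<oplus>\<^bsub>H\<^esub> g = g \<oplus>\<^bsub>H\<^esub> f"
      by (rule inj[where X = X and Y = Y])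
        (simp_all add: f g A FA[where X = X and Y = Y] D.Add_commute[OF FH[OF f] FH[OF g]])
  next
    fix X Y f
    assume f: "f \<in> Hom H X Y"
    then have XY: "X \<in> Obj H" "Y \<in> Obj H" using H.Hom_Obj by auto
    have "Zero D (FObj F X) (FObj F Y) \<oplus>\<^bsub>D\<^esub> FArr F f = FArr F f"
      using FH[OF f] by (simp add: Hom_def)
    then show "Zero H X Y \<oplus>\<^bsub>H\<^esub> f = f"
      by (intro inj[where X = X and Y = Y])
        (simp_all add: f XY A Z FZ FA[where X = X and Y = Y])
    obtain g where g: "g \<in> Hom H X Y" "FArr F g = D.neg (FArr F f)"
      using bij_betw_imp_surj_on[OF bij[OF XY]] D.neg_Hom[OF FH[OF f]] by (metis imageE)
    have "g \<oplus>\<^bsub>H\<^esub> f = Zero H X Y"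
      by (rule inj[where X = X and Y = Y])
        (simp_all add: f g XY A Z FZ FA[where X = X and Y = Y] D.neg_Add[OF FH[OF f]])
    with g show "\<exists>g\<in>Hom H X Y. g \<oplus>\<^bsub>H\<^esub> f = Zero H X Y" by blast
  next
    fix X Y Z f g g'
    assume f: "f \<in> Hom H X Y" and g: "g \<in> Hom H Y Z" and g': "g' \<in> Hom H Y Z"
    note C = H.Comp_Hom[OF f g] H.Comp_Hom[OF f g'] H.Comp_Hom[OF f A[OF g g']]
    show "(g \<oplus>\<^bsub>H\<^esub> g') \<cdot>\<^bsub>H\<^esub> f = g \<cdot>\<^bsub>H\<^esub> f \<oplus>\<^bsub>H\<^esub> g' \<cdot>\<^bsub>H\<^esub> f"
      by (rule inj[where X = X and Y = Z])
        (simp_all add: C A FA[OF g g'] FA[OF C(1,2)] functor_Comp[OF F f g] functor_Comp[OF F f g']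
          functor_Comp[OF F f A[OF g g']] D.Comp_distrib_right[OF FH[OF f] FH[OF g] FH[OF g']])
  next
    fix X Y Z f f' g
    assume f: "f \<in> Hom H X Y" and f': "f' \<in> Hom H X Y" and g: "g \<in> Hom H Y Z"
    note C = H.Comp_Hom[OF f g] H.Comp_Hom[OF f' g] H.Comp_Hom[OF A[OF f f'] g]
    show "g \<cdot>\<^bsub>H\<^esub> (f \<oplus>\<^bsub>H\<^esub> f') = g \<cdot>\<^bsub>H\<^esub> f \<oplus>\<^bsub>H\<^esub> g \<cdot>\<^bsub>H\<^esub> f'"
      by (rule inj[where X = X and Y = Z])
        (simp_all add: C A FA[OF f f'] FA[OF C(1,2)] functor_Comp[OF F f g] functor_Comp[OF F f' g]
          functor_Comp[OF F A[OF f f'] g] D.Comp_distrib_left[OF FH[OF f] FH[OF f'] FH[OF g]])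
  qed (use H A Z in auto)
qed


text \<open>The composite of \<open>F\<close> with \<open>G\<close> is conjugation by an
  isomorphism, hence additive. As \<open>G\<close> is additive and faithful, it can be cancelled
  from the resulting equation.\<close>

lemma additive_functor_inverse:
  assumes C: "preadditive_category C" and D: "preadditive_category D"
    and F: "is_functor C D F" and G: "additive_functor D C G"
    and GF: "naturally_isomorphic C C (comp_functor G F) id_functor"
    and FG: "naturally_isomorphic D D (comp_functor F G) id_functor"
  shows "additive_functor C D F"
proof -
  interpret C: preadditive C by unfold_locales (rule C)
  interpret D: preadditive D by unfold_locales (rule D)
  have G': "is_functor D C G" using G by (simp add: additive_functor_def)
  note comp = is_functor_comp[OF F G']
  obtain \<eta> \<eta>' where \<eta>: "\<And>X. X \<in> Obj C \<Longrightarrow> \<eta> X \<in> Hom C (FObj (comp_functor G F) X) X"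
    and \<eta>': "\<And>X. X \<in> Obj C \<Longrightarrow> \<eta>' X \<in> Hom C X (FObj (comp_functor G F) X)"
    and conj: "\<And>f X Y. f \<in> Hom C X Y \<Longrightarrow>
      FArr (comp_functor G F) f = \<eta>' Y \<cdot>\<^bsub>C\<^esub> (f \<cdot>\<^bsub>C\<^esub> \<eta> X)"
    using C.is_category comp GF by (rule naturally_isomorphic_idE) blast
  have "FArr F (f \<oplus>\<^bsub>C\<^esub> g) = FArr F f \<oplus>\<^bsub>D\<^esub> FArr F g"
    if XY: "X \<in> Obj C" "Y \<in> Obj C" and f: "f \<in> Hom C X Y" and g: "g \<in> Hom C X Y" for X Y f g
  proof -
    note H = functor_Hom[OF F f] functor_Hom[OF F g]
    have "FArr G (FArr F (f \<oplus>\<^bsub>C\<^esub> g)) = \<eta>' Y \<cdot>\<^bsub>C\<^esub> ((f \<oplus>\<^bsub>C\<^esub> g) \<cdot>\<^bsub>C\<^esub> \<eta> X)"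
      using conj[OF C.Add_Hom[OF f g]] by simp
    also have "\<dots> = \<eta>' Y \<cdot>\<^bsub>C\<^esub> (f \<cdot>\<^bsub>C\<^esub> \<eta> X) \<oplus>\<^bsub>C\<^esub> \<eta>' Y \<cdot>\<^bsub>C\<^esub> (g \<cdot>\<^bsub>C\<^esub> \<eta> X)"
      unfolding C.Comp_distrib_right[OF \<eta>[OF XY(1)] f g]
      by (rule C.Comp_distrib_left[OF C.Comp_Hom[OF \<eta>[OF XY(1)] f] C.Comp_Hom[OF \<eta>[OF XY(1)] g] \<eta>'[OF XY(2)]])
    also have "\<dots> = FArr G (FArr F f) \<oplus>\<^bsub>C\<^esub> FArr G (FArr F g)"
      using conj[OF f] conj[OF g] by simp
    also have "\<dots> = FArr G (FArr F f \<oplus>\<^bsub>D\<^esub> FArr F g)"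
      using additive_functor_Add[OF D.is_category G H] by simp
    finally show ?thesis
      by (rule equivalence_faithful[OF D.is_category G' F FG functor_Hom[OF F C.Add_Hom[OF f g]] D.Add_Hom[OF H]])
  qed
  then show ?thesis using F by (simp add: additive_functor_def)
qed

section \<open>Full subcategories and additive quotients\<close>

lemma full_subcat_simps [simp]:
  "Obj (full_subcat C S) = Obj C \<inter> S" "Dom (full_subcat C S) = Dom C"
  "Cod (full_subcat C S) = Cod C" "Ide (full_subcat C S) = Ide C"
  "Comp (full_subcat C S) = Comp C"
  by (simp_all add: full_subcat_def)

lemma full_subcat_add_simps [simp]:
  "Add (full_subcat C S) = Add C" "Zero (full_subcat C S) = Zero C"
  by (simp_all add: full_subcat_def)

lemma Hom_full_subcat:
  "f \<in> Hom (full_subcat C S) X Y \<longleftrightarrow> f \<in> Hom C X Y \<and> X \<in> S \<and> Y \<in> S"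
  by (auto simp: Hom_def full_subcat_def)

lemma Arr_full_subcat:
  "f \<in> Arr (full_subcat C S) \<longleftrightarrow> f \<in> Arr C \<and> Dom C f \<in> S \<and> Cod C f \<in> S"
  by (auto simp: full_subcat_def)

lemma is_category_full_subcat: "is_category C \<Longrightarrow> is_category (full_subcat C S)"
  by (auto simp: is_category_def Hom_full_subcat Arr_full_subcat)

lemma preadditive_category_full_subcat:
  assumes "preadditive_category C"
  shows "preadditive_category (full_subcat C S)"
proof -
  interpret preadditive C by unfold_locales (rule assms)
  show ?thesis
  proof (rule preadditive_categoryI)
    fix X Y f assume "f \<in> Hom (full_subcat C S) X Y"
    then show "\<exists>g\<in>Hom (full_subcat C S) X Y. g \<oplus>\<^bsub>full_subcat C S\<^esub> f = Zero (full_subcat C S) X Y"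
      by (intro bexI[of _ "neg f"]) (auto simp: Hom_full_subcat neg_Add neg_Hom)
  qed (auto simp: is_category_full_subcat is_category Hom_full_subcat Add_Hom Add_assoc Zero_Hom
      intro: Add_commute, auto simp: Hom_def)
qed

lemma zero_object_full_subcat:
  assumes "preadditive_category C"
  shows "zero_object (full_subcat C S) Z \<longleftrightarrow> zero_object C Z \<and> Z \<in> S"
proof -
  interpret preadditive C by unfold_locales (rule assms)
  interpret S: preadditive "full_subcat C S"
    by unfold_locales (rule preadditive_category_full_subcat[OF assms])
  show ?thesis by (auto simp: zero_object_iff S.zero_object_iff)
qed

lemma biproduct_full_subcat:
  "biproduct (full_subcat C S) X Y P i j p q \<longleftrightarrow>
    biproduct C X Y P i j p q \<and> X \<in> S \<and> Y \<in> S \<and> P \<in> S"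
  by (auto simp: biproduct_def Hom_full_subcat)

lemma additive_category_full_subcat:
  assumes "additive_category C" "full_additive_subcategory C S"
  shows "additive_category (full_subcat C S)"
proof -
  have C: "preadditive_category C" using assms by (simp add: additive_category_def)
  obtain Z where "zero_object C Z" using assms(1) by (rule additive_categoryE)
  moreover from this have "Z \<in> S" by (rule full_additive_zero[OF assms(2)])
  ultimately have "\<exists>Z. zero_object (full_subcat C S) Z"
    using zero_object_full_subcat[OF C] by blast
  moreover have "\<exists>P i j p q. biproduct (full_subcat C S) X Y P i j p q"
    if "X \<in> Obj C \<inter> S" "Y \<in> Obj C \<inter> S" for X Y
  proof -
    have XY: "X \<in> Obj C" "Y \<in> Obj C" "X \<in> S" "Y \<in> S" using that by simp_all
    obtain P i j p q where "biproduct C X Y P i j p q"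
      using assms(1) XY(1,2) by (rule additive_category_biproductE)
    then show ?thesis
      using full_additive_biproduct[OF assms(2) _ XY(3,4)] XY by (metis biproduct_full_subcat)
  qed
  ultimately show ?thesis
    using preadditive_category_full_subcat[OF C] by (simp add: additive_category_def)
qed

section \<open>The ideal of maps through \<open>U\<close> and the quotient by it\<close>

locale additive_ideal = preadditive C for C :: "('o, 'a, 'z) add_cat_scheme" (structure) +
  fixes U :: "'o set"
  assumes additive: "additive_category C"
    and full_additive: "full_additive_subcategory C U"
begin

lemma U_Obj: "X \<in> U \<Longrightarrow> X \<in> Obj C"
  using full_additive by (auto simp: full_additive_subcategory_def)

abbreviation null :: "'a \<Rightarrow> bool" where "null \<equiv> factors_through C U"

lemma nullI: "a \<in> Hom C X Z \<Longrightarrow> b \<in> Hom C Z Y \<Longrightarrow> Z \<in> U \<Longrightarrow> null (b \<cdot> a)"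
  unfolding factors_through_def by (force simp: Hom_def)

lemma nullE:
  assumes "null h" "h \<in> Hom C X Y"
  obtains Z a b where "Z \<in> U" "a \<in> Hom C X Z" "b \<in> Hom C Z Y" "h = b \<cdot> a"
  using assms unfolding factors_through_def by (auto simp: Hom_def[of C X Y])

lemma null_Zero:
  assumes "X \<in> Obj C" "Y \<in> Obj C"
  shows "null (Zero C X Y)"
proof -
  obtain Z where "zero_object C Z" using additive by (rule additive_categoryE)
  then have "Z \<in> U" "Z \<in> Obj C" using full_additive_zero[OF full_additive] U_Obj by blast+
  then show ?thesis using nullI[of "Zero C X Z" X Z "Zero C Z Y" Y] assms by (simp add: Zero_Hom)
qed

lemma null_Comp_left:
  assumes "null h" "h \<in> Hom C X Y" "g \<in> Hom C Y Z"
  shows "null (g \<cdot> h)"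
proof -
  obtain V a b where "V \<in> U" "a \<in> Hom C X V" "b \<in> Hom C V Y" "h = b \<cdot> a"
    using assms(1,2) by (rule nullE)
  then show ?thesis using nullI[of a X V "g \<cdot> b" Z] assms(3) by (auto simp: Hom_def)
qed

lemma null_Comp_right:
  assumes "null h" "h \<in> Hom C X Y" "g \<in> Hom C Z X"
  shows "null (h \<cdot> g)"
proof -
  obtain V a b where "V \<in> U" "a \<in> Hom C X V" "b \<in> Hom C V Y" "h = b \<cdot> a"
    using assms(1,2) by (rule nullE)
  then show ?thesis using nullI[of "a \<cdot> g" Z V b Y] assms(3) by (auto simp: Hom_def)
qed

lemma null_neg:
  assumes "null h" "h \<in> Hom C X Y"
  shows "null (neg h)"
proof -
  obtain V a b where "V \<in> U" "a \<in> Hom C X V" "b \<in> Hom C V Y" "h = b \<cdot> a"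
    using assms by (rule nullE)
  then show ?thesis using nullI[of a X V "neg b" Y] by (simp add: neg_Comp neg_Hom)
qed

text \<open>The sum factors through the biproduct of the two middle objects, by the column of the
  first factors and the row of the second ones. This is where closure of \<open>U\<close> under
  biproducts enters.\<close>

lemma null_Add:
  assumes "null h" "h \<in> Hom C X Y" "null k" "k \<in> Hom C X Y"
  shows "null (h \<oplus> k)"
proof -
  obtain V a b where h: "V \<in> U" "a \<in> Hom C X V" "b \<in> Hom C V Y" "h = b \<cdot> a"
    using assms(1,2) by (rule nullE)
  obtain V' a' b' where k: "V' \<in> U" "a' \<in> Hom C X V'" "b' \<in> Hom C V' Y" "k = b' \<cdot> a'"
    using assms(3,4) by (rule nullE)
  obtain P i j p q where P: "biproduct C V V' P i j p q"
    using additive U_Obj[OF h(1)] U_Obj[OF k(1)] by (rule additive_category_biproductE)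
  then have "P \<in> U" using full_additive_biproduct[OF full_additive] h(1) k(1) by blast
  moreover have "i \<cdot> a \<oplus> j \<cdot> a' \<in> Hom C X P" "b \<cdot> p \<oplus> b' \<cdot> q \<in> Hom C P Y"
    using P h k by (auto simp: biproduct_def Hom_def)
  moreover have "(b \<cdot> p \<oplus> b' \<cdot> q) \<cdot> (i \<cdot> a \<oplus> j \<cdot> a') = h \<oplus> k"
  proof -
    have e: "p \<cdot> i = Ide C V" "q \<cdot> j = Ide C V'" "q \<cdot> i = Zero C V V'" "p \<cdot> j = Zero C V' V"
      and H: "i \<in> Hom C V P" "j \<in> Hom C V' P" "p \<in> Hom C P V" "q \<in> Hom C P V'"
      using P by (auto simp: biproduct_def)
    have r: "p \<cdot> (i \<cdot> a) = a" "q \<cdot> (j \<cdot> a') = a'" "q \<cdot> (i \<cdot> a) = Zero C X V'" "p \<cdot> (j \<cdot> a') = Zero C X V"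
      using e[THEN Comp_reassoc] H h k U_Obj by (auto simp: Hom_def)
    show ?thesis using H h k U_Obj r by (auto simp: Hom_def)
  qed
  ultimately show ?thesis using nullI by metis
qed

lemma ideal_rel_iff:
  "(f, g) \<in> ideal_rel C U \<longleftrightarrow>
    (\<exists>X Y h. f \<in> Hom C X Y \<and> g \<in> Hom C X Y \<and> h \<in> Hom C X Y \<and> null h \<and> f = g \<oplus> h)"
  unfolding ideal_rel_def using Hom_Obj by auto blast

lemma ideal_relI:
  "g \<in> Hom C X Y \<Longrightarrow> h \<in> Hom C X Y \<Longrightarrow> null h \<Longrightarrow> (g \<oplus> h, g) \<in> ideal_rel C U"
  using Add_Hom unfolding ideal_rel_iff by blast

lemma ideal_rel_neg:
  assumes "f \<in> Hom C X Y" "g \<in> Hom C X Y" "null (f \<oplus> neg g)"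
  shows "(f, g) \<in> ideal_rel C U"
  using ideal_relI[OF assms(2) _ assms(3)] assms Add_neg_cancel[OF assms(1,2)]
  by (simp add: Add_Hom neg_Hom)

lemma congruence_ideal_rel: "congruence C (ideal_rel C U)"
proof
  show "equiv (Arr C) (ideal_rel C U)"
  proof (rule equivI)
    show "ideal_rel C U \<subseteq> Arr C \<times> Arr C" by (auto simp: ideal_rel_iff Hom_def)
    show "refl_on (Arr C) (ideal_rel C U)"
    proof (rule refl_onI)
      fix f assume f: "f \<in> Arr C"
      then show "(f, f) \<in> ideal_rel C U"
        using ideal_relI[of f "Dom C f" "Cod C f" "Zero C (Dom C f) (Cod C f)"]
        by (simp add: null_Zero Hom_def)
    qed
    show "sym (ideal_rel C U)"
    proof (rule symI)
      fix f g assume "(f, g) \<in> ideal_rel C U"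
      then obtain X Y h where *: "g \<in> Hom C X Y" "h \<in> Hom C X Y" "null h" "f = g \<oplus> h"
        by (auto simp: ideal_rel_iff)
      then have "f \<oplus> neg h = g"
        using Add_assoc[of g X Y h "neg h"] Add_neg[of h X Y] neg_Hom[of h X Y] Hom_Obj
        by (auto simp: Hom_def)
      then show "(g, f) \<in> ideal_rel C U"
        using ideal_relI[of f X Y "neg h"] * by (simp add: null_neg neg_Hom Add_Hom)
    qed
    show "trans (ideal_rel C U)"
    proof (rule transI)
      fix f g k assume "(f, g) \<in> ideal_rel C U" "(g, k) \<in> ideal_rel C U"
      then obtain X Y h X' Y' h' where *: "h \<in> Hom C X Y" "null h" "g \<in> Hom C X Y" "f = g \<oplus> h"
        "h' \<in> Hom C X' Y'" "null h'" "k \<in> Hom C X' Y'" "g = k \<oplus> h'"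
        by (auto simp: ideal_rel_iff)
      moreover from this have "X' = X" "Y' = Y" using Add_Hom by (auto simp: Hom_def)
      ultimately show "(f, k) \<in> ideal_rel C U"
        using ideal_relI[of k X Y "h' \<oplus> h"] Add_assoc[of k X Y h' h] null_Add by (simp add: Add_Hom)
    qed
  qed
  fix f f' assume "(f, f') \<in> ideal_rel C U"
  then obtain X Y h where f: "f \<in> Hom C X Y" "f' \<in> Hom C X Y" "h \<in> Hom C X Y" "null h" "f = f' \<oplus> h"
    unfolding ideal_rel_iff by blast
  show "Dom C f = Dom C f' \<and> Cod C f = Cod C f'" using f(1,2) by (simp add: Hom_def)
  fix g g' assume gg': "(g, g') \<in> ideal_rel C U" and comp: "Cod C f = Dom C g"
  obtain V Z k where "g \<in> Hom C V Z" "g' \<in> Hom C V Z" "k \<in> Hom C V Z" "null k" "g = g' \<oplus> k"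
    using gg' unfolding ideal_rel_iff by blast
  moreover from this have "V = Y" using f(1) comp by (simp add: Hom_def)
  ultimately have g: "g \<in> Hom C Y Z" "g' \<in> Hom C Y Z" "k \<in> Hom C Y Z" "null k" "g = g' \<oplus> k"
    by simp_all
  have H: "g' \<cdot> f' \<in> Hom C X Z" "g' \<cdot> h \<in> Hom C X Z" "k \<cdot> f \<in> Hom C X Z"
    by (rule Comp_Hom; fact)+
  have "null (g' \<cdot> h \<oplus> k \<cdot> f)"
    by (rule null_Add[OF null_Comp_left[OF f(4,3) g(2)] H(2) null_Comp_right[OF g(4,3) f(1)] H(3)])
  \<comment> \<open>Only one factor is expanded at a time: \<open>k\<close> is multiplied with the
    whole of \<open>f\<close>, so two error terms arise and no mixed third one.\<close>
  moreover have "g \<cdot> f = g' \<cdot> f' \<oplus> (g' \<cdot> h \<oplus> k \<cdot> f)"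
  proof -
    have "g \<cdot> f = g' \<cdot> f \<oplus> k \<cdot> f" using Comp_distrib_right[OF f(1) g(2,3)] g(5) by simp
    also have "g' \<cdot> f = g' \<cdot> f' \<oplus> g' \<cdot> h" using Comp_distrib_left[OF f(2,3) g(2)] f(5) by simp
    finally show ?thesis using Add_assoc[OF H] by simp
  qed
  ultimately show "(g \<cdot> f, g' \<cdot> f') \<in> ideal_rel C U"
    using ideal_relI[OF H(1) Add_Hom[OF H(2,3)]] by simp
qed

sublocale Quo: congruence C "ideal_rel C U"
  by (rule congruence_ideal_rel)

abbreviation AQuo where "AQuo \<equiv> additive_quotient C U"

lemma truncate_AQuo [simp]: "cat.truncate AQuo = Quo.Quo"
  by (simp add: additive_quotient_def cat.truncate_def cat.extend_def)

lemma Add_compatible: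
  assumes "(f, f') \<in> ideal_rel C U" "(g, g') \<in> ideal_rel C U" "Dom C f = Dom C g" "Cod C f = Cod C g"
  shows "(f \<oplus> g, f' \<oplus> g') \<in> ideal_rel C U"
proof -
  obtain X Y h where f: "f \<in> Hom C X Y" "f' \<in> Hom C X Y" "h \<in> Hom C X Y" "null h" "f = f' \<oplus> h"
    using assms(1) unfolding ideal_rel_iff by blast
  obtain X' Y' k where "g \<in> Hom C X' Y'" "g' \<in> Hom C X' Y'" "k \<in> Hom C X' Y'" "null k" "g = g' \<oplus> k"
    using assms(2) unfolding ideal_rel_iff by blast
  moreover from this have "X' = X" "Y' = Y" using f(1) assms(3,4) by (simp_all add: Hom_def)
  ultimately have g: "g \<in> Hom C X Y" "g' \<in> Hom C X Y" "k \<in> Hom C X Y" "null k" "g = g' \<oplus> k"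
    by simp_all
  have "f \<oplus> g = (f' \<oplus> g') \<oplus> (h \<oplus> k)" using Add_add_swap[OF f(2,3) g(2,3)] f(5) g(5) by simp
  then show ?thesis
    using ideal_relI[OF Add_Hom[OF f(2) g(2)] Add_Hom[OF f(3) g(3)] null_Add[OF f(4,3) g(4,3)]] by simp
qed

lemma Add_cls:
  assumes "f \<in> Hom C X Y" "g \<in> Hom C X Y"
  shows "Quo.cls f \<oplus>\<^bsub>AQuo\<^esub> Quo.cls g = Quo.cls (f \<oplus> g)"
proof -
  have "f \<in> Arr C" "g \<in> Arr C" "Dom C f = Dom C g" "Cod C f = Cod C g"
    using assms by (auto simp: Hom_def)
  then show ?thesis
    using Quo.cls_eqI[OF Add_compatible[OF Quo.some_cls Quo.some_cls], of f g]
    by (simp add: additive_quotient_def cat.extend_def add_cat.fields_def)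
qed

lemma Zero_AQuo: "Zero AQuo X Y = Quo.cls (Zero C X Y)"
  by (simp add: additive_quotient_def cat.extend_def add_cat.fields_def)

lemma AQuo_simps:
  "Obj AQuo = Obj C" "Hom AQuo X Y = Hom Quo.Quo X Y" "Ide AQuo X = Quo.cls (Ide C X)"
  "Comp AQuo = Comp Quo.Quo" "Arr AQuo = Arr Quo.Quo" "Dom AQuo = Dom Quo.Quo" "Cod AQuo = Cod Quo.Quo"
  using Hom_truncate[of AQuo] truncate_simps[of AQuo] Quo.Obj_Quo Quo.Ide_Quo by simp_all

lemma is_category_AQuo: "is_category AQuo"
  using Quo.is_category_Quo is_category_truncate[of AQuo] by simp

lemma Comp_AQuo: "f \<in> Hom C X Y \<Longrightarrow> g \<in> Hom C Y Z \<Longrightarrow> Quo.cls g \<cdot>\<^bsub>AQuo\<^esub> Quo.cls f = Quo.cls (g \<cdot> f)"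
  by (simp add: AQuo_simps Quo.Comp_cls_Hom)

lemma cls_Hom_AQuo: "f \<in> Hom C X Y \<Longrightarrow> Quo.cls f \<in> Hom AQuo X Y"
  by (simp add: AQuo_simps Quo.cls_Hom)

lemma Hom_AQuoE:
  assumes "c \<in> Hom AQuo X Y"
  obtains f where "f \<in> Hom C X Y" "c = Quo.cls f"
  using assms by (auto simp: AQuo_simps elim: Quo.Hom_QuoE)

lemma preadditive_category_AQuo: "preadditive_category AQuo"
proof (rule preadditive_categoryI)
  fix X Y c d k
  assume "c \<in> Hom AQuo X Y" "d \<in> Hom AQuo X Y" "k \<in> Hom AQuo X Y"
  then obtain f g h where *: "f \<in> Hom C X Y" "c = Quo.cls f" "g \<in> Hom C X Y" "d = Quo.cls g"
    "h \<in> Hom C X Y" "k = Quo.cls h" by (metis Hom_AQuoE)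
  then show "c \<oplus>\<^bsub>AQuo\<^esub> d \<oplus>\<^bsub>AQuo\<^esub> k = c \<oplus>\<^bsub>AQuo\<^esub> (d \<oplus>\<^bsub>AQuo\<^esub> k)"
    by (simp add: Add_cls[where X = X and Y = Y] Add_Hom Add_assoc[OF *(1,3,5)])
next
  fix X Y c d
  assume "c \<in> Hom AQuo X Y" "d \<in> Hom AQuo X Y"
  then obtain f g where *: "f \<in> Hom C X Y" "c = Quo.cls f" "g \<in> Hom C X Y" "d = Quo.cls g"
    by (metis Hom_AQuoE)
  then show "c \<oplus>\<^bsub>AQuo\<^esub> d \<in> Hom AQuo X Y" "c \<oplus>\<^bsub>AQuo\<^esub> d = d \<oplus>\<^bsub>AQuo\<^esub> c"
    using Add_commute[OF *(1,3)] by (simp_all add: Add_cls[OF *(1,3)] Add_cls[OF *(3,1)] Add_Hom cls_Hom_AQuo)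
next
  fix X Y c
  assume "c \<in> Hom AQuo X Y"
  then obtain f where *: "f \<in> Hom C X Y" "c = Quo.cls f" by (rule Hom_AQuoE)
  then show "Zero AQuo X Y \<oplus>\<^bsub>AQuo\<^esub> c = c"
    using Add_cls[OF Zero_Hom *(1)] Hom_Obj[OF *(1)] by (simp add: Zero_AQuo Hom_def)
  show "\<exists>g\<in>Hom AQuo X Y. g \<oplus>\<^bsub>AQuo\<^esub> c = Zero AQuo X Y"
    by (rule bexI[of _ "Quo.cls (neg f)"])
      (simp_all only: *(2) Zero_AQuo Add_cls[OF neg_Hom[OF *(1)] *(1)] neg_Add[OF *(1)]
        cls_Hom_AQuo[OF neg_Hom[OF *(1)]])
next
  fix X Y Z c d d'
  assume "c \<in> Hom AQuo X Y" "d \<in> Hom AQuo Y Z" "d' \<in> Hom AQuo Y Z"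
  then obtain f g g' where *: "f \<in> Hom C X Y" "c = Quo.cls f" "g \<in> Hom C Y Z" "d = Quo.cls g"
    "g' \<in> Hom C Y Z" "d' = Quo.cls g'" by (metis Hom_AQuoE)
  show "(d \<oplus>\<^bsub>AQuo\<^esub> d') \<cdot>\<^bsub>AQuo\<^esub> c = d \<cdot>\<^bsub>AQuo\<^esub> c \<oplus>\<^bsub>AQuo\<^esub> d' \<cdot>\<^bsub>AQuo\<^esub> c"
    by (simp only: * Add_cls[OF *(3,5)] Comp_AQuo[OF *(1) Add_Hom[OF *(3,5)]] Comp_AQuo[OF *(1,3)]
        Comp_AQuo[OF *(1,5)] Add_cls[OF Comp_Hom[OF *(1,3)] Comp_Hom[OF *(1,5)]]
        Comp_distrib_right[OF *(1,3,5)])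
next
  fix X Y Z c c' d
  assume "c \<in> Hom AQuo X Y" "c' \<in> Hom AQuo X Y" "d \<in> Hom AQuo Y Z"
  then obtain f f' g where *: "f \<in> Hom C X Y" "c = Quo.cls f" "f' \<in> Hom C X Y" "c' = Quo.cls f'"
    "g \<in> Hom C Y Z" "d = Quo.cls g" by (metis Hom_AQuoE)
  show "d \<cdot>\<^bsub>AQuo\<^esub> (c \<oplus>\<^bsub>AQuo\<^esub> c') = d \<cdot>\<^bsub>AQuo\<^esub> c \<oplus>\<^bsub>AQuo\<^esub> d \<cdot>\<^bsub>AQuo\<^esub> c'"
    by (simp only: * Add_cls[OF *(1,3)] Comp_AQuo[OF Add_Hom[OF *(1,3)] *(5)] Comp_AQuo[OF *(1,5)]
        Comp_AQuo[OF *(3,5)] Add_cls[OF Comp_Hom[OF *(1,5)] Comp_Hom[OF *(3,5)]]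
        Comp_distrib_left[OF *(1,3,5)])
qed (auto simp: is_category_AQuo AQuo_simps Zero_AQuo Quo.cls_Hom Zero_Hom)

text \<open>The quotient functor is additive and the identity on objects, so the zero object and the
  biproducts of \<open>C\<close> descend.\<close>

lemma additive_category_AQuo: "additive_category AQuo"
proof (rule additive_category_image[OF additive preadditive_category_AQuo])
  let ?F = "\<lparr>FObj = \<lambda>X. X, FArr = Quo.cls\<rparr>"
  have "is_functor C AQuo ?F"
    unfolding is_functor_def by (auto simp: AQuo_simps Quo.Comp_cls Quo.cls_Hom Hom_def[of C])
  then show "additive_functor C AQuo ?F"
    by (simp add: additive_functor_def Add_cls)
  show "FObj ?F ` Obj C = Obj AQuo" by (simp add: AQuo_simps)
qed

end

section \<open>Weak factorization systems\<close>

lemma liftsE: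
  assumes "lifts C l r" "l \<in> Hom C X Y" "r \<in> Hom C E B" "u \<in> Hom C X E" "v \<in> Hom C Y B"
    "r \<cdot>\<^bsub>C\<^esub> u = v \<cdot>\<^bsub>C\<^esub> l"
  obtains h where "h \<in> Hom C Y E" "h \<cdot>\<^bsub>C\<^esub> l = u" "r \<cdot>\<^bsub>C\<^esub> h = v"
proof -
  have D: "Dom C l = X" "Cod C l = Y" "Dom C r = E" "Cod C r = B"
    using assms(2,3) by (simp_all add: Hom_def)
  show thesis using assms(1,4-6) that unfolding lifts_def D by blast
qed

lemma factorizationsE:
  assumes "factorizations C L R" "f \<in> Hom C X Y" "L \<subseteq> Arr C" "R \<subseteq> Arr C"
  obtains V i p where "i \<in> Hom C X V" "p \<in> Hom C V Y" "i \<in> L" "p \<in> R" "f = p \<cdot>\<^bsub>C\<^esub> i"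
proof -
  have "f \<in> Arr C" using assms(2) by (simp add: Hom_def)
  then obtain i p where ip: "i \<in> L" "p \<in> R" "Dom C i = Dom C f" "Cod C i = Dom C p" "Cod C p = Cod C f"
    "f = p \<cdot>\<^bsub>C\<^esub> i"
    using assms(1) unfolding factorizations_def by blast
  then have "i \<in> Hom C X (Dom C p)" "p \<in> Hom C (Dom C p) Y"
    using assms(2-4) by (auto simp: Hom_def)
  then show thesis using ip that by blast
qed

lemma retract_closedD:
  assumes "retract_closed C M" "f \<in> M" "g \<in> Hom C X Y" "f \<in> Hom C X' Y'"
    "\<phi>1 \<in> Hom C X X'" "\<psi>1 \<in> Hom C X' X" "\<phi>2 \<in> Hom C Y Y'" "\<psi>2 \<in> Hom C Y' Y"
    "f \<cdot>\<^bsub>C\<^esub> \<phi>1 = \<phi>2 \<cdot>\<^bsub>C\<^esub> g" "g \<cdot>\<^bsub>C\<^esub> \<psi>1 = \<psi>2 \<cdot>\<^bsub>C\<^esub> f"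
    "\<psi>1 \<cdot>\<^bsub>C\<^esub> \<phi>1 = Ide C X" "\<psi>2 \<cdot>\<^bsub>C\<^esub> \<phi>2 = Ide C Y"
  shows "g \<in> M"
proof -
  have D: "Dom C g = X" "Cod C g = Y" "Dom C f = X'" "Cod C f = Y'" "g \<in> Arr C" "f \<in> Arr C"
    using assms(3,4) by (simp_all add: Hom_def)
  have "retract_of C g f"
    unfolding retract_of_def D using assms(5-12) D by blast
  then show ?thesis using assms(1,2) unfolding retract_closed_def by blast
qed

text \<open>A model structure contains two such systems on one category. Each closure property
  proved here is read once for cofibrations and trivial fibrations, once for trivial cofibrations
  and fibrations.\<close>

locale weak_factorization_system = preadditive C
  for C :: "('o, 'a, 'z) add_cat_scheme" (structure) +
  fixes L R :: "'a set"
  assumes L_Arr: "L \<subseteq> Arr C" and R_Arr: "R \<subseteq> Arr C"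
    and L_retract: "retract_closed C L" and R_retract: "retract_closed C R"
    and lifting: "l \<in> L \<Longrightarrow> r \<in> R \<Longrightarrow> lifts C l r"
    and factorization: "factorizations C L R"
begin

lemmas factorE = factorizationsE[OF factorization _ L_Arr R_Arr]
lemmas liftE = liftsE[OF lifting]

text \<open>The retract argument: factor \<open>l = p \<cdot> i\<close> and lift \<open>l\<close>
  against \<open>p\<close>. The lift is a section of \<open>p\<close> that exhibits \<open>l\<close>
  as a retract of \<open>i\<close>.\<close>

lemma L_if_lifts:
  assumes l: "l \<in> Hom C X Y"
    and *: "\<And>E B r u v. r \<in> R \<Longrightarrow> r \<in> Hom C E B \<Longrightarrow> u \<in> Hom C X E \<Longrightarrow> v \<in> Hom C Y B \<Longrightarrow>
      r \<cdot> u = v \<cdot> l \<Longrightarrow> \<exists>h\<in>Hom C Y E. h \<cdot> l = u \<and> r \<cdot> h = v"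
  shows "l \<in> L"
proof -
  obtain V i p where ip: "i \<in> Hom C X V" "p \<in> Hom C V Y" "i \<in> L" "p \<in> R" "l = p \<cdot> i"
    using l by (rule factorE)
  have XY: "X \<in> Obj C" "Y \<in> Obj C" using Hom_Obj[OF l] by simp_all
  have I: "Ide C Y \<cdot> l = l" "i \<cdot> Ide C X = i" "l \<cdot> Ide C X = l" "Ide C X \<cdot> Ide C X = Ide C X"
    using l ip(1) XY by (simp_all add: Hom_def)
  obtain h where h: "h \<in> Hom C Y V" "h \<cdot> l = i" "p \<cdot> h = Ide C Y"
    using *[OF ip(4,2,1) Ide_Hom[OF XY(2)]] ip(5) I by auto
  show ?thesis
    by (rule retract_closedD[OF L_retract ip(3) l ip(1) Ide_Hom[OF XY(1)] Ide_Hom[OF XY(1)] h(1) ip(2)])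
      (simp_all add: h I ip(5)[symmetric])
qed

text \<open>Dual retract argument: a lift of \<open>i\<close> against \<open>r\<close> is a
  retraction of \<open>i\<close> and exhibits \<open>r\<close> as a retract of
  \<open>p\<close>.\<close>

lemma R_if_lifts:
  assumes r: "r \<in> Hom C E B"
    and *: "\<And>X Y l u v. l \<in> L \<Longrightarrow> l \<in> Hom C X Y \<Longrightarrow> u \<in> Hom C X E \<Longrightarrow> v \<in> Hom C Y B \<Longrightarrow>
      r \<cdot> u = v \<cdot> l \<Longrightarrow> \<exists>h\<in>Hom C Y E. h \<cdot> l = u \<and> r \<cdot> h = v"
  shows "r \<in> R"
proof -
  obtain V i p where ip: "i \<in> Hom C E V" "p \<in> Hom C V B" "i \<in> L" "p \<in> R" "r = p \<cdot> i"
    using r by (rule factorE)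
  have EB: "E \<in> Obj C" "B \<in> Obj C" using Hom_Obj[OF r] by simp_all
  have I: "r \<cdot> Ide C E = r" "Ide C B \<cdot> p = p" "Ide C B \<cdot> r = r" "Ide C B \<cdot> Ide C B = Ide C B"
    using r ip(2) EB by (simp_all add: Hom_def)
  obtain h where h: "h \<in> Hom C V E" "h \<cdot> i = Ide C E" "r \<cdot> h = p"
    using *[OF ip(3,1) Ide_Hom[OF EB(1)] ip(2)] ip(5) I by auto
  show ?thesis
    by (rule retract_closedD[OF R_retract ip(4) r ip(2) ip(1) h(1) Ide_Hom[OF EB(2)] Ide_Hom[OF EB(2)]])
      (simp_all add: h I ip(5)[symmetric])
qed

lemma Ide_L: "X \<in> Obj C \<Longrightarrow> Ide C X \<in> L"
  by (rule L_if_lifts[OF Ide_Hom]) (auto simp: Hom_def)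

lemma Ide_R: "X \<in> Obj C \<Longrightarrow> Ide C X \<in> R"
  by (rule R_if_lifts[OF Ide_Hom]) (auto simp: Hom_def)

lemma Comp_L:
  assumes f: "f \<in> Hom C X Y" "f \<in> L" and g: "g \<in> Hom C Y Z" "g \<in> L"
  shows "g \<cdot> f \<in> L"
proof (rule L_if_lifts[OF Comp_Hom[OF f(1) g(1)]])
  fix E B r u v
  assume r: "r \<in> R" "r \<in> Hom C E B" and u: "u \<in> Hom C X E" and v: "v \<in> Hom C Z B"
    and sq: "r \<cdot> u = v \<cdot> (g \<cdot> f)"
  have "r \<cdot> u = (v \<cdot> g) \<cdot> f" using sq f g v by (simp add: Hom_def)
  then obtain h where h: "h \<in> Hom C Y E" "h \<cdot> f = u" "r \<cdot> h = v \<cdot> g"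
    using liftE[OF f(2) r(1) f(1) r(2) u Comp_Hom[OF g(1) v]] by metis
  obtain k where k: "k \<in> Hom C Z E" "k \<cdot> g = h" "r \<cdot> k = v"
    using liftE[OF g(2) r(1) g(1) r(2) h(1) v h(3)] by metis
  have "k \<cdot> (g \<cdot> f) = u"
    using Comp_reassoc[OF k(2)] f g k(1) h(2) by (simp add: Hom_def)
  then show "\<exists>h\<in>Hom C Z E. h \<cdot> (g \<cdot> f) = u \<and> r \<cdot> h = v" using k by blast
qed

lemma Comp_R:
  assumes f: "f \<in> Hom C X Y" "f \<in> R" and g: "g \<in> Hom C Y Z" "g \<in> R"
  shows "g \<cdot> f \<in> R"
proof (rule R_if_lifts[OF Comp_Hom[OF f(1) g(1)]])
  fix S T l u v
  assume l: "l \<in> L" "l \<in> Hom C S T" and u: "u \<in> Hom C S X" and v: "v \<in> Hom C T Z"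
    and sq: "g \<cdot> f \<cdot> u = v \<cdot> l"
  have "g \<cdot> (f \<cdot> u) = v \<cdot> l" using sq f g u by (simp add: Hom_def)
  then obtain h where h: "h \<in> Hom C T Y" "h \<cdot> l = f \<cdot> u" "g \<cdot> h = v"
    using liftE[OF l(1) g(2) l(2) g(1) Comp_Hom[OF u f(1)] v] by metis
  obtain k where k: "k \<in> Hom C T X" "k \<cdot> l = u" "f \<cdot> k = h"
    using liftE[OF l(1) f(2) l(2) f(1) u h(1) h(2)[symmetric]] by metis
  have "g \<cdot> f \<cdot> k = v"
    using f g k h(3) by (simp add: Hom_def)
  then show "\<exists>h\<in>Hom C T X. h \<cdot> l = u \<and> g \<cdot> f \<cdot> h = v" using k by blast
qed

text \<open>The inclusion \<open>i\<close> is the cobase change of the zero map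
  \<open>Z \<rightarrow> Y\<close> along the zero map \<open>Z \<rightarrow> X\<close>. A lift is
  assembled summand by summand: \<open>u\<close> on \<open>X\<close>, and on \<open>Y\<close> a lift
  \<open>t\<close> of \<open>v \<cdot> j\<close>.\<close>

lemma biproduct_L:
  assumes P: "biproduct C X Y P i j p q" and Z: "Z \<in> Obj C" "Zero C Z Y \<in> L"
  shows "i \<in> L"
proof -
  have H: "i \<in> Hom C X P" "j \<in> Hom C Y P" "p \<in> Hom C P X" "q \<in> Hom C P Y" "Y \<in> Obj C" "X \<in> Obj C"
    and e: "p \<cdot> i = Ide C X" "q \<cdot> i = Zero C X Y" "i \<cdot> p \<oplus> j \<cdot> q = Ide C P"
    using P by (simp_all add: biproduct_def)
  show ?thesis
  proof (rule L_if_lifts[OF H(1)])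
    fix E B r u v
    assume r: "r \<in> R" "r \<in> Hom C E B" and u: "u \<in> Hom C X E" and v: "v \<in> Hom C P B"
      and sq: "r \<cdot> u = v \<cdot> i"
    have E: "E \<in> Obj C" using Hom_Obj[OF u] by simp
    have "r \<cdot> Zero C Z E = (v \<cdot> j) \<cdot> Zero C Z Y" using r v H Z by (auto simp: Hom_def)
    then obtain t where t: "t \<in> Hom C Y E" "r \<cdot> t = v \<cdot> j"
      using liftE[OF Z(2) r(1) Zero_Hom[OF Z(1) H(5)] r(2) Zero_Hom[OF Z(1) E] Comp_Hom[OF H(2) v]] by metis
    have "(u \<cdot> p \<oplus> t \<cdot> q) \<cdot> i = u"
      using u t H e E by (auto simp: Hom_def)
    moreover have "r \<cdot> (u \<cdot> p \<oplus> t \<cdot> q) = v"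
    proof -
      have "r \<cdot> (u \<cdot> p \<oplus> t \<cdot> q) = r \<cdot> (u \<cdot> p) \<oplus> r \<cdot> (t \<cdot> q)"
        using u t H r by (auto simp: Hom_def)
      also have "r \<cdot> (u \<cdot> p) = v \<cdot> (i \<cdot> p)"
        using Comp_reassoc[OF sq] u H r v by (auto simp: Hom_def)
      also have "r \<cdot> (t \<cdot> q) = v \<cdot> (j \<cdot> q)"
        using Comp_reassoc[OF t(2)] t(1) H r v by (auto simp: Hom_def)
      also have "v \<cdot> (i \<cdot> p) \<oplus> v \<cdot> (j \<cdot> q) = v \<cdot> (i \<cdot> p \<oplus> j \<cdot> q)"
        by (rule Comp_distrib_left[OF Comp_Hom[OF H(3,1)] Comp_Hom[OF H(4,2)] v, symmetric])
      finally show ?thesis using e(3) v by (simp add: Hom_def)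
    qed
    moreover have "u \<cdot> p \<oplus> t \<cdot> q \<in> Hom C P E"
      by (rule Add_Hom[OF Comp_Hom[OF H(3) u] Comp_Hom[OF H(4) t(1)]])
    ultimately show "\<exists>h\<in>Hom C P E. h \<cdot> i = u \<and> r \<cdot> h = v" by blast
  qed
qed

text \<open>Dually \<open>p\<close> is the base change of the zero map
  \<open>Y \<rightarrow> Z\<close>. The lift has component \<open>v\<close> in \<open>X\<close>, and
  its component in \<open>Y\<close> extends \<open>q \<cdot> u\<close> along
  \<open>l\<close>.\<close>

lemma biproduct_R:
  assumes P: "biproduct C X Y P i j p q" and Z: "Z \<in> Obj C" "Zero C Y Z \<in> R"
  shows "p \<in> R"
proof -
  have H: "i \<in> Hom C X P" "j \<in> Hom C Y P" "p \<in> Hom C P X" "q \<in> Hom C P Y" "Y \<in> Obj C" "X \<in> Obj C"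
    and e: "p \<cdot> i = Ide C X" "p \<cdot> j = Zero C Y X" "i \<cdot> p \<oplus> j \<cdot> q = Ide C P"
    using P by (simp_all add: biproduct_def)
  show ?thesis
  proof (rule R_if_lifts[OF H(3)])
    fix S T l u v
    assume l: "l \<in> L" "l \<in> Hom C S T" and u: "u \<in> Hom C S P" and v: "v \<in> Hom C T X"
      and sq: "p \<cdot> u = v \<cdot> l"
    have T: "T \<in> Obj C" using Hom_Obj[OF v] by simp
    have "Zero C Y Z \<cdot> (q \<cdot> u) = Zero C T Z \<cdot> l" using l u H Z by (auto simp: Hom_def)
    then obtain t where t: "t \<in> Hom C T Y" "t \<cdot> l = q \<cdot> u"
      using liftE[OF l(1) Z(2) l(2) Zero_Hom[OF H(5) Z(1)] Comp_Hom[OF u H(4)] Zero_Hom[OF T Z(1)]] by metis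
    have "p \<cdot> (i \<cdot> v \<oplus> j \<cdot> t) = v"
    proof -
      have "p \<cdot> (i \<cdot> v \<oplus> j \<cdot> t) = p \<cdot> (i \<cdot> v) \<oplus> p \<cdot> (j \<cdot> t)"
        using v t H by (auto simp: Hom_def)
      also have "p \<cdot> (i \<cdot> v) = v"
        using Comp_reassoc[OF e(1)] v H by (auto simp: Hom_def)
      also have "p \<cdot> (j \<cdot> t) = Zero C T X"
        using Comp_reassoc[OF e(2)] t(1) H by (auto simp: Hom_def)
      finally show ?thesis using v by (simp add: Hom_def)
    qed
    moreover have "(i \<cdot> v \<oplus> j \<cdot> t) \<cdot> l = u"
    proof -
      have "(i \<cdot> v \<oplus> j \<cdot> t) \<cdot> l = i \<cdot> (v \<cdot> l) \<oplus> j \<cdot> (t \<cdot> l)"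
        using v t(1) H l by (auto simp: Hom_def)
      also have "\<dots> = i \<cdot> (p \<cdot> u) \<oplus> j \<cdot> (q \<cdot> u)" using sq t(2) by simp
      also have "\<dots> = (i \<cdot> p \<oplus> j \<cdot> q) \<cdot> u"
        using u H Comp_distrib_right[OF u Comp_Hom[OF H(3,1)] Comp_Hom[OF H(4,2)]] by (simp add: Hom_def)
      finally show ?thesis using e(3) u by (simp add: Hom_def)
    qed
    moreover have "i \<cdot> v \<oplus> j \<cdot> t \<in> Hom C T P"
      by (rule Add_Hom[OF Comp_Hom[OF v H(1)] Comp_Hom[OF t(1) H(2)]])
    ultimately show "\<exists>h\<in>Hom C T P. h \<cdot> l = u \<and> p \<cdot> h = v" by blast
  qed
qed

end


section \<open>Model structures on additive categories\<close>

locale additive_model =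
  fixes A :: "('o, 'a, 'z) add_cat_scheme" (structure) and CoFib Fib Weq :: "'a set"
  assumes additive: "additive_category A" and model: "model_structure A CoFib Fib Weq"

sublocale additive_model \<subseteq> preadditive A
  using additive by (rule additive_category_preadditive)

sublocale additive_model \<subseteq> triv_cofib: weak_factorization_system A "CoFib \<inter> Weq" Fib
proof
  show "retract_closed A (CoFib \<inter> Weq)"
    using model unfolding model_structure_def retract_closed_def by blast
qed (use model in \<open>auto simp: model_structure_def\<close>)

sublocale additive_model \<subseteq> triv_fib: weak_factorization_system A CoFib "Fib \<inter> Weq"
proof
  show "retract_closed A (Fib \<inter> Weq)"
    using model unfolding model_structure_def retract_closed_def by blast
qed (use model in \<open>auto simp: model_structure_def\<close>)

context additive_model
begin

lemma Weq_Comp: "f \<in> Hom A X Y \<Longrightarrow> g \<in> Hom A Y Z \<Longrightarrow> f \<in> Weq \<Longrightarrow> g \<in> Weq \<Longrightarrow> g \<cdot> f \<in> Weq"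
  and Weq_cancel_right: "f \<in> Hom A X Y \<Longrightarrow> g \<in> Hom A Y Z \<Longrightarrow> f \<in> Weq \<Longrightarrow> g \<cdot> f \<in> Weq \<Longrightarrow> g \<in> Weq"
  and Weq_cancel_left: "f \<in> Hom A X Y \<Longrightarrow> g \<in> Hom A Y Z \<Longrightarrow> g \<in> Weq \<Longrightarrow> g \<cdot> f \<in> Weq \<Longrightarrow> f \<in> Weq"
  using model unfolding model_structure_def two_out_of_three_def Hom_def by auto

lemma Ide_Weq: "X \<in> Obj A \<Longrightarrow> Ide A X \<in> Weq"
  using triv_cofib.Ide_L by simp

text \<open>The classes of objects are defined with an unspecified zero object. Fixing one turns
  membership into a condition on a single zero map.\<close>

definition Z\<^sub>0 :: 'o where "Z\<^sub>0 = (SOME Z. zero_object A Z)"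

lemma zero_object_zero: "zero_object A Z\<^sub>0"
  unfolding Z\<^sub>0_def using additive by (metis additive_categoryE someI_ex)

lemma zero_Obj [simp]: "Z\<^sub>0 \<in> Obj A" and Ide_zero: "Ide A Z\<^sub>0 = Zero A Z\<^sub>0 Z\<^sub>0"
  using zero_object_zero by (simp_all add: zero_object_iff)

section \<open>Cofibrant, fibrant and trivial objects\<close>

abbreviation cof where "cof \<equiv> cofibrant_objects A CoFib"
abbreviation fib where "fib \<equiv> fibrant_objects A Fib"
abbreviation triv where "triv \<equiv> trivial_objects A Weq"

text \<open>The zero maps between \<open>Z\<close> and \<open>Z'\<close> are mutually inverse, so
  the map out of \<open>Z'\<close> is a retract of the one out of \<open>Z\<close>.\<close>

lemma from_zero_object:
  assumes M: "retract_closed A M" and Z: "zero_object A Z" "zero_object A Z'"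
    and X: "X \<in> Obj A" and "Zero A Z X \<in> M"
  shows "Zero A Z' X \<in> M"
proof -
  have Ob: "Z \<in> Obj A" "Z' \<in> Obj A" "Ide A Z = Zero A Z Z" "Ide A Z' = Zero A Z' Z'"
    using Z by (simp_all add: zero_object_iff)
  show ?thesis
    by (rule retract_closedD[OF M assms(5) Zero_Hom[OF Ob(2) X] Zero_Hom[OF Ob(1) X] Zero_Hom[OF Ob(2,1)]
          Zero_Hom[OF Ob(1,2)] Ide_Hom[OF X] Ide_Hom[OF X]]) (use Ob X in auto)
qed

lemma to_zero_object:
  assumes M: "retract_closed A M" and Z: "zero_object A Z" "zero_object A Z'"
    and X: "X \<in> Obj A" and "Zero A X Z \<in> M"
  shows "Zero A X Z' \<in> M"
proof -
  have Ob: "Z \<in> Obj A" "Z' \<in> Obj A" "Ide A Z = Zero A Z Z" "Ide A Z' = Zero A Z' Z'"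
    using Z by (simp_all add: zero_object_iff)
  show ?thesis
    by (rule retract_closedD[OF M assms(5) Zero_Hom[OF X Ob(2)] Zero_Hom[OF X Ob(1)]
          Ide_Hom[OF X] Ide_Hom[OF X] Zero_Hom[OF Ob(2,1)] Zero_Hom[OF Ob(1,2)]]) (use Ob X in auto)
qed

lemma retract_closed:
  "retract_closed A CoFib" "retract_closed A Fib" "retract_closed A Weq"
  using model by (auto simp: model_structure_def)

lemma cof_iff: "X \<in> cof \<longleftrightarrow> X \<in> Obj A \<and> Zero A Z\<^sub>0 X \<in> CoFib"
proof
  assume "X \<in> cof"
  then obtain Z f where "X \<in> Obj A" "zero_object A Z" "f \<in> Hom A Z X" "f \<in> CoFib"
    unfolding cofibrant_objects_def by blast
  then show "X \<in> Obj A \<and> Zero A Z\<^sub>0 X \<in> CoFib"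
    using from_zero_object[OF retract_closed(1) _ zero_object_zero] zero_object_Zero(1) by metis
next
  assume "X \<in> Obj A \<and> Zero A Z\<^sub>0 X \<in> CoFib"
  then show "X \<in> cof" unfolding cofibrant_objects_def using zero_object_zero Zero_Hom zero_Obj by blast
qed

lemma fib_iff: "X \<in> fib \<longleftrightarrow> X \<in> Obj A \<and> Zero A X Z\<^sub>0 \<in> Fib"
proof
  assume "X \<in> fib"
  then obtain Z f where "X \<in> Obj A" "zero_object A Z" "f \<in> Hom A X Z" "f \<in> Fib"
    unfolding fibrant_objects_def by blast
  then show "X \<in> Obj A \<and> Zero A X Z\<^sub>0 \<in> Fib"
    using to_zero_object[OF retract_closed(2) _ zero_object_zero] zero_object_Zero(2) by metis
next
  assume "X \<in> Obj A \<and> Zero A X Z\<^sub>0 \<in> Fib"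
  then show "X \<in> fib" unfolding fibrant_objects_def using zero_object_zero Zero_Hom zero_Obj by blast
qed

lemma triv_iff: "X \<in> triv \<longleftrightarrow> X \<in> Obj A \<and> Zero A Z\<^sub>0 X \<in> Weq"
proof
  assume "X \<in> triv"
  then obtain Z f where "X \<in> Obj A" "zero_object A Z" "f \<in> Hom A Z X" "f \<in> Weq"
    unfolding trivial_objects_def by blast
  then show "X \<in> Obj A \<and> Zero A Z\<^sub>0 X \<in> Weq"
    using from_zero_object[OF retract_closed(3) _ zero_object_zero] zero_object_Zero(1) by metis
next
  assume "X \<in> Obj A \<and> Zero A Z\<^sub>0 X \<in> Weq"
  then show "X \<in> triv" unfolding trivial_objects_def using zero_object_zero Zero_Hom zero_Obj by blast
qed

text \<open>The composite through \<open>X\<close> is the identity of the zero object, so two out of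
  three links the maps into and out of \<open>X\<close>.\<close>

lemma triv_iff': "X \<in> triv \<longleftrightarrow> X \<in> Obj A \<and> Zero A X Z\<^sub>0 \<in> Weq"
proof -
  have "Zero A Z\<^sub>0 X \<in> Weq \<longleftrightarrow> Zero A X Z\<^sub>0 \<in> Weq" if X: "X \<in> Obj A"
  proof -
    have "Zero A X Z\<^sub>0 \<cdot> Zero A Z\<^sub>0 X \<in> Weq" using Ide_Weq[OF zero_Obj] X by (simp add: Ide_zero)
    then show ?thesis
      using Weq_cancel_left Weq_cancel_right Zero_Hom[OF zero_Obj X] Zero_Hom[OF X zero_Obj] by metis
  qed
  then show ?thesis by (auto simp: triv_iff)
qed

abbreviation cf where "cf \<equiv> cof \<inter> fib"
abbreviation cfw where "cfw \<equiv> cof \<inter> fib \<inter> triv"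

lemma cof_Comp:
  assumes "X \<in> cof" "i \<in> Hom A X Y" "i \<in> CoFib"
  shows "Y \<in> cof"
proof -
  have X: "X \<in> Obj A" "Zero A Z\<^sub>0 X \<in> CoFib" using assms by (simp_all add: cof_iff)
  have "i \<cdot> Zero A Z\<^sub>0 X \<in> CoFib"
    by (rule triv_fib.Comp_L[OF Zero_Hom[OF zero_Obj X(1)] X(2) assms(2,3)])
  then show ?thesis using assms(2) Hom_Obj[OF assms(2)] by (simp add: cof_iff Hom_def)
qed

lemma fib_Comp:
  assumes "Y \<in> fib" "p \<in> Hom A X Y" "p \<in> Fib"
  shows "X \<in> fib"
proof -
  have Y: "Y \<in> Obj A" "Zero A Y Z\<^sub>0 \<in> Fib" using assms by (simp_all add: fib_iff)
  have "Zero A Y Z\<^sub>0 \<cdot> p \<in> Fib"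
    by (rule triv_cofib.Comp_R[OF assms(2,3) Zero_Hom[OF Y(1) zero_Obj] Y(2)])
  then show ?thesis using assms(2) Hom_Obj[OF assms(2)] by (simp add: fib_iff Hom_def)
qed

lemma triv_Comp:
  assumes "X \<in> triv" "i \<in> Hom A X Y" "i \<in> Weq"
  shows "Y \<in> triv"
proof -
  have X: "X \<in> Obj A" "Zero A Z\<^sub>0 X \<in> Weq" using assms by (simp_all add: triv_iff)
  have "i \<cdot> Zero A Z\<^sub>0 X \<in> Weq"
    by (rule Weq_Comp[OF Zero_Hom[OF zero_Obj X(1)] assms(2) X(2) assms(3)])
  then show ?thesis using assms(2) Hom_Obj[OF assms(2)] by (simp add: triv_iff Hom_def)
qed

lemma cf_Obj: "X \<in> cf \<Longrightarrow> X \<in> Obj A"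
  by (simp add: cof_iff)

lemma biproduct_CoFib:
  assumes "biproduct A X Y P i j p q" "Y \<in> cof"
  shows "i \<in> CoFib"
  using triv_fib.biproduct_L[OF assms(1) zero_Obj] assms(2) by (simp add: cof_iff)

lemma biproduct_Fib:
  assumes "biproduct A X Y P i j p q" "Y \<in> fib"
  shows "p \<in> Fib"
  using triv_cofib.biproduct_R[OF assms(1) zero_Obj] assms(2) by (simp add: fib_iff)

text \<open>Cofibrancy of \<open>Y\<close> makes \<open>0 \<rightarrow> Y\<close> a trivial
  cofibration. Those are stable under cobase change, whereas weak equivalences in general are
  not.\<close>

lemma biproduct_Weq:
  assumes "biproduct A X Y P i j p q" "Y \<in> cof" "Y \<in> triv"
  shows "i \<in> Weq"
  using triv_cofib.biproduct_L[OF assms(1) zero_Obj] assms(2,3) by (simp add: cof_iff triv_iff)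

lemma zero_object_cfw:
  assumes "zero_object A Z"
  shows "Z \<in> cfw"
proof -
  have Z: "Z \<in> Obj A" using assms by (simp add: zero_object_iff)
  show ?thesis
    unfolding cofibrant_objects_def fibrant_objects_def trivial_objects_def
    using assms Z Ide_Hom[OF Z] triv_fib.Ide_L[OF Z] triv_cofib.Ide_R[OF Z] Ide_Weq[OF Z] by blast
qed

text \<open>\<open>P\<close> is the target of the cofibration \<open>i\<close> out of
  \<open>X\<close> and the source of the fibration \<open>p\<close> to \<open>X\<close>.\<close>

lemma biproduct_cf:
  assumes P: "biproduct A X Y P i j p q" and X: "X \<in> cf" and Y: "Y \<in> cf"
  shows "P \<in> cf"
proof -
  have "i \<in> Hom A X P" "p \<in> Hom A P X" using P by (simp_all add: biproduct_def)
  then show ?thesis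
    using cof_Comp biproduct_CoFib[OF P] fib_Comp biproduct_Fib[OF P] X Y by blast
qed

lemma full_additive_cf: "full_additive_subcategory A cf"
  unfolding full_additive_subcategory_def
proof (intro conjI allI ballI impI)
  show "cf \<subseteq> Obj A" using cf_Obj by blast
  show "Z \<in> cf" if "zero_object A Z" for Z using zero_object_cfw[OF that] by blast
  show "P \<in> cf" if "X \<in> cf" "Y \<in> cf" "biproduct A X Y P i j p q" for X Y P i j p q
    using biproduct_cf that by blast
qed

abbreviation CF where "CF \<equiv> full_subcat A cf"

lemma full_additive_cfw: "full_additive_subcategory CF cfw"
  unfolding full_additive_subcategory_def biproduct_full_subcat zero_object_full_subcat[OF preadditive]
proof (intro conjI allI ballI impI)
  show "cfw \<subseteq> Obj CF" using cf_Obj by auto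
  show "Z \<in> cfw" if "zero_object A Z \<and> Z \<in> cf" for Z using zero_object_cfw that by blast
  show "P \<in> cfw" if X: "X \<in> cfw" and Y: "Y \<in> cfw"
    and P: "biproduct A X Y P i j p q \<and> X \<in> cf \<and> Y \<in> cf \<and> P \<in> cf" for X Y P i j p q
  proof -
    have "i \<in> Hom A X P" using P by (simp add: biproduct_def)
    moreover have "i \<in> Weq" using biproduct_Weq P Y by blast
    ultimately show ?thesis using triv_Comp P X by blast
  qed
qed

sublocale CF: additive_ideal CF cfw
proof
  show "additive_category CF" by (rule additive_category_full_subcat[OF additive full_additive_cf])
  then show "preadditive_category CF" by (simp add: additive_category_def)
qed (rule full_additive_cfw)

lemma Hom_CF: "X \<in> cf \<Longrightarrow> Y \<in> cf \<Longrightarrow> f \<in> Hom CF X Y \<longleftrightarrow> f \<in> Hom A X Y"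
  by (simp add: Hom_full_subcat)

text \<open>The instance for \<open>CF\<close> brings its own \<open>neg\<close>, an inverse taken
  in another hom group. Uniqueness of negatives identifies the two.\<close>

lemma neg_CF:
  assumes "f \<in> Hom A X Y" "X \<in> cf" "Y \<in> cf"
  shows "CF.neg f = neg f"
  using CF.neg_unique[of f X Y "neg f"] assms by (simp add: Hom_CF neg_Hom Add_neg)

text \<open>Factor \<open>X \<rightarrow> 0\<close> as a cofibration followed by a trivial
  fibration. The first factor makes \<open>K\<close> cofibrant, the second makes it fibrant and
  trivial.\<close>

lemma coneE:
  assumes "X \<in> cof"
  obtains K i where "K \<in> cfw" "i \<in> Hom A X K" "i \<in> CoFib"
proof -
  have X: "X \<in> Obj A" using assms by (simp add: cof_iff)
  obtain K i p where ip: "i \<in> Hom A X K" "p \<in> Hom A K Z\<^sub>0" "i \<in> CoFib" "p \<in> Fib \<inter> Weq"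
    using Zero_Hom[OF X zero_Obj] by (rule triv_fib.factorE)
  have "p = Zero A K Z\<^sub>0" by (rule zero_object_Zero(2)[OF zero_object_zero ip(2)])
  then have "K \<in> fib" "K \<in> triv" using ip(4) Hom_Obj[OF ip(1)] by (simp_all add: fib_iff triv_iff')
  then show thesis using that[of K i] cof_Comp[OF assms ip(1,3)] ip by blast
qed

text \<open>Dual of the cone: factor \<open>0 \<rightarrow> Y\<close> as a trivial cofibration
  followed by a fibration, whose source is fibrant because \<open>Y\<close> is.\<close>

lemma coconeE:
  assumes "Y \<in> fib"
  obtains K p where "K \<in> cfw" "p \<in> Hom A K Y" "p \<in> Fib"
proof -
  have Y: "Y \<in> Obj A" using assms by (simp add: fib_iff)
  obtain K i p where ip: "i \<in> Hom A Z\<^sub>0 K" "p \<in> Hom A K Y" "i \<in> CoFib \<inter> Weq" "p \<in> Fib"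
    using Zero_Hom[OF zero_Obj Y] by (rule triv_cofib.factorE)
  have "i = Zero A Z\<^sub>0 K" by (rule zero_object_Zero(1)[OF zero_object_zero ip(1)])
  then have "K \<in> cof" "K \<in> triv" using ip(3) Hom_Obj[OF ip(1)] by (simp_all add: cof_iff triv_iff)
  then show thesis using that[of K p] fib_Comp[OF assms ip(2,4)] ip by blast
qed

text \<open>Lifting the square \<open>q \<cdot> h = 0 \<cdot> i\<close> extends \<open>h\<close> along the cofibration \<open>i\<close> of \<open>X\<close> into its cone.\<close>

lemma factors_through_cone:
  assumes q: "q \<in> Hom A E Y" "q \<in> Fib" "q \<in> Weq" and h: "h \<in> Hom A X E" "q \<cdot> h = Zero A X Y"
    and X: "X \<in> cof"
  obtains K a b where "K \<in> cfw" "a \<in> Hom A X K" "b \<in> Hom A K E" "h = b \<cdot> a"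
proof -
  obtain K i where K: "K \<in> cfw" "i \<in> Hom A X K" "i \<in> CoFib" using X by (rule coneE)
  have KY: "K \<in> Obj A" "Y \<in> Obj A" using Hom_Obj[OF K(2)] Hom_Obj[OF q(1)] by simp_all
  have "q \<cdot> h = Zero A K Y \<cdot> i" using h K(2) KY by (simp add: Hom_def)
  then obtain b where "b \<in> Hom A K E" "b \<cdot> i = h"
    using triv_fib.liftE[OF K(3) _ K(2) q(1) h(1) Zero_Hom[OF KY]] q by (metis IntI)
  then show thesis using that K by blast
qed

text \<open>Dual argument: \<open>0\<close> and \<open>k\<close> form a square between the trivial
  cofibration \<open>j\<close> and the fibration \<open>p\<close> of the cocone, and its lift is a
  factorization of \<open>k\<close> over \<open>p\<close>.\<close>

lemma factors_through_cocone:
  assumes j: "j \<in> Hom A X E" "j \<in> CoFib" "j \<in> Weq" and k: "k \<in> Hom A E Y" "k \<cdot> j = Zero A X Y"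
    and Y: "Y \<in> fib"
  obtains K a b where "K \<in> cfw" "a \<in> Hom A E K" "b \<in> Hom A K Y" "k = b \<cdot> a"
proof -
  obtain K p where K: "K \<in> cfw" "p \<in> Hom A K Y" "p \<in> Fib" using Y by (rule coconeE)
  have KX: "X \<in> Obj A" "K \<in> Obj A" using Hom_Obj[OF K(2)] Hom_Obj[OF j(1)] by simp_all
  have "p \<cdot> Zero A X K = k \<cdot> j" using k K(2) KX by (simp add: Hom_def)
  then obtain a where "a \<in> Hom A E K" "p \<cdot> a = k"
    using triv_cofib.liftE[OF _ K(3) j(1) K(2) Zero_Hom[OF KX] k(1)] j by (metis IntI)
  then show thesis using that K by blast
qed

section \<open>Weak equivalences become isomorphisms in the quotient\<close>

abbreviation B where "B \<equiv> additive_quotient CF cfw"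

lemma cls_eqI:
  assumes "f \<in> Hom A X Y" "g \<in> Hom A X Y" "X \<in> cf" "Y \<in> cf"
    and "K \<in> cfw" "a \<in> Hom A X K" "b \<in> Hom A K Y" "f \<oplus> neg g = b \<cdot> a"
  shows "CF.Quo.cls f = CF.Quo.cls g"
proof (rule CF.Quo.cls_eqI, rule CF.ideal_rel_neg[where X = X and Y = Y])
  show "CF.null (f \<oplus>\<^bsub>CF\<^esub> CF.neg g)"
    using CF.nullI[of a X K b Y] assms by (simp add: Hom_CF neg_CF[OF assms(2-4)])
qed (use assms in \<open>simp_all add: Hom_CF\<close>)

lemma B_Hom: "f \<in> Hom A X Y \<Longrightarrow> X \<in> cf \<Longrightarrow> Y \<in> cf \<Longrightarrow> CF.Quo.cls f \<in> Hom B X Y"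
  by (rule CF.cls_Hom_AQuo) (simp add: Hom_CF)

lemma B_Comp:
  "f \<in> Hom A X Y \<Longrightarrow> g \<in> Hom A Y Z \<Longrightarrow> X \<in> cf \<Longrightarrow> Y \<in> cf \<Longrightarrow> Z \<in> cf \<Longrightarrow>
    CF.Quo.cls g \<cdot>\<^bsub>B\<^esub> CF.Quo.cls f = CF.Quo.cls (g \<cdot> f)"
  using CF.Comp_AQuo[of f X Y g Z] by (simp add: Hom_CF)

lemma B_HomE:
  assumes "c \<in> Hom B X Y"
  obtains f where "f \<in> Hom A X Y" "X \<in> cf" "Y \<in> cf" "c = CF.Quo.cls f"
  using assms by (rule CF.Hom_AQuoE) (use that in \<open>auto simp: Hom_full_subcat\<close>)

sublocale B: preadditive B
  by unfold_locales (rule CF.preadditive_category_AQuo)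

text \<open>For a section \<open>s\<close> of \<open>p\<close>, the map \<open>1 - s \<cdot> p\<close> is killed by \<open>p\<close>, hence factors through a cone.\<close>

lemma is_iso_triv_fib:
  assumes p: "p \<in> Hom A E Y" "p \<in> Fib" "p \<in> Weq" and E: "E \<in> cf" and Y: "Y \<in> cf"
  shows "is_iso B (CF.Quo.cls p)"
proof -
  have Ob: "E \<in> Obj A" "Y \<in> Obj A" using E Y cf_Obj by auto
  \<comment> \<open>As \<open>Y\<close> is cofibrant, its identity lifts through the trivial
    fibration \<open>p\<close>, which gives the section \<open>s\<close>.\<close>
  have "p \<cdot> Zero A Z\<^sub>0 E = Ide A Y \<cdot> Zero A Z\<^sub>0 Y" using p Ob by (simp add: Hom_def)
  then obtain s where s: "s \<in> Hom A Y E" "p \<cdot> s = Ide A Y"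
    using triv_fib.liftE[OF _ _ Zero_Hom[OF zero_Obj Ob(2)] p(1) Zero_Hom[OF zero_Obj Ob(1)] Ide_Hom[OF Ob(2)]]
      Y p by (auto simp: cof_iff)
  have sp: "s \<cdot> p \<in> Hom A E E" by (rule Comp_Hom[OF p(1) s(1)])
  have "p \<cdot> (s \<cdot> p) = p" using Comp_reassoc[OF s(2)] s(1) p by (simp add: Hom_def)
  then have "p \<cdot> (Ide A E \<oplus> neg (s \<cdot> p)) = Zero A E Y"
    using Comp_distrib_left[OF Ide_Hom[OF Ob(1)] neg_Hom[OF sp] p(1)] Comp_neg[OF sp p(1)]
      Add_neg[OF p(1)] p(1) by (simp add: Hom_def)
  then obtain K a b where "K \<in> cfw" "a \<in> Hom A E K" "b \<in> Hom A K E" "Ide A E \<oplus> neg (s \<cdot> p) = b \<cdot> a"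
    using factors_through_cone[OF p Add_Hom[OF Ide_Hom[OF Ob(1)] neg_Hom[OF sp]]] E by blast
  then have "CF.Quo.cls (Ide A E) = CF.Quo.cls (s \<cdot> p)"
    by (rule cls_eqI[OF Ide_Hom[OF Ob(1)] sp E E])
  then show ?thesis
    using B.is_isoI[OF B_Hom[OF p(1) E Y] B_Hom[OF s(1) Y E]] B_Comp[OF p(1) s(1) E Y E]
      B_Comp[OF s(1) p(1) Y E Y] s(2) by (simp add: CF.AQuo_simps)
qed

text \<open>Fibrancy of \<open>X\<close> gives a retraction \<open>r\<close> of \<open>i\<close>.
  The difference of the identity and \<open>i \<cdot> r\<close> vanishes after composing with
  \<open>i\<close>, hence factors through a cocone of \<open>E\<close>.\<close>

lemma is_iso_triv_cofib:
  assumes i: "i \<in> Hom A X E" "i \<in> CoFib" "i \<in> Weq" and X: "X \<in> cf" and E: "E \<in> cf"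
  shows "is_iso B (CF.Quo.cls i)"
proof -
  have Ob: "X \<in> Obj A" "E \<in> Obj A" using E X cf_Obj by auto
  have "Zero A X Z\<^sub>0 \<cdot> Ide A X = Zero A E Z\<^sub>0 \<cdot> i" using i Ob by (simp add: Hom_def)
  then obtain r where r: "r \<in> Hom A E X" "r \<cdot> i = Ide A X"
    using triv_cofib.liftE[OF _ _ i(1) Zero_Hom[OF Ob(1) zero_Obj] Ide_Hom[OF Ob(1)] Zero_Hom[OF Ob(2) zero_Obj]]
      X i by (auto simp: fib_iff)
  have ir: "i \<cdot> r \<in> Hom A E E" by (rule Comp_Hom[OF r(1) i(1)])
  have "(i \<cdot> r) \<cdot> i = i" using r i by (simp add: Hom_def)
  then have "(Ide A E \<oplus> neg (i \<cdot> r)) \<cdot> i = Zero A X E"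
    using Comp_distrib_right[OF i(1) Ide_Hom[OF Ob(2)] neg_Hom[OF ir]] neg_Comp[OF i(1) ir]
      Add_neg[OF i(1)] i(1) by (simp add: Hom_def)
  then obtain K a b where "K \<in> cfw" "a \<in> Hom A E K" "b \<in> Hom A K E" "Ide A E \<oplus> neg (i \<cdot> r) = b \<cdot> a"
    using factors_through_cocone[OF i Add_Hom[OF Ide_Hom[OF Ob(2)] neg_Hom[OF ir]]] E by blast
  then have "CF.Quo.cls (Ide A E) = CF.Quo.cls (i \<cdot> r)"
    by (rule cls_eqI[OF Ide_Hom[OF Ob(2)] ir E E])
  then show ?thesis
    using B.is_isoI[OF B_Hom[OF i(1) X E] B_Hom[OF r(1) E X]] B_Comp[OF i(1) r(1) X E X]
      B_Comp[OF r(1) i(1) E X E] r(2) by (simp add: CF.AQuo_simps)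
qed

text \<open>Factor \<open>w\<close> as a trivial cofibration and a fibration, itself a weak
  equivalence by two out of three. The middle object is cofibrant because \<open>X\<close> is and
  fibrant because \<open>Y\<close> is, so the two special cases apply.\<close>

lemma is_iso_Weq:
  assumes w: "w \<in> Hom A X Y" "w \<in> Weq" and X: "X \<in> cf" and Y: "Y \<in> cf"
  shows "is_iso B (CF.Quo.cls w)"
proof -
  obtain E i p where ip: "i \<in> Hom A X E" "p \<in> Hom A E Y" "i \<in> CoFib \<inter> Weq" "p \<in> Fib" "w = p \<cdot> i"
    using w(1) by (rule triv_cofib.factorE)
  have "p \<in> Weq" using Weq_cancel_right[OF ip(1,2)] ip w(2) by simp
  moreover have E: "E \<in> cf" using cof_Comp[OF _ ip(1)] fib_Comp[OF _ ip(2,4)] ip X Y by blast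
  ultimately show ?thesis
    using B.is_iso_Comp[OF is_iso_triv_cofib[OF ip(1) _ _ X E] is_iso_triv_fib[OF ip(2,4) _ E Y]
        B_Hom[OF ip(1) X E] B_Hom[OF ip(2) E Y]] B_Comp[OF ip(1,2) X E Y] ip by simp
qed

end

section \<open>Cofibrant-fibrant replacement\<close>

text \<open>Only objects and comparison maps are chosen. \<open>Q\<close> and \<open>R\<close> are
  not assumed to act on arrows, and \<open>R X\<close> is attached to \<open>Q X\<close> rather than
  to \<open>X\<close>, which keeps it cofibrant.\<close>

locale replacement = additive_model +
  fixes Q R :: "'a \<Rightarrow> 'a" and q j :: "'a \<Rightarrow> 'b"
  assumes Q: "X \<in> Obj A \<Longrightarrow> Q X \<in> cof" and R: "X \<in> Obj A \<Longrightarrow> R X \<in> cf"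
    and q: "X \<in> Obj A \<Longrightarrow> q X \<in> Hom A (Q X) X \<and> q X \<in> Fib \<and> q X \<in> Weq"
    and j: "X \<in> Obj A \<Longrightarrow> j X \<in> Hom A (Q X) (R X) \<and> j X \<in> CoFib \<and> j X \<in> Weq"
begin

lemma q_Hom: "X \<in> Obj A \<Longrightarrow> q X \<in> Hom A (Q X) X" and j_Hom: "X \<in> Obj A \<Longrightarrow> j X \<in> Hom A (Q X) (R X)"
  using q j by blast+

lemma Q_Obj: "X \<in> Obj A \<Longrightarrow> Q X \<in> Obj A" and R_Obj: "X \<in> Obj A \<Longrightarrow> R X \<in> Obj A"
  using Q R by (auto simp: cof_iff)

text \<open>A relation instead of a choice of lifts: it is closed under composition, sums and
  negation, while chosen lifts would respect none of these. The middle map \<open>h\<close> is kept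
  because both squares are needed later.\<close>

definition replaces :: "'a \<Rightarrow> 'a \<Rightarrow> 'b \<Rightarrow> 'b \<Rightarrow> 'b \<Rightarrow> bool" where
  "replaces X Y f h g \<longleftrightarrow> f \<in> Hom A X Y \<and> h \<in> Hom A (Q X) (Q Y) \<and> g \<in> Hom A (R X) (R Y) \<and>
     q Y \<cdot> h = f \<cdot> q X \<and> g \<cdot> j X = j Y \<cdot> h"

text \<open>The lift \<open>h\<close> exists because \<open>Q X\<close> is cofibrant and
  \<open>q Y\<close> a trivial fibration; the extension \<open>g\<close> exists because
  \<open>R Y\<close> is fibrant and \<open>j X\<close> a trivial cofibration.\<close>

lemma replacesE:
  assumes f: "f \<in> Hom A X Y"
  obtains h g where "replaces X Y f h g"
proof -
  have XY: "X \<in> Obj A" "Y \<in> Obj A" using Hom_Obj[OF f] by simp_all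
  have QX: "Zero A Z\<^sub>0 (Q X) \<in> CoFib" and RY: "Zero A (R Y) Z\<^sub>0 \<in> Fib"
    using Q R XY by (auto simp: cof_iff fib_iff)
  note O = Q_Obj[OF XY(1)] Q_Obj[OF XY(2)] R_Obj[OF XY(1)] R_Obj[OF XY(2)]
  have fq: "f \<cdot> q X \<in> Hom A (Q X) Y" by (rule Comp_Hom[OF q_Hom[OF XY(1)] f])
  have "q Y \<cdot> Zero A Z\<^sub>0 (Q Y) = (f \<cdot> q X) \<cdot> Zero A Z\<^sub>0 (Q X)"
    using fq q_Hom[OF XY(2)] O by (simp add: Hom_def)
  then obtain h where h: "h \<in> Hom A (Q X) (Q Y)" "q Y \<cdot> h = f \<cdot> q X"
    using triv_fib.liftE[OF QX _ Zero_Hom[OF zero_Obj O(1)] q_Hom[OF XY(2)] Zero_Hom[OF zero_Obj O(2)] fq]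
      q[OF XY(2)] by (metis IntI)
  have jh: "j Y \<cdot> h \<in> Hom A (Q X) (R Y)" by (rule Comp_Hom[OF h(1) j_Hom[OF XY(2)]])
  have "Zero A (R Y) Z\<^sub>0 \<cdot> (j Y \<cdot> h) = Zero A (R X) Z\<^sub>0 \<cdot> j X"
    using jh j_Hom[OF XY(1)] O by (simp add: Hom_def)
  then obtain g where "g \<in> Hom A (R X) (R Y)" "g \<cdot> j X = j Y \<cdot> h"
    using triv_cofib.liftE[OF _ RY j_Hom[OF XY(1)] Zero_Hom[OF O(4) zero_Obj] jh Zero_Hom[OF O(3) zero_Obj]]
      j[OF XY(1)] by (metis IntI)
  then show thesis using that f h unfolding replaces_def by blast
qed

lemma replaces_Ide: "X \<in> Obj A \<Longrightarrow> replaces X X (Ide A X) (Ide A (Q X)) (Ide A (R X))"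
  using q_Hom j_Hom Q_Obj R_Obj by (simp add: replaces_def Hom_def)

lemma replaces_Comp:
  assumes "replaces X Y f h g" "replaces Y Z f' h' g'"
  shows "replaces X Z (f' \<cdot> f) (h' \<cdot> h) (g' \<cdot> g)"
proof -
  have H: "f \<in> Hom A X Y" "h \<in> Hom A (Q X) (Q Y)" "g \<in> Hom A (R X) (R Y)"
    "f' \<in> Hom A Y Z" "h' \<in> Hom A (Q Y) (Q Z)" "g' \<in> Hom A (R Y) (R Z)"
    and e: "q Y \<cdot> h = f \<cdot> q X" "g \<cdot> j X = j Y \<cdot> h" "q Z \<cdot> h' = f' \<cdot> q Y" "g' \<cdot> j Y = j Z \<cdot> h'"
    using assms by (simp_all add: replaces_def)
  have "X \<in> Obj A" "Y \<in> Obj A" "Z \<in> Obj A" using Hom_Obj H by blast+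
  note H' = H this[THEN q_Hom] this[THEN j_Hom]
  have "q Z \<cdot> (h' \<cdot> h) = f' \<cdot> f \<cdot> q X"
    using H' Comp_reassoc[OF e(3)] e(1) by (simp add: Hom_def)
  moreover have "g' \<cdot> g \<cdot> j X = j Z \<cdot> (h' \<cdot> h)"
    using H' Comp_reassoc[OF e(4)] e(2) by (simp add: Hom_def)
  ultimately show ?thesis using H by (simp add: replaces_def Comp_Hom)
qed

lemma replaces_Add:
  assumes "replaces X Y f h g" "replaces X Y f' h' g'"
  shows "replaces X Y (f \<oplus> f') (h \<oplus> h') (g \<oplus> g')"
proof -
  have H: "f \<in> Hom A X Y" "h \<in> Hom A (Q X) (Q Y)" "g \<in> Hom A (R X) (R Y)"
    "f' \<in> Hom A X Y" "h' \<in> Hom A (Q X) (Q Y)" "g' \<in> Hom A (R X) (R Y)"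
    and e: "q Y \<cdot> h = f \<cdot> q X" "g \<cdot> j X = j Y \<cdot> h" "q Y \<cdot> h' = f' \<cdot> q X" "g' \<cdot> j X = j Y \<cdot> h'"
    using assms by (simp_all add: replaces_def)
  have XY: "X \<in> Obj A" "Y \<in> Obj A" using Hom_Obj[OF H(1)] by simp_all
  show ?thesis
    using H e Comp_distrib_left[OF H(2,5) q_Hom[OF XY(2)]] Comp_distrib_right[OF q_Hom[OF XY(1)] H(1,4)]
      Comp_distrib_left[OF H(2,5) j_Hom[OF XY(2)]] Comp_distrib_right[OF j_Hom[OF XY(1)] H(3,6)]
    by (simp add: replaces_def Add_Hom)
qed

lemma replaces_neg:
  assumes "replaces X Y f h g"
  shows "replaces X Y (neg f) (neg h) (neg g)"
proof -
  have H: "f \<in> Hom A X Y" "h \<in> Hom A (Q X) (Q Y)" "g \<in> Hom A (R X) (R Y)"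
    and e: "q Y \<cdot> h = f \<cdot> q X" "g \<cdot> j X = j Y \<cdot> h"
    using assms by (simp_all add: replaces_def)
  have XY: "X \<in> Obj A" "Y \<in> Obj A" using Hom_Obj[OF H(1)] by simp_all
  show ?thesis
    using H e Comp_neg[OF H(2) q_Hom[OF XY(2)]] neg_Comp[OF q_Hom[OF XY(1)] H(1)]
      Comp_neg[OF H(2) j_Hom[OF XY(2)]] neg_Comp[OF j_Hom[OF XY(1)] H(3)]
    by (simp add: replaces_def neg_Hom)
qed

text \<open>A replacement of zero differs by a map through the cone of \<open>Q X\<close> from one vanishing on \<open>Q X\<close>.\<close>

lemma replaces_Zero:
  assumes "replaces X Y (Zero A X Y) h g"
  shows "CF.null g"
proof -
  have H: "Zero A X Y \<in> Hom A X Y" "h \<in> Hom A (Q X) (Q Y)" "g \<in> Hom A (R X) (R Y)"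
    and e: "q Y \<cdot> h = Zero A X Y \<cdot> q X" "g \<cdot> j X = j Y \<cdot> h"
    using assms by (simp_all add: replaces_def)
  have XY: "X \<in> Obj A" "Y \<in> Obj A" using Hom_Obj[OF H(1)] by simp_all
  have RXY: "R X \<in> cf" "R Y \<in> cf" using R XY by blast+
  have jX: "j X \<in> Hom A (Q X) (R X)" "j X \<in> CoFib" "j X \<in> Weq" using j[OF XY(1)] by simp_all
  have qY: "q Y \<in> Hom A (Q Y) Y" "q Y \<in> Fib" "q Y \<in> Weq" using q[OF XY(2)] by simp_all
  have "q Y \<cdot> h = Zero A (Q X) Y" using e(1) q_Hom[OF XY(1)] XY by (simp add: Hom_def)
  then obtain K a b where K: "K \<in> cfw" "a \<in> Hom A (Q X) K" "b \<in> Hom A K (Q Y)" "h = b \<cdot> a"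
    using factors_through_cone[OF qY H(2) _ Q[OF XY(1)]] by blast
  have KO: "K \<in> Obj A" "K \<in> cf" "Zero A K Z\<^sub>0 \<in> Fib" using K(1) by (auto simp: cof_iff fib_iff)
  \<comment> \<open>The cone \<open>K\<close> is fibrant, so \<open>a\<close> extends over the
    trivial cofibration \<open>j X\<close>. The resulting \<open>m\<close> factors through
    \<open>K\<close> and agrees with \<open>g\<close> on \<open>Q X\<close>.\<close>
  have "Zero A K Z\<^sub>0 \<cdot> a = Zero A (R X) Z\<^sub>0 \<cdot> j X"
    using K(2) jX(1) R_Obj[OF XY(1)] KO by (simp add: Hom_def)
  then obtain a' where a': "a' \<in> Hom A (R X) K" "a' \<cdot> j X = a"
    using triv_cofib.liftE[OF _ KO(3) jX(1) Zero_Hom[OF KO(1) zero_Obj] K(2)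
        Zero_Hom[OF R_Obj[OF XY(1)] zero_Obj]] jX by (metis IntI)
  define m where "m = (j Y \<cdot> b) \<cdot> a'"
  have jb: "j Y \<cdot> b \<in> Hom A K (R Y)" by (rule Comp_Hom[OF K(3) j_Hom[OF XY(2)]])
  have m: "m \<in> Hom A (R X) (R Y)" unfolding m_def by (rule Comp_Hom[OF a'(1) jb])
  have mj: "m \<cdot> j X = g \<cdot> j X"
    using a' jb K(3,4) jX(1) j_Hom[OF XY(2)] e(2) by (simp add: m_def Hom_def)
  \<comment> \<open>What is left of \<open>g\<close> vanishes on \<open>Q X\<close> and therefore
    factors through a cocone of the fibrant object \<open>R Y\<close>.\<close>
  have "(g \<oplus> neg m) \<cdot> j X = Zero A (Q X) (R Y)"
    unfolding Comp_distrib_right[OF jX(1) H(3) neg_Hom[OF m]] neg_Comp[OF jX(1) m] mj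
    by (rule Add_neg[OF Comp_Hom[OF jX(1) H(3)]])
  then obtain K' c d where K': "K' \<in> cfw" "c \<in> Hom A (R X) K'" "d \<in> Hom A K' (R Y)" "g \<oplus> neg m = d \<cdot> c"
    using factors_through_cocone[OF jX Add_Hom[OF H(3) neg_Hom[OF m]]] RXY by blast
  have gm: "CF.null (g \<oplus> neg m)" using CF.nullI[of c "R X" K' d "R Y"] K' RXY by (simp add: Hom_CF)
  moreover have nm: "CF.null m"
    using CF.nullI[of a' "R X" K "j Y \<cdot> b" "R Y"] K(1) a'(1) jb RXY by (simp add: Hom_CF m_def)
  ultimately have "CF.null (m \<oplus>\<^bsub>CF\<^esub> (g \<oplus> neg m))"
    by (intro CF.null_Add[where X = "R X" and Y = "R Y"])
      (use RXY m H(3) in \<open>simp_all add: Hom_CF Add_Hom neg_Hom\<close>)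
  then show ?thesis using Add_neg_cancel[OF H(3) m] by simp
qed

text \<open>By linearity the difference of two replacements of \<open>f\<close> replaces the zero
  map.\<close>

lemma replaces_unique:
  assumes r: "replaces X Y f h g" and r': "replaces X Y f h' g'"
  shows "CF.Quo.cls g = CF.Quo.cls g'"
proof -
  have f: "f \<in> Hom A X Y" and g: "g \<in> Hom A (R X) (R Y)" and g': "g' \<in> Hom A (R X) (R Y)"
    using assms by (simp_all add: replaces_def)
  have R: "R X \<in> cf" "R Y \<in> cf" using Hom_Obj[OF f] R by blast+
  have "CF.null (g \<oplus> neg g')"
    by (rule replaces_Zero) (use replaces_Add[OF r replaces_neg[OF r']] Add_neg[OF f] in simp)
  then show ?thesis
    by (intro CF.Quo.cls_eqI CF.ideal_rel_neg[where X = "R X" and Y = "R Y"])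
      (use R g g' in \<open>simp_all add: Hom_CF neg_CF[OF g' R]\<close>)
qed

text \<open>Two out of three passes the property from \<open>f\<close> to \<open>h\<close> around
  the first square and from \<open>h\<close> to \<open>g\<close> around the second.\<close>

lemma replaces_Weq:
  assumes "replaces X Y f h g" "f \<in> Weq"
  shows "g \<in> Weq"
proof -
  have H: "f \<in> Hom A X Y" "h \<in> Hom A (Q X) (Q Y)" "g \<in> Hom A (R X) (R Y)"
    and e: "q Y \<cdot> h = f \<cdot> q X" "g \<cdot> j X = j Y \<cdot> h"
    using assms by (simp_all add: replaces_def)
  have XY: "X \<in> Obj A" "Y \<in> Obj A" using Hom_Obj[OF H(1)] by simp_all
  note qj = q[OF XY(1)] q[OF XY(2)] j[OF XY(1)] j[OF XY(2)]
  have "q Y \<cdot> h \<in> Weq" unfolding e(1) using Weq_Comp[of "q X" "Q X" X f Y] H qj assms(2) by blast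
  then have "h \<in> Weq" using Weq_cancel_left[of h "Q X" "Q Y" "q Y" Y] H qj by blast
  then have "g \<cdot> j X \<in> Weq" unfolding e(2) using Weq_Comp[of h "Q X" "Q Y" "j Y" "R Y"] H qj by blast
  then show ?thesis using Weq_cancel_right[of "j X" "Q X" "R X" g "R Y"] H qj by blast
qed

text \<open>\<open>SOME\<close> picks any \<open>g\<close> that admits a suitable \<open>h\<close>;
  by \<open>replaces_unique\<close> its class does not depend on the pick.\<close>

definition repl_functor where
  "repl_functor = \<lparr>FObj = R,
     FArr = (\<lambda>f. CF.Quo.cls (SOME g. \<exists>h. replaces (Dom A f) (Cod A f) f h g))\<rparr>"

abbreviation \<Phi> where "\<Phi> \<equiv> repl_functor"

lemma FObj_repl [simp]: "FObj \<Phi> X = R X"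
  by (simp add: repl_functor_def)

lemma FArr_repl:
  assumes "replaces X Y f h g"
  shows "FArr \<Phi> f = CF.Quo.cls g"
proof -
  have "Dom A f = X" "Cod A f = Y" using assms by (simp_all add: replaces_def Hom_def)
  moreover have "\<exists>h. replaces X Y f h (SOME g. \<exists>h. replaces X Y f h g)"
    by (rule someI_ex) (use assms in blast)
  ultimately show ?thesis using replaces_unique[OF _ assms] by (auto simp: repl_functor_def)
qed

lemma B_replaces: "replaces X Y f h g \<Longrightarrow> CF.Quo.cls g \<in> Hom B (R X) (R Y)"
  using B_Hom[of g "R X" "R Y"] R Hom_Obj[of f X Y] by (simp add: replaces_def)

lemma is_functor_repl: "is_functor A B \<Phi>"
  unfolding is_functor_def
proof (intro conjI ballI impI)
  show "FObj \<Phi> X \<in> Obj B" if "X \<in> Obj A" for X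
    using R[OF that] R_Obj[OF that] by (simp add: CF.AQuo_simps)
  show "FArr \<Phi> (Ide A X) = Ide B (FObj \<Phi> X)" if "X \<in> Obj A" for X
    using FArr_repl[OF replaces_Ide[OF that]] by (simp add: CF.AQuo_simps)
next
  fix f assume "f \<in> Arr A"
  then have "f \<in> Hom A (Dom A f) (Cod A f)" by (simp add: Hom_def)
  then obtain h g where r: "replaces (Dom A f) (Cod A f) f h g" by (rule replacesE)
  then show "FArr \<Phi> f \<in> Hom B (FObj \<Phi> (Dom A f)) (FObj \<Phi> (Cod A f))"
    using B_replaces[OF r] by (simp add: FArr_repl[OF r])
next
  fix f f' assume f: "f \<in> Arr A" "f' \<in> Arr A" "Cod A f = Dom A f'"
  let ?X = "Dom A f" and ?Y = "Dom A f'" and ?Z = "Cod A f'"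
  have "f \<in> Hom A ?X ?Y" using f by (simp add: Hom_def)
  then obtain h g where r: "replaces ?X ?Y f h g" by (rule replacesE)
  have "f' \<in> Hom A ?Y ?Z" using f by (simp add: Hom_def)
  then obtain h' g' where r': "replaces ?Y ?Z f' h' g'" by (rule replacesE)
  have "R ?X \<in> cf" "R ?Y \<in> cf" "R ?Z \<in> cf" using f by (simp_all only: R Dom_Obj Cod_Obj)
  then show "FArr \<Phi> (f' \<cdot> f) = FArr \<Phi> f' \<cdot>\<^bsub>B\<^esub> FArr \<Phi> f"
    unfolding FArr_repl[OF r] FArr_repl[OF r'] FArr_repl[OF replaces_Comp[OF r r']]
    using B_Comp[of g "R ?X" "R ?Y" g' "R ?Z"] r r' by (simp add: replaces_def)
qed

lemma repl_Add:
  assumes f: "f \<in> Hom A X Y" and f': "f' \<in> Hom A X Y"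
  shows "FArr \<Phi> (f \<oplus> f') = FArr \<Phi> f \<oplus>\<^bsub>B\<^esub> FArr \<Phi> f'"
proof -
  obtain h g where r: "replaces X Y f h g" using f by (rule replacesE)
  obtain h' g' where r': "replaces X Y f' h' g'" using f' by (rule replacesE)
  have "R X \<in> cf" "R Y \<in> cf" using R Hom_Obj[OF f] by blast+
  then show ?thesis
    unfolding FArr_repl[OF r] FArr_repl[OF r'] FArr_repl[OF replaces_Add[OF r r']]
    using CF.Add_cls[of g "R X" "R Y" g'] r r' by (simp add: replaces_def Hom_CF)
qed

lemma repl_Weq:
  assumes w: "w \<in> Arr A" "w \<in> Weq"
  shows "is_iso B (FArr \<Phi> w)"
proof -
  have "w \<in> Hom A (Dom A w) (Cod A w)" using w by (simp add: Hom_def)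
  then obtain h g where r: "replaces (Dom A w) (Cod A w) w h g" by (rule replacesE)
  have "R (Dom A w) \<in> cf" "R (Cod A w) \<in> cf" using w by (simp_all only: R Dom_Obj Cod_Obj)
  then show ?thesis
    unfolding FArr_repl[OF r]
    using is_iso_Weq[of g "R (Dom A w)" "R (Cod A w)"] replaces_Weq[OF r w(2)] r
    by (simp add: replaces_def)
qed

end

sublocale replacement \<subseteq> inverting A Weq B \<Phi>
  by unfold_locales (use is_functor_repl repl_Weq in auto)

section \<open>The functor back to the localization and the equivalence\<close>

context replacement
begin

abbreviation \<Phi>' where "\<Phi>' \<equiv> extension"

text \<open>
  Both sides are composites of one map \<open>X \<oplus> K \<rightarrow> Y\<close> with two sections of the projection
  \<open>X \<oplus> K \<rightarrow> X\<close>; as that projection is a weak equivalence, \<open>\<gamma>\<close> identifies the sections.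
\<close>

lemma \<gamma>_eq_through_cfw:
  assumes g: "g \<in> Hom A X Y" and K: "K \<in> cfw" and a: "a \<in> Hom A X K" and b: "b \<in> Hom A K Y"
  shows "\<gamma> (g \<oplus> b \<cdot> a) = \<gamma> g"
proof -
  have O: "X \<in> Obj A" "Y \<in> Obj A" "K \<in> Obj A" using Hom_Obj[OF g] Hom_Obj[OF a] by simp_all
  obtain P i k p r where P: "biproduct A X K P i k p r"
    using additive O(1,3) by (rule additive_category_biproductE)
  then have H: "i \<in> Hom A X P" "k \<in> Hom A K P" "p \<in> Hom A P X" "r \<in> Hom A P K" "P \<in> Obj A"
    and e: "p \<cdot> i = Ide A X" "r \<cdot> k = Ide A K" "r \<cdot> i = Zero A X K" "p \<cdot> k = Zero A K X"
    by (simp_all add: biproduct_def)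
  \<comment> \<open>Since \<open>K\<close> is cofibrant and trivial, \<open>i\<close> is a weak
    equivalence; two out of three on \<open>p \<cdot> i = Ide A X\<close> gives the same for
    \<open>p\<close>.\<close>
  have "i \<in> Weq" using biproduct_Weq[OF P] K by blast
  then have pW: "p \<in> Weq" using Weq_cancel_right[OF H(1,3)] Ide_Weq[OF O(1)] e(1) by simp
  \<comment> \<open>\<open>s\<close> is the graph of \<open>a\<close> and \<open>m\<close> the row
    with entries \<open>g\<close> and \<open>b\<close>. Thus \<open>m\<close> composed with
    \<open>i\<close> is \<open>g\<close>, and composed with \<open>s\<close> it is the perturbed
    map.\<close>
  define s where "s = i \<oplus> k \<cdot> a"
  define m where "m = g \<cdot> p \<oplus> b \<cdot> r"
  have s: "s \<in> Hom A X P" unfolding s_def by (rule Add_Hom[OF H(1) Comp_Hom[OF a H(2)]])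
  have m: "m \<in> Hom A P Y"
    unfolding m_def by (rule Add_Hom[OF Comp_Hom[OF H(3) g] Comp_Hom[OF H(4) b]])
  have ps: "p \<cdot> s = Ide A X"
    unfolding s_def using H a e O Comp_reassoc[OF e(4)] by (auto simp: Hom_def)
  have rs: "r \<cdot> s = a"
    unfolding s_def using H a e O Comp_reassoc[OF e(2)] by (auto simp: Hom_def)
  have "m \<cdot> s = g \<cdot> (p \<cdot> s) \<oplus> b \<cdot> (r \<cdot> s)"
    unfolding m_def using H s g b by (auto simp: Hom_def)
  then have ms: "m \<cdot> s = g \<oplus> b \<cdot> a" using ps rs g by (simp add: Hom_def)
  have "m \<cdot> i = g \<cdot> (p \<cdot> i) \<oplus> b \<cdot> (r \<cdot> i)"
    unfolding m_def using H g b by (auto simp: Hom_def)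
  then have mi: "m \<cdot> i = g" using e g b O by (simp add: Hom_def)
  have "\<gamma> p \<cdot>\<^bsub>Loc\<^esub> \<gamma> s = \<gamma> p \<cdot>\<^bsub>Loc\<^esub> \<gamma> i"
    using \<gamma>_Comp[OF s H(3)] \<gamma>_Comp[OF H(1,3)] ps e(1) by simp
  moreover have "\<gamma>_inv p \<cdot>\<^bsub>Loc\<^esub> (\<gamma> p \<cdot>\<^bsub>Loc\<^esub> \<gamma> t) = \<gamma> t" if t: "t \<in> Hom A X P" for t
    using Loc.Comp_reassoc[OF \<gamma>_inv(1)[OF H(3) pW]] \<gamma>_Hom[OF t] \<gamma>_Hom[OF H(3)] \<gamma>_inv_Hom[OF H(3) pW]
    by (simp add: Hom_def)
  ultimately have "\<gamma> s = \<gamma> i" using s H(1) by metis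
  then show ?thesis using \<gamma>_Comp[OF s m] \<gamma>_Comp[OF H(1) m] ms mi by simp
qed

lemma \<gamma>_ideal:
  assumes "(f, g) \<in> ideal_rel CF cfw"
  shows "\<gamma> f = \<gamma> g"
proof -
  obtain X Y n where g: "g \<in> Hom CF X Y" and n: "n \<in> Hom CF X Y" "CF.null n" and f: "f = g \<oplus> n"
    using assms unfolding CF.ideal_rel_iff by auto
  obtain K a b where "K \<in> cfw" "a \<in> Hom CF X K" "b \<in> Hom CF K Y" "n = b \<cdot>\<^bsub>CF\<^esub> a"
    using n(2,1) by (rule CF.nullE)
  then show ?thesis using \<gamma>_eq_through_cfw[of g X Y K a b] g f by (simp add: Hom_full_subcat)
qed

text \<open>Functors are pairs of total functions, so the restriction of the localization functor to
  \<open>CF\<close> is the same term. It descends because of \<open>\<gamma>_ideal\<close>.\<close>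

definition \<Psi> where
  "\<Psi> = CF.Quo.descend (localization_functor A Weq)"

lemma FObj_\<Psi> [simp]: "FObj \<Psi> X = X"
  by (simp add: \<Psi>_def)

lemma FArr_\<Psi>:
  assumes "f \<in> Hom A X Y" "X \<in> cf" "Y \<in> cf"
  shows "FArr \<Psi> (CF.Quo.cls f) = \<gamma> f"
  using CF.Quo.FArr_descend[of "localization_functor A Weq" f] \<gamma>_ideal assms
  by (auto simp: \<Psi>_def Hom_def Arr_full_subcat)

lemma is_functor_\<Psi>: "is_functor B Loc \<Psi>"
proof -
  have "is_functor CF Loc (localization_functor A Weq)"
    using is_functor_localization by (auto simp: is_functor_def Arr_full_subcat)
  then have "is_functor CF.Quo.Quo Loc \<Psi>"
    unfolding \<Psi>_def by (rule CF.Quo.is_functor_descend) (simp add: \<gamma>_ideal)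
  then show ?thesis using is_functor_truncate(1)[of B Loc \<Psi>] by simp
qed

text \<open>The addition \<open>H\<close> is arbitrary: sums in \<open>B\<close> are computed on
  representatives in \<open>A\<close>, where additivity of the localization functor into
  \<open>H\<close> applies.\<close>

lemma \<Psi>_Add:
  assumes H: "additive_functor A H (localization_functor A Weq)"
    and c: "c \<in> Hom B X Y" and d: "d \<in> Hom B X Y"
  shows "FArr \<Psi> (c \<oplus>\<^bsub>B\<^esub> d) = FArr \<Psi> c \<oplus>\<^bsub>H\<^esub> FArr \<Psi> d"
proof -
  obtain f where f: "f \<in> Hom A X Y" "X \<in> cf" "Y \<in> cf" "c = CF.Quo.cls f" using c by (rule B_HomE)
  obtain g where g: "g \<in> Hom A X Y" "d = CF.Quo.cls g" using d by (rule B_HomE)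
  have "c \<oplus>\<^bsub>B\<^esub> d = CF.Quo.cls (f \<oplus> g)"
    using CF.Add_cls[of f X Y g] f g by (simp add: Hom_CF)
  then show ?thesis
    using additive_functor_Add[OF is_category H f(1) g(1)] f g
    by (simp add: FArr_\<Psi>[OF _ f(2,3)] Add_Hom)
qed

lemma \<Psi>_replaces:
  assumes "replaces X Y f h g"
  shows "FArr \<Psi> (FArr \<Phi>' (\<gamma> f)) = \<gamma> g"
proof -
  have f: "f \<in> Hom A X Y" and g: "g \<in> Hom A (R X) (R Y)" using assms by (simp_all add: replaces_def)
  then have "f \<in> Arr A" "R X \<in> cf" "R Y \<in> cf" using R Hom_Obj[OF f] by (auto simp: Hom_def)
  then show ?thesis using FArr_\<Psi>[OF g] FArr_repl[OF assms] by simp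
qed

lemma nat_iso_Loc: "naturally_isomorphic Loc Loc (comp_functor \<Psi> \<Phi>') id_functor"
proof (rule naturally_isomorphic_sym)
  show F: "is_functor Loc Loc (comp_functor \<Psi> \<Phi>')"
    by (rule is_functor_comp[OF extension_functor is_functor_\<Psi>])
  show I: "is_functor Loc Loc id_functor" by (rule is_functor_id[OF Loc.is_category])
  \<comment> \<open>The zigzag read from \<open>X\<close> to \<open>R X\<close>: its leg
    \<open>q X\<close> has to be traversed backwards, which is why the isomorphism is built out of
    the identity functor and then inverted.\<close>
  define \<eta> where "\<eta> X = \<gamma> (j X) \<cdot>\<^bsub>Loc\<^esub> \<gamma>_inv (q X)" for X
  have \<eta>: "\<eta> X \<in> Hom Loc X (R X)" "is_iso Loc (\<eta> X)" if X: "X \<in> Obj A" for X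
  proof -
    note qj = q[OF X] j[OF X]
    have 1: "\<gamma> (j X) \<in> Hom Loc (Q X) (R X)" "\<gamma>_inv (q X) \<in> Hom Loc X (Q X)"
      using \<gamma>_Hom[of "j X"] \<gamma>_inv_Hom[of "q X"] qj by blast+
    then show "\<eta> X \<in> Hom Loc X (R X)" unfolding \<eta>_def by (rule Loc.Comp_Hom[rotated])
    have 2: "is_iso Loc (\<gamma> (j X))" by (rule \<gamma>_iso) (use qj in \<open>auto simp: Hom_def\<close>)
    have 3: "is_iso Loc (\<gamma>_inv (q X))"
      using Loc.is_isoI[OF 1(2) \<gamma>_Hom] \<gamma>_inv[of "q X"] qj by blast
    show "is_iso Loc (\<eta> X)" unfolding \<eta>_def by (rule Loc.is_iso_Comp[OF 3 2 1(2,1)])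
  qed
  \<comment> \<open>On an arrow of \<open>A\<close> the claim is the pasting of the two squares of
    \<open>replaces\<close>, the first one with its \<open>q\<close> sides reversed.
    \<open>Loc_natural\<close> extends it to all of \<open>Loc\<close>.\<close>
  have nat: "\<eta> Y \<cdot>\<^bsub>Loc\<^esub> \<gamma> f = FArr \<Psi> (FArr \<Phi>' (\<gamma> f)) \<cdot>\<^bsub>Loc\<^esub> \<eta> X" if f: "f \<in> Hom A X Y" for f X Y
  proof -
    have XY: "X \<in> Obj A" "Y \<in> Obj A" using Hom_Obj[OF f] by simp_all
    obtain h g where r: "replaces X Y f h g" using f by (rule replacesE)
    then have hg: "h \<in> Hom A (Q X) (Q Y)" "g \<in> Hom A (R X) (R Y)"
      "q Y \<cdot> h = f \<cdot> q X" "g \<cdot> j X = j Y \<cdot> h" by (simp_all add: replaces_def)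
    have qW: "q X \<in> Weq" "q Y \<in> Weq" using q XY by blast+
    note H = \<gamma>_Hom[OF f] \<gamma>_Hom[OF hg(1)] \<gamma>_Hom[OF hg(2)] \<gamma>_Hom[OF j_Hom[OF XY(1)]]
      \<gamma>_Hom[OF j_Hom[OF XY(2)]] \<gamma>_Hom[OF q_Hom[OF XY(1)]] \<gamma>_Hom[OF q_Hom[OF XY(2)]]
      \<gamma>_inv_Hom[OF q_Hom[OF XY(1)] qW(1)] \<gamma>_inv_Hom[OF q_Hom[OF XY(2)] qW(2)]
    have "\<gamma> f \<cdot>\<^bsub>Loc\<^esub> \<gamma> (q X) = \<gamma> (q Y) \<cdot>\<^bsub>Loc\<^esub> \<gamma> h"
      using \<gamma>_Comp[OF hg(1) q_Hom[OF XY(2)]] \<gamma>_Comp[OF q_Hom[OF XY(1)] f] hg(3) by simp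
    then have sq: "\<gamma> h \<cdot>\<^bsub>Loc\<^esub> \<gamma>_inv (q X) = \<gamma>_inv (q Y) \<cdot>\<^bsub>Loc\<^esub> \<gamma> f"
      by (rule Loc.inverse_square[OF H(6,8) \<gamma>_inv(2,1)[OF q_Hom[OF XY(1)] qW(1)] H(7,9)
            \<gamma>_inv(1)[OF q_Hom[OF XY(2)] qW(2)] H(2,1)])
    have sq': "\<gamma> g \<cdot>\<^bsub>Loc\<^esub> \<gamma> (j X) = \<gamma> (j Y) \<cdot>\<^bsub>Loc\<^esub> \<gamma> h"
      using \<gamma>_Comp[OF hg(1) j_Hom[OF XY(2)]] \<gamma>_Comp[OF j_Hom[OF XY(1)] hg(2)] hg(4) by simp
    have "\<eta> Y \<cdot>\<^bsub>Loc\<^esub> \<gamma> f = \<gamma> (j Y) \<cdot>\<^bsub>Loc\<^esub> (\<gamma> h \<cdot>\<^bsub>Loc\<^esub> \<gamma>_inv (q X))"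
      unfolding sq \<eta>_def using H by (simp add: Hom_def)
    also have "\<dots> = \<gamma> g \<cdot>\<^bsub>Loc\<^esub> \<eta> X"
      unfolding \<eta>_def using H Loc.Comp_reassoc[OF sq'] by (simp add: Hom_def)
    finally show ?thesis unfolding \<Psi>_replaces[OF r] .
  qed
  have "\<eta> Y \<cdot>\<^bsub>Loc\<^esub> c = FArr \<Psi> (FArr \<Phi>' c) \<cdot>\<^bsub>Loc\<^esub> \<eta> X"
    if c: "c \<in> Hom Loc X Y" for c X Y
    using Loc_natural[OF Loc.is_category I F _ _ c, of \<eta>] \<eta> nat by simp
  then show "naturally_isomorphic Loc Loc id_functor (comp_functor \<Psi> \<Phi>')"
    unfolding naturally_isomorphic_def using \<eta>
    by (intro exI[of _ \<eta>]) (auto simp: Hom_def)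
qed (rule Loc.is_category)+

lemma nat_iso_B: "naturally_isomorphic B B (comp_functor \<Phi>' \<Psi>) id_functor"
proof (rule naturally_isomorphic_sym)
  show "is_functor B B (comp_functor \<Phi>' \<Psi>)"
    by (rule is_functor_comp[OF is_functor_\<Psi> extension_functor])
  show "is_functor B B id_functor" by (rule is_functor_id[OF B.is_category])
  define \<theta> where "\<theta> X = CF.Quo.cls (j X) \<cdot>\<^bsub>B\<^esub> B.inverse_arr (CF.Quo.cls (q X))" for X
  \<comment> \<open>For fibrant \<open>X\<close> the fibration \<open>q X\<close> makes
    \<open>Q X\<close> fibrant, so the whole zigzag lies in \<open>cf\<close> and its legs are
    invertible in \<open>B\<close> by \<open>is_iso_Weq\<close>.\<close>
  have QX: "Q X \<in> cf" if "X \<in> cf" for X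
    using fib_Comp[of X "q X" "Q X"] Q[OF cf_Obj[OF that]] q[OF cf_Obj[OF that]] that by blast
  have qB: "CF.Quo.cls (q X) \<in> Hom B (Q X) X" "is_iso B (CF.Quo.cls (q X))"
    and jB: "CF.Quo.cls (j X) \<in> Hom B (Q X) (R X)" "is_iso B (CF.Quo.cls (j X))" if X: "X \<in> cf" for X
    using B_Hom[of "q X" "Q X" X] is_iso_Weq[of "q X" "Q X" X] B_Hom[of "j X" "Q X" "R X"]
      is_iso_Weq[of "j X" "Q X" "R X"] q[OF cf_Obj[OF X]] j[OF cf_Obj[OF X]] QX[OF X] X
      R[OF cf_Obj[OF X]] by blast+
  note inv = B.inverse_arr[OF qB(2,1)]
  have \<theta>: "\<theta> X \<in> Hom B X (R X)" "is_iso B (\<theta> X)" if X: "X \<in> cf" for X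
    unfolding \<theta>_def
    by (rule B.Comp_Hom[OF inv(1)[OF X X] jB(1)[OF X]],
        rule B.is_iso_Comp[OF inv(4)[OF X X] jB(2)[OF X] inv(1)[OF X X] jB(1)[OF X]])
  have "\<theta> Y \<cdot>\<^bsub>B\<^esub> c = FArr \<Phi>' (FArr \<Psi> c) \<cdot>\<^bsub>B\<^esub> \<theta> X" if c: "c \<in> Hom B X Y" for c X Y
  proof -
    obtain f where f: "f \<in> Hom A X Y" and X: "X \<in> cf" and Y: "Y \<in> cf" and cf: "c = CF.Quo.cls f"
      using c by (rule B_HomE)
    obtain h g where r: "replaces X Y f h g" using f by (rule replacesE)
    then have hg: "h \<in> Hom A (Q X) (Q Y)" "g \<in> Hom A (R X) (R Y)"
      "q Y \<cdot> h = f \<cdot> q X" "g \<cdot> j X = j Y \<cdot> h" by (simp_all add: replaces_def)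
    have R: "R X \<in> cf" "R Y \<in> cf" using R cf_Obj X Y by blast+
    note QXY = QX[OF X] QX[OF Y] and XY = cf_Obj[OF X] cf_Obj[OF Y]
    have "FArr \<Phi>' (FArr \<Psi> c) = CF.Quo.cls g"
      unfolding cf FArr_\<Psi>[OF f X Y] FArr_repl[OF r, symmetric]
      by (rule FArr_extension) (use f in \<open>simp add: Hom_def\<close>)
    moreover have "\<theta> Y \<cdot>\<^bsub>B\<^esub> c = CF.Quo.cls g \<cdot>\<^bsub>B\<^esub> \<theta> X"
    proof -
      note H = c B_Hom[OF hg(1) QXY] B_Hom[OF hg(2) R] qB(1)[OF X] qB(1)[OF Y] inv(1)[OF X X]
        inv(1)[OF Y Y] jB(1)[OF X] jB(1)[OF Y]
      have "c \<cdot>\<^bsub>B\<^esub> CF.Quo.cls (q X) = CF.Quo.cls (q Y) \<cdot>\<^bsub>B\<^esub> CF.Quo.cls h"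
        using B_Comp[OF q_Hom[OF XY(1)] f QXY(1) X Y] B_Comp[OF hg(1) q_Hom[OF XY(2)] QXY Y] hg(3) cf
        by simp
      then have sq: "CF.Quo.cls h \<cdot>\<^bsub>B\<^esub> B.inverse_arr (CF.Quo.cls (q X)) =
          B.inverse_arr (CF.Quo.cls (q Y)) \<cdot>\<^bsub>B\<^esub> c"
        by (rule B.inverse_square[OF H(4,6) inv(3,2)[OF X X] H(5,7) inv(2)[OF Y Y] H(2,1)])
      have sq': "CF.Quo.cls g \<cdot>\<^bsub>B\<^esub> CF.Quo.cls (j X) = CF.Quo.cls (j Y) \<cdot>\<^bsub>B\<^esub> CF.Quo.cls h"
        using B_Comp[OF j_Hom[OF XY(1)] hg(2) QXY(1) R] B_Comp[OF hg(1) j_Hom[OF XY(2)] QXY R(2)] hg(4)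
        by simp
      have "\<theta> Y \<cdot>\<^bsub>B\<^esub> c =
          CF.Quo.cls (j Y) \<cdot>\<^bsub>B\<^esub> (CF.Quo.cls h \<cdot>\<^bsub>B\<^esub> B.inverse_arr (CF.Quo.cls (q X)))"
        unfolding sq \<theta>_def using H by (simp add: Hom_def)
      also have "\<dots> = CF.Quo.cls g \<cdot>\<^bsub>B\<^esub> \<theta> X"
        unfolding \<theta>_def using H B.Comp_reassoc[OF sq'] by (simp add: Hom_def)
      finally show ?thesis .
    qed
    ultimately show ?thesis by simp
  qed
  then show "naturally_isomorphic B B id_functor (comp_functor \<Phi>' \<Psi>)"
    unfolding naturally_isomorphic_def using \<theta>
    by (intro exI[of _ \<theta>]) (auto simp: Hom_def CF.AQuo_simps(1))
qed (rule B.is_category)+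

section \<open>The addition on the localization and additivity of the equivalence\<close>

lemma extension_bij:
  assumes "X \<in> Obj A" "Y \<in> Obj A"
  shows "bij_betw (FArr \<Phi>') (Hom Loc X Y) (Hom B (R X) (R Y))"
proof (rule bij_betw_imageI)
  show "inj_on (FArr \<Phi>') (Hom Loc X Y)"
    using equivalence_faithful[OF Loc.is_category extension_functor is_functor_\<Psi> nat_iso_Loc]
    by (rule inj_onI)
  have "\<exists>c\<in>Hom Loc X Y. FArr \<Phi>' c = d" if "d \<in> Hom B (R X) (R Y)" for d
    using equivalence_full[OF Loc.is_category B.is_category extension_functor is_functor_\<Psi>
        nat_iso_Loc nat_iso_B, of X Y d] assms that by simp
  moreover have "FArr \<Phi>' c \<in> Hom B (R X) (R Y)" if "c \<in> Hom Loc X Y" for c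
    using functor_Hom[OF extension_functor that] by simp
  ultimately show "FArr \<Phi>' ` Hom Loc X Y = Hom B (R X) (R Y)" by blast
qed

text \<open>The addition of \<open>B\<close> pulled back along the fully faithful functor \<open>\<Phi>'\<close>.\<close>

definition Loc_add :: "('a, ('a, 'b) path set) add_cat" where
  "Loc_add = cat.extend Loc (add_cat.fields
     (\<lambda>c d. inv_into (Hom Loc (Dom Loc c) (Cod Loc c)) (FArr \<Phi>') (FArr \<Phi>' c \<oplus>\<^bsub>B\<^esub> FArr \<Phi>' d))
     (\<lambda>X Y. inv_into (Hom Loc X Y) (FArr \<Phi>') (Zero B (R X) (R Y))))"

lemma truncate_Loc_add: "cat.truncate Loc_add = Loc"
  by (simp add: Loc_add_def cat.truncate_def cat.extend_def)

lemma Hom_Loc_add: "Hom Loc_add X Y = Hom Loc X Y" and Obj_Loc_add: "Obj Loc_add = Obj A"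
  using Hom_truncate[of Loc_add] truncate_simps(1)[of Loc_add] by (simp_all add: truncate_Loc_add)

lemma Add_Loc_add:
  assumes c: "c \<in> Hom Loc X Y" and d: "d \<in> Hom Loc X Y"
  shows "c \<oplus>\<^bsub>Loc_add\<^esub> d \<in> Hom Loc X Y \<and> FArr \<Phi>' (c \<oplus>\<^bsub>Loc_add\<^esub> d) = FArr \<Phi>' c \<oplus>\<^bsub>B\<^esub> FArr \<Phi>' d"
proof -
  have XY: "X \<in> Obj A" "Y \<in> Obj A" using Loc.Hom_Obj[OF c] by simp_all
  have "FArr \<Phi>' c \<oplus>\<^bsub>B\<^esub> FArr \<Phi>' d \<in> FArr \<Phi>' ` Hom Loc X Y"
    using B.Add_Hom[OF functor_Hom[OF extension_functor c] functor_Hom[OF extension_functor d]]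
    by (simp add: bij_betw_imp_surj_on[OF extension_bij[OF XY]])
  moreover have "c \<oplus>\<^bsub>Loc_add\<^esub> d = inv_into (Hom Loc X Y) (FArr \<Phi>') (FArr \<Phi>' c \<oplus>\<^bsub>B\<^esub> FArr \<Phi>' d)"
    using c by (simp add: Loc_add_def cat.extend_def add_cat.fields_def Hom_def)
  ultimately show ?thesis by (simp add: inv_into_into f_inv_into_f)
qed

lemma Zero_Loc_add:
  assumes XY: "X \<in> Obj A" "Y \<in> Obj A"
  shows "Zero Loc_add X Y \<in> Hom Loc X Y \<and> FArr \<Phi>' (Zero Loc_add X Y) = Zero B (R X) (R Y)"
proof -
  have "Zero B (R X) (R Y) \<in> FArr \<Phi>' ` Hom Loc X Y"
    using B.Zero_Hom[of "R X" "R Y"] functor_Obj[OF is_functor_repl] XY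
    by (simp add: bij_betw_imp_surj_on[OF extension_bij[OF XY]])
  moreover have "Zero Loc_add X Y = inv_into (Hom Loc X Y) (FArr \<Phi>') (Zero B (R X) (R Y))"
    by (simp add: Loc_add_def cat.extend_def add_cat.fields_def)
  ultimately show ?thesis by (simp add: inv_into_into f_inv_into_f)
qed

lemma additive_localization_Loc_add: "additive_localization A Weq Loc_add"
proof -
  have cat: "is_category Loc_add"
    using Loc.is_category is_category_truncate[of Loc_add] by (simp add: truncate_Loc_add)
  have "is_functor Loc_add B \<Phi>'"
    using extension_functor is_functor_truncate(1)[of Loc_add B \<Phi>'] by (simp add: truncate_Loc_add)
  then have pre: "preadditive_category Loc_add"
    by (rule preadditive_category_pullback[OF cat B.preadditive])
      (simp_all add: Hom_Loc_add Obj_Loc_add extension_bij Add_Loc_add Zero_Loc_add)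
  have "is_functor A Loc_add (localization_functor A Weq)"
    using is_functor_localization is_functor_truncate(2)[of A Loc_add "localization_functor A Weq"]
    by (simp add: truncate_Loc_add)
  \<comment> \<open>Injectivity of \<open>\<Phi>'\<close> on Hom-sets reduces this to additivity of
    the replacement functor.\<close>
  moreover have "\<gamma> (f \<oplus> g) = \<gamma> f \<oplus>\<^bsub>Loc_add\<^esub> \<gamma> g"
    if XY: "X \<in> Obj A" "Y \<in> Obj A" and f: "f \<in> Hom A X Y" and g: "g \<in> Hom A X Y" for X Y f g
  proof -
    note fg = Add_Hom[OF f g]
    have ext: "FArr \<Phi>' (\<gamma> t) = FArr \<Phi> t" if "t \<in> Hom A X Y" for t
      by (rule FArr_extension) (use that in \<open>simp add: Hom_def\<close>)
    have "FArr \<Phi>' (\<gamma> (f \<oplus> g)) = FArr \<Phi>' (\<gamma> f \<oplus>\<^bsub>Loc_add\<^esub> \<gamma> g)"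
      unfolding Add_Loc_add[OF \<gamma>_Hom[OF f] \<gamma>_Hom[OF g], THEN conjunct2] ext[OF f] ext[OF g] ext[OF fg]
      by (rule repl_Add[OF f g])
    then show ?thesis
      using bij_betw_imp_inj_on[OF extension_bij[OF XY]] \<gamma>_Hom[OF fg]
        Add_Loc_add[OF \<gamma>_Hom[OF f] \<gamma>_Hom[OF g], THEN conjunct1] by (blast dest: inj_onD)
  qed
  ultimately have add: "additive_functor A Loc_add (localization_functor A Weq)"
    by (simp add: additive_functor_def)
  \<comment> \<open>The localization functor is additive and the identity on objects, so the zero
    object and the biproducts come from \<open>A\<close>.\<close>
  have "additive_category Loc_add"
    by (rule additive_category_image[OF additive pre add]) (simp add: Obj_Loc_add)
  with add show ?thesis by (simp add: additive_localization_def truncate_Loc_add)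
qed

text \<open>For an arbitrary \<open>H\<close> additivity is obtained for \<open>\<Psi>\<close> first
  and passed to \<open>\<Phi>'\<close> by \<open>additive_functor_inverse\<close>. The natural
  isomorphisms are those of the underlying category.\<close>

lemma additively_equivalent_localization:
  assumes "additive_localization A Weq H"
  shows "additively_equivalent H B"
proof -
  have H: "cat.truncate H = Loc" and add: "additive_category H"
    and \<gamma>: "additive_functor A H (localization_functor A Weq)"
    using assms by (simp_all add: additive_localization_def)
  have pre: "preadditive_category H" using add by (simp add: additive_category_def)
  have \<Phi>: "is_functor H B \<Phi>'"
    using extension_functor is_functor_truncate(1)[of H B \<Phi>'] by (simp add: H)
  have "is_functor B H \<Psi>"
    using is_functor_\<Psi> is_functor_truncate(2)[of B H \<Psi>] by (simp add: H)
  then have \<Psi>: "additive_functor B H \<Psi>"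
    using \<Psi>_Add[OF \<gamma>] by (simp add: additive_functor_def)
  have nH: "naturally_isomorphic H H (comp_functor \<Psi> \<Phi>') id_functor"
    using nat_iso_Loc naturally_isomorphic_truncate(1)[of H H "comp_functor \<Psi> \<Phi>'" id_functor]
      naturally_isomorphic_truncate(2)[of "cat.truncate H" H "comp_functor \<Psi> \<Phi>'" id_functor] by (simp add: H)
  have "additive_functor H B \<Phi>'"
    by (rule additive_functor_inverse[OF pre B.preadditive \<Phi> \<Psi> nH nat_iso_B])
  then show ?thesis
    unfolding additively_equivalent_def
    using add CF.additive_category_AQuo \<Psi> nH nat_iso_B by blast
qed

end

lemma (in additive_model) replacement_exists: "\<exists>Q R q j. replacement A CoFib Fib Weq Q R q j"
proof -
  have "\<exists>Q q. Q \<in> cof \<and> q \<in> Hom A Q X \<and> q \<in> Fib \<and> q \<in> Weq" if X: "X \<in> Obj A" for X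
  proof -
    obtain Q i q where iq: "i \<in> Hom A Z\<^sub>0 Q" "q \<in> Hom A Q X" "i \<in> CoFib" "q \<in> Fib \<inter> Weq"
      using Zero_Hom[OF zero_Obj X] by (rule triv_fib.factorE)
    have "i = Zero A Z\<^sub>0 Q" by (rule zero_object_Zero(1)[OF zero_object_zero iq(1)])
    then have "Q \<in> cof" using iq(3) Hom_Obj[OF iq(1)] by (simp add: cof_iff)
    then show ?thesis using iq by blast
  qed
  then obtain Q q where Q: "\<And>X. X \<in> Obj A \<Longrightarrow> Q X \<in> cof \<and> q X \<in> Hom A (Q X) X \<and> q X \<in> Fib \<and> q X \<in> Weq"
    by metis
  have "\<exists>R j. R \<in> cf \<and> j \<in> Hom A X R \<and> j \<in> CoFib \<and> j \<in> Weq" if X: "X \<in> cof" for X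
  proof -
    have "X \<in> Obj A" using X by (simp add: cof_iff)
    obtain R j p where jp: "j \<in> Hom A X R" "p \<in> Hom A R Z\<^sub>0" "j \<in> CoFib \<inter> Weq" "p \<in> Fib"
      using Zero_Hom[OF \<open>X \<in> Obj A\<close> zero_Obj] by (rule triv_cofib.factorE)
    have "p = Zero A R Z\<^sub>0" by (rule zero_object_Zero(2)[OF zero_object_zero jp(2)])
    then have "R \<in> fib" using jp(4) Hom_Obj[OF jp(1)] by (simp add: fib_iff)
    moreover have "R \<in> cof" using cof_Comp[OF X jp(1)] jp(3) by blast
    ultimately show ?thesis using jp by blast
  qed
  then obtain R j where R: "\<And>X. X \<in> cof \<Longrightarrow> R X \<in> cf \<and> j X \<in> Hom A X (R X) \<and> j X \<in> CoFib \<and> j X \<in> Weq"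
    by metis
  \<comment> \<open>The fibrant replacement was chosen for cofibrant objects, hence the composition
    with \<open>Q\<close>.\<close>
  have "replacement A CoFib Fib Weq Q (R \<circ> Q) q (j \<circ> Q)"
    by unfold_locales (use Q R in auto)
  then show ?thesis by blast
qed

theorem theorem1p1:
  fixes A :: "('o, 'a) add_cat" and CoFib Fib Weq :: "'a set"
  defines "\<C> \<equiv> cofibrant_objects A CoFib"
    and "\<F> \<equiv> fibrant_objects A Fib"
    and "\<W> \<equiv> trivial_objects A Weq"
  assumes "additive_category A"
    and "weakly_idempotent_complete A"
    and "model_structure A CoFib Fib Weq"
  shows "full_additive_subcategory A (\<C> \<inter> \<F>) \<and>
    full_additive_subcategory (full_subcat A (\<C> \<inter> \<F>)) (\<C> \<inter> \<F> \<inter> \<W>) \<and>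
    (\<exists>H. additive_localization A Weq H) \<and>
    (\<forall>H. additive_localization A Weq H \<longrightarrow>
       additively_equivalent H
         (additive_quotient (full_subcat A (\<C> \<inter> \<F>)) (\<C> \<inter> \<F> \<inter> \<W>)))"
proof -
  interpret additive_model A CoFib Fib Weq
    using assms(4,6) by unfold_locales
  obtain Q R q j where "replacement A CoFib Fib Weq Q R q j" using replacement_exists by blast
  then interpret replacement A CoFib Fib Weq Q R q j .
  show ?thesis
    unfolding \<C>_def \<F>_def \<W>_def
    using full_additive_cf full_additive_cfw additive_localization_Loc_add
      additively_equivalent_localization by blast
qed

end
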